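(* Let $u_0\in H^1_0(\Omega)$ and $f\in L^\infty(0,\infty;L^2(\Omega))$, and let $u$ be the strong solution of $u_t-(1+\|\nabla u(t)\|^2)\Delta u=f$ in $\Omega\times(0,\infty)$, $u=0$ on $\partial\Omega\times(0,\infty)$, $u(\cdot,0)=u_0$. Then for $0<\alpha<\frac{\lambda_1}{2}$ and all $t>0$, with $\beta=1-\frac{2\alpha}{\lambda_1}>0$, $$\|\nabla u(t)\|^2+\beta e^{-2\alpha t}\int_0^te^{2\alpha s}\|\Delta u(s)\|^2ds+2e^{-2\alpha t}\int_0^te^{2\alpha s}\|\nabla u(s)\|^2\|\Delta u(s)\|^2ds\le e^{-2\alpha t}\|\nabla u_0\|^2+\frac1{2\alpha}\|f\|^2_{L^\infty(L^2)}(1-e^{-2\alpha t})\le\|\nabla u_0\|^2+\frac1{2\alpha}\|f\|^2_{L^\infty(L^2)}.$$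
   Context: $\Omega\subset\mathbb{R}^d$ ($d=2$ or $3$) is a bounded convex polygonal or polyhedral domain; $\|\cdot\|$ is the $L^2(\Omega)$-norm. $\lambda_1>0$ is the smallest eigenvalue of $-\Delta$ with homogeneous Dirichlet boundary condition. The strong solution satisfies, for every $T>0$, $u\in C([0,T];H^1_0(\Omega))\cap L^2(0,T;H^2(\Omega))$ and $u_t\in L^2(0,T;L^2(\Omega))$, with the equation holding almost everywhere. *)

theory Defs
  imports "HOL-Analysis.Analysis" "HOL-Probability.Essential_Supremum"
begin

section \<open>Domains and test functions\<close>

definition convex_polytopal_domain :: "'a::euclidean_space set \<Rightarrow> bool" where
  "convex_polytopal_domain \<Omega> \<longleftrightarrow>
     open \<Omega> \<and> \<Omega> \<noteq> {} \<and> bounded \<Omega> \<and> convex \<Omega> \<and> polytope (closure \<Omega>)"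

text \<open>A multi-index is a list of basis vectors, to be differentiated in one after another;
  its order is the length of the list.\<close>

fun iterated_partial :: "'a::euclidean_space list \<Rightarrow> ('a \<Rightarrow> real) \<Rightarrow> 'a \<Rightarrow> real" where
  "iterated_partial [] \<phi> = \<phi>"
| "iterated_partial (b # bs) \<phi> =
     (\<lambda>x. frechet_derivative (iterated_partial bs \<phi>) (at x) b)"

definition smooth_fun :: "('a::euclidean_space \<Rightarrow> real) \<Rightarrow> bool" where
  "smooth_fun \<phi> \<longleftrightarrow>
     (\<forall>bs x. set bs \<subseteq> Basis \<longrightarrow> iterated_partial bs \<phi> differentiable (at x))"

definition test_functions :: "'a::euclidean_space set \<Rightarrow> ('a \<Rightarrow> real) set" where
  "test_functions \<Omega> =
     {\<phi>. smooth_fun \<phi> \<and> compact (closure {x. \<phi> x \<noteq> 0}) \<and> closure {x. \<phi> x \<noteq> 0} \<subseteq> \<Omega>}"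

section \<open>Lebesgue and Sobolev spaces\<close>

text \<open>Elements of \<open>L\<^sup>2(\<Omega>)\<close> and of the Sobolev spaces are represented by functions on the whole
  space, of which only the values almost everywhere on \<open>\<Omega>\<close> matter. The norms below are therefore
  seminorms on representatives, and equality of two elements is equality almost everywhere
  on \<open>\<Omega>\<close>.\<close>

definition L2_space :: "'a::euclidean_space set \<Rightarrow> ('a \<Rightarrow> real) set" where
  "L2_space \<Omega> = {v. v \<in> borel_measurable (lebesgue_on \<Omega>) \<and>
                    integrable (lebesgue_on \<Omega>) (\<lambda>x. (v x)\<^sup>2)}"

definition L2_norm :: "'a::euclidean_space set \<Rightarrow> ('a \<Rightarrow> 'b::real_normed_vector) \<Rightarrow> real" where
  "L2_norm \<Omega> v = sqrt (\<integral>x. (norm (v x))\<^sup>2 \<partial>lebesgue_on \<Omega>)"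

definition is_weak_deriv ::
  "'a::euclidean_space set \<Rightarrow> 'a list \<Rightarrow> ('a \<Rightarrow> real) \<Rightarrow> ('a \<Rightarrow> real) \<Rightarrow> bool" where
  "is_weak_deriv \<Omega> bs v g \<longleftrightarrow>
     (\<forall>\<phi>\<in>test_functions \<Omega>.
        (\<integral>x. v x * iterated_partial bs \<phi> x \<partial>lebesgue_on \<Omega>)
          = (-1) ^ length bs * (\<integral>x. g x * \<phi> x \<partial>lebesgue_on \<Omega>))"

text \<open>Square integrable weak derivatives are unique up to null sets, so the choice of a
  representative is immaterial wherever one exists.\<close>

definition weak_deriv ::
  "'a::euclidean_space set \<Rightarrow> 'a list \<Rightarrow> ('a \<Rightarrow> real) \<Rightarrow> 'a \<Rightarrow> real" where
  "weak_deriv \<Omega> bs v = (SOME g. g \<in> L2_space \<Omega> \<and> is_weak_deriv \<Omega> bs v g)"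

definition weak_grad :: "'a::euclidean_space set \<Rightarrow> ('a \<Rightarrow> real) \<Rightarrow> 'a \<Rightarrow> 'a" where
  "weak_grad \<Omega> v x = (\<Sum>b\<in>Basis. weak_deriv \<Omega> [b] v x *\<^sub>R b)"

definition weak_laplacian :: "'a::euclidean_space set \<Rightarrow> ('a \<Rightarrow> real) \<Rightarrow> 'a \<Rightarrow> real" where
  "weak_laplacian \<Omega> v x = (\<Sum>b\<in>Basis. weak_deriv \<Omega> [b, b] v x)"

definition sobolev_space :: "nat \<Rightarrow> 'a::euclidean_space set \<Rightarrow> ('a \<Rightarrow> real) set" where
  "sobolev_space k \<Omega> =
     {v \<in> L2_space \<Omega>. \<forall>bs. set bs \<subseteq> Basis \<and> length bs \<le> k \<longrightarrow>
        (\<exists>g\<in>L2_space \<Omega>. is_weak_deriv \<Omega> bs v g)}"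

definition sobolev_norm :: "nat \<Rightarrow> 'a::euclidean_space set \<Rightarrow> ('a \<Rightarrow> real) \<Rightarrow> real" where
  "sobolev_norm k \<Omega> v =
     sqrt (\<Sum>bs\<in>{bs. set bs \<subseteq> Basis \<and> length bs \<le> k}. (L2_norm \<Omega> (weak_deriv \<Omega> bs v))\<^sup>2)"

definition H10_space :: "'a::euclidean_space set \<Rightarrow> ('a \<Rightarrow> real) set" where
  "H10_space \<Omega> =
     {v \<in> sobolev_space 1 \<Omega>. \<exists>\<phi>::nat \<Rightarrow> 'a \<Rightarrow> real. (\<forall>n. \<phi> n \<in> test_functions \<Omega>) \<and>
        (\<lambda>n. sobolev_norm 1 \<Omega> (\<lambda>x. v x - \<phi> n x)) \<longlonglongrightarrow> 0}"

section \<open>Eigenvalues of the Dirichlet Laplacian\<close>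

text \<open>The eigenvalue equation \<open>-\<Delta>v = \<mu>v\<close>, \<open>v = 0\<close> on the boundary, in its usual weak form.\<close>

definition dirichlet_eigenvalue :: "'a::euclidean_space set \<Rightarrow> real \<Rightarrow> bool" where
  "dirichlet_eigenvalue \<Omega> \<mu> \<longleftrightarrow>
     (\<exists>v\<in>H10_space \<Omega>. \<not> (AE x in lebesgue_on \<Omega>. v x = 0) \<and>
        (\<forall>\<phi>\<in>H10_space \<Omega>.
           (\<integral>x. weak_grad \<Omega> v x \<bullet> weak_grad \<Omega> \<phi> x \<partial>lebesgue_on \<Omega>)
             = \<mu> * (\<integral>x. v x * \<phi> x \<partial>lebesgue_on \<Omega>)))"

definition smallest_dirichlet_eigenvalue :: "'a::euclidean_space set \<Rightarrow> real \<Rightarrow> bool" where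
  "smallest_dirichlet_eigenvalue \<Omega> l \<longleftrightarrow>
     dirichlet_eigenvalue \<Omega> l \<and> (\<forall>\<mu>. dirichlet_eigenvalue \<Omega> \<mu> \<longrightarrow> l \<le> \<mu>)"

section \<open>Functions of time with values in a function space\<close>

text \<open>The library's Bochner integral needs the value space to be a type. The value spaces here
  depend on \<open>\<Omega>\<close>, so they are given by a set \<open>V\<close> of representatives and a seminorm \<open>N\<close>, and the
  definitions follow the library's with these in place of the type and its norm. The time
  interval carries the (complete) Lebesgue measure, so that what happens at a null set of
  times, where \<open>u t\<close> may fail to lie in \<open>V\<close>, has no influence.\<close>

definition bochner_measurable ::
  "real set \<Rightarrow> ('a \<Rightarrow> real) set \<Rightarrow> (('a \<Rightarrow> real) \<Rightarrow> real) \<Rightarrow> (real \<Rightarrow> 'a \<Rightarrow> real) \<Rightarrow> bool" where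
  "bochner_measurable I V N u \<longleftrightarrow>
     (AE t in lebesgue_on I. u t \<in> V) \<and>
     (\<exists>s::nat \<Rightarrow> real \<Rightarrow> 'a \<Rightarrow> real.
        (\<forall>n. simple_function (lebesgue_on I) (s n) \<and> s n ` I \<subseteq> V) \<and>
        (AE t in lebesgue_on I. (\<lambda>n. N (\<lambda>x. s n t x - u t x)) \<longlonglongrightarrow> 0))"

definition simple_integral_on :: "real set \<Rightarrow> (real \<Rightarrow> 'a \<Rightarrow> real) \<Rightarrow> 'a \<Rightarrow> real" where
  "simple_integral_on I s x =
     (\<Sum>y\<in>s ` I. measure (lebesgue_on I) {t \<in> I. s t = y} * y x)"

definition has_bochner_integral_on ::
  "real set \<Rightarrow> ('a \<Rightarrow> real) set \<Rightarrow> (('a \<Rightarrow> real) \<Rightarrow> real) \<Rightarrow> (real \<Rightarrow> 'a \<Rightarrow> real)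
     \<Rightarrow> ('a \<Rightarrow> real) \<Rightarrow> bool" where
  "has_bochner_integral_on I V N u z \<longleftrightarrow>
     z \<in> V \<and> bochner_measurable I V N u \<and>
     (\<exists>s::nat \<Rightarrow> real \<Rightarrow> 'a \<Rightarrow> real.
        (\<forall>n. simple_function (lebesgue_on I) (s n) \<and> s n ` I \<subseteq> V \<and>
             emeasure (lebesgue_on I) {t \<in> I. s n t \<noteq> (\<lambda>x. 0)} < \<infinity>) \<and>
        (\<lambda>n. \<integral>\<^sup>+t. ennreal (N (\<lambda>x. s n t x - u t x)) \<partial>lebesgue_on I) \<longlonglongrightarrow> 0 \<and>
        (\<lambda>n. N (\<lambda>x. simple_integral_on I (s n) x - z x)) \<longlonglongrightarrow> 0)"

definition bochner_L2 ::
  "real set \<Rightarrow> ('a \<Rightarrow> real) set \<Rightarrow> (('a \<Rightarrow> real) \<Rightarrow> real) \<Rightarrow> (real \<Rightarrow> 'a \<Rightarrow> real) set" where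
  "bochner_L2 I V N =
     {u. bochner_measurable I V N u \<and> integrable (lebesgue_on I) (\<lambda>t. (N (u t))\<^sup>2)}"

definition bochner_Linf_norm ::
  "real set \<Rightarrow> (('a \<Rightarrow> real) \<Rightarrow> real) \<Rightarrow> (real \<Rightarrow> 'a \<Rightarrow> real) \<Rightarrow> ereal" where
  "bochner_Linf_norm I N u = esssup (lebesgue_on I) (\<lambda>t. ereal (N (u t)))"

definition bochner_Linf ::
  "real set \<Rightarrow> ('a \<Rightarrow> real) set \<Rightarrow> (('a \<Rightarrow> real) \<Rightarrow> real) \<Rightarrow> (real \<Rightarrow> 'a \<Rightarrow> real) set" where
  "bochner_Linf I V N = {u. bochner_measurable I V N u \<and> bochner_Linf_norm I N u < \<infinity>}"

definition continuous_into ::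
  "real set \<Rightarrow> ('a \<Rightarrow> real) set \<Rightarrow> (('a \<Rightarrow> real) \<Rightarrow> real) \<Rightarrow> (real \<Rightarrow> 'a \<Rightarrow> real) set" where
  "continuous_into I V N =
     {u. \<forall>t\<in>I. u t \<in> V \<and> ((\<lambda>s. N (\<lambda>x. u s x - u t x)) \<longlongrightarrow> 0) (at t within I)}"

text \<open>\<open>w\<close> is the distributional derivative of \<open>u\<close> on \<open>(0,T)\<close> with values in \<open>L\<^sup>2(\<Omega>)\<close>: for all
  scalar test functions \<open>\<eta>\<close> on \<open>(0,T)\<close>, the \<open>L\<^sup>2(\<Omega>)\<close>-valued integrals of \<open>\<eta>' u\<close> and of \<open>-\<eta> w\<close>
  agree.\<close>

definition is_weak_time_deriv ::
  "'a::euclidean_space set \<Rightarrow> real \<Rightarrow> (real \<Rightarrow> 'a \<Rightarrow> real) \<Rightarrow> (real \<Rightarrow> 'a \<Rightarrow> real) \<Rightarrow> bool" where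
  "is_weak_time_deriv \<Omega> T u w \<longleftrightarrow>
     (\<forall>\<eta>\<in>test_functions {0<..<T}. \<exists>z.
        has_bochner_integral_on {0<..<T} (L2_space \<Omega>) (L2_norm \<Omega>)
          (\<lambda>t x. deriv \<eta> t * u t x) z \<and>
        has_bochner_integral_on {0<..<T} (L2_space \<Omega>) (L2_norm \<Omega>)
          (\<lambda>t x. - (\<eta> t * w t x)) z)"

section \<open>Strong solutions of the Kirchhoff-type heat equation\<close>

definition strong_solution ::
  "'a::euclidean_space set \<Rightarrow> (real \<Rightarrow> 'a \<Rightarrow> real) \<Rightarrow> ('a \<Rightarrow> real) \<Rightarrow> (real \<Rightarrow> 'a \<Rightarrow> real) \<Rightarrow> bool"
where
  "strong_solution \<Omega> f u\<^sub>0 u \<longleftrightarrow>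
     (\<forall>T>0. u \<in> continuous_into {0..T} (H10_space \<Omega>) (sobolev_norm 1 \<Omega>) \<and>
            u \<in> bochner_L2 {0<..<T} (sobolev_space 2 \<Omega>) (sobolev_norm 2 \<Omega>)) \<and>
     (AE x in lebesgue_on \<Omega>. u 0 x = u\<^sub>0 x) \<and>
     (\<exists>u\<^sub>t.
        (\<forall>T>0. u\<^sub>t \<in> bochner_L2 {0<..<T} (L2_space \<Omega>) (L2_norm \<Omega>) \<and>
               is_weak_time_deriv \<Omega> T u u\<^sub>t) \<and>
        (AE t in lebesgue_on {0<..}. AE x in lebesgue_on \<Omega>.
           u\<^sub>t t x - (1 + (L2_norm \<Omega> (weak_grad \<Omega> (u t)))\<^sup>2) * weak_laplacian \<Omega> (u t) x = f t x))"

end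

theory Submission
  imports Defs "HOL-Complex_Analysis.Great_Picard"
begin

text \<open>Formally, testing the equation with \<open>-\<Delta>u\<close> gives, with \<open>E = |\<nabla>u|\<^sup>2\<close>,
  \<open>E' + 2 (1 + E) |\<Delta>u|\<^sup>2 = -2 (f, \<Delta>u) \<le> |f|\<^sup>2 + |\<Delta>u|\<^sup>2\<close>. Multiplying by \<open>exp (2 \<alpha> t)\<close>, absorbing
  \<open>2 \<alpha> E\<close> by means of \<open>\<lambda>\<^sub>1 E \<le> |\<Delta>u|\<^sup>2\<close> and integrating yields the estimate.

  The bound \<open>\<lambda>\<^sub>1 E \<le> |\<Delta>u|\<^sup>2\<close> follows from Green's formula and the Poincare inequality with constant
  \<open>\<lambda>\<^sub>1\<close>. The latter holds because the infimum of the Rayleigh quotient over test functions is itself an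
  eigenvalue: by Rellich compactness a minimizing sequence converges in \<open>L\<^sup>2\<close>, hence in \<open>H\<^sup>1\<close>.

  The derivative of \<open>E\<close> is replaced by backward difference quotients averaged over time. Convexity
  and Green's formula give \<open>E(t) - E(t - h) \<le> -2 (u(t) - u(t - h), \<Delta>u(t))\<close>, where the right-hand side
  is the integral of \<open>-2 (u\<^sub>t(r), \<Delta>u(t))\<close> over \<open>r\<close> in \<open>[t - h, t]\<close>. Dividing by \<open>h\<close>, integrating over
  \<open>t\<close> and letting \<open>h\<close> tend to \<open>0\<close> gives the integrated energy inequality.\<close>

text \<open>The Laplacian of u is merely square integrable in time, and
  \<open>is_weak_time_deriv\<close> tests with scalar functions of time only, hence gives usable
  identities after pairing with one fixed y in \<open>L2\<close>. So \<Delta>u(t) cannot be paired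
  with the time derivative directly. In (u(t) - u(t - h), \<Delta>u(t)) the second factor is frozen
  while the derivative is integrated over [t - h, t]; what remains is a Lebesgue differentiation
  statement in the mean for square integrable functions of time with values in \<open>L2\<close>.
  Young's inequality for (f, \<Delta>u) is taken with constant 1 and costs one of the two copies of
  |\<Delta>u|^2. Absorbing 2\<alpha>E costs the fraction 2\<alpha>/\<lambda>_1 of the other, and
  \<beta> is what is left. The factor 1/(2\<alpha>) comes from integrating the weight. Elements of
  the spaces are representatives under a seminorm, and weak derivatives are chosen by
  \<open>SOME\<close>; linearity of the latter holds only almost everywhere, which is why so many
  steps pass through norms and inner products.\<close>

lemma discriminant_le:
  fixes a b c :: real
  assumes "0 \<le> c" and nonneg: "\<And>t. 0 \<le> a - 2 * t * b + t\<^sup>2 * c"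
  shows "b\<^sup>2 \<le> a * c"
proof (cases "c = 0")
  case True
  have "b = 0"
  proof (rule ccontr)
    assume "b \<noteq> 0"
    \<comment> \<open>With c = 0 the quadratic is affine in t, and at this t it takes the value
      -1.\<close>
    then have "2 * ((a + 1) / (2 * b)) * b = a + 1" by simp
    then show False using nonneg[of "(a + 1) / (2 * b)"] True by simp
  qed
  with True show ?thesis by simp
next
  case False
  with assms have c: "c > 0" by simp
  \<comment> \<open>The quadratic attains its minimum at b / c.\<close>
  have "0 \<le> a - 2 * (b / c) * b + (b / c)\<^sup>2 * c" by (rule nonneg)
  also have "\<dots> = a - b\<^sup>2 / c" using c by (simp add: field_simps power2_eq_square)
  finally show ?thesis using c by (simp add: field_simps)
qed

section \<open>The space of square integrable functions\<close>

text \<open>The integral of a non-integrable product is 0 by convention, so homogeneity below holds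
  for arbitrary functions, whereas additivity needs membership in \<open>L2_space\<close>.\<close>

definition L2_inner :: "'a::euclidean_space set \<Rightarrow> ('a \<Rightarrow> real) \<Rightarrow> ('a \<Rightarrow> real) \<Rightarrow> real" where
  "L2_inner \<Omega> v w = (\<integral>x. v x * w x \<partial>lebesgue_on \<Omega>)"

lemma L2_measurable: "v \<in> L2_space \<Omega> \<Longrightarrow> v \<in> borel_measurable (lebesgue_on \<Omega>)"
  by (simp add: L2_space_def)

lemma integrable_mult_L2:
  assumes "v \<in> L2_space \<Omega>" "w \<in> L2_space \<Omega>"
  shows "integrable (lebesgue_on \<Omega>) (\<lambda>x. v x * w x)"
proof (rule Bochner_Integration.integrable_bound)
  show "integrable (lebesgue_on \<Omega>) (\<lambda>x. (v x)\<^sup>2 + (w x)\<^sup>2)"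
    using assms by (simp add: L2_space_def)
  show "(\<lambda>x. v x * w x) \<in> borel_measurable (lebesgue_on \<Omega>)"
    using assms[THEN L2_measurable] by measurable
  show "AE x in lebesgue_on \<Omega>. norm (v x * w x) \<le> norm ((v x)\<^sup>2 + (w x)\<^sup>2)"
  proof (rule AE_I2)
    fix x
    have "2 * \<bar>v x * w x\<bar> \<le> (v x)\<^sup>2 + (w x)\<^sup>2"
      using sum_squares_bound[of "\<bar>v x\<bar>" "\<bar>w x\<bar>"] by (simp add: abs_mult)
    then show "norm (v x * w x) \<le> norm ((v x)\<^sup>2 + (w x)\<^sup>2)" by simp
  qed
qed

lemma L2_add:
  assumes "v \<in> L2_space \<Omega>" "w \<in> L2_space \<Omega>"
  shows "(\<lambda>x. v x + w x) \<in> L2_space \<Omega>"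
proof -
  have "integrable (lebesgue_on \<Omega>) (\<lambda>x. (v x)\<^sup>2 + (w x)\<^sup>2 + 2 * (v x * w x))"
    using assms integrable_mult_L2[OF assms] by (auto simp: L2_space_def)
  moreover have "(\<lambda>x. v x + w x) \<in> borel_measurable (lebesgue_on \<Omega>)"
    using assms[THEN L2_measurable] by measurable
  ultimately show ?thesis by (simp add: L2_space_def power2_sum mult.assoc)
qed

lemma L2_scale:
  assumes "v \<in> L2_space \<Omega>"
  shows "(\<lambda>x. c * v x) \<in> L2_space \<Omega>"
proof -
  have "(\<lambda>x. c * v x) \<in> borel_measurable (lebesgue_on \<Omega>)"
    using L2_measurable[OF assms] by measurable
  with assms show ?thesis by (auto simp: L2_space_def power_mult_distrib)
qed

lemma L2_zero [simp]: "(\<lambda>x. 0) \<in> L2_space \<Omega>"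
  by (simp add: L2_space_def)

lemma L2_diff:
  assumes "v \<in> L2_space \<Omega>" "w \<in> L2_space \<Omega>"
  shows "(\<lambda>x. v x - w x) \<in> L2_space \<Omega>"
  using L2_add[OF assms(1) L2_scale[OF assms(2), of "-1"]] by simp

lemma L2_sum:
  assumes "\<And>i. i \<in> I \<Longrightarrow> v i \<in> L2_space \<Omega>"
  shows "(\<lambda>x. \<Sum>i\<in>I. v i x) \<in> L2_space \<Omega>"
  using assms by (induction I rule: infinite_finite_induct) (auto intro: L2_add)

lemma L2_inner_commute: "L2_inner \<Omega> v w = L2_inner \<Omega> w v"
  by (simp add: L2_inner_def mult.commute)

lemma L2_inner_scale_left [simp]: "L2_inner \<Omega> (\<lambda>x. c * v x) w = c * L2_inner \<Omega> v w"
  by (simp add: L2_inner_def mult.assoc)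

lemma L2_inner_scale_right [simp]: "L2_inner \<Omega> v (\<lambda>x. c * w x) = c * L2_inner \<Omega> v w"
  by (simp add: L2_inner_def mult.left_commute)

lemma L2_inner_zero_left [simp]: "L2_inner \<Omega> (\<lambda>x. 0) w = 0"
  by (simp add: L2_inner_def)

lemma L2_inner_add_left:
  assumes "v \<in> L2_space \<Omega>" "v' \<in> L2_space \<Omega>" "w \<in> L2_space \<Omega>"
  shows "L2_inner \<Omega> (\<lambda>x. v x + v' x) w = L2_inner \<Omega> v w + L2_inner \<Omega> v' w"
  unfolding L2_inner_def
  using assms by (simp add: distrib_right integrable_mult_L2)

lemma L2_inner_diff_left:
  assumes "v \<in> L2_space \<Omega>" "v' \<in> L2_space \<Omega>" "w \<in> L2_space \<Omega>"
  shows "L2_inner \<Omega> (\<lambda>x. v x - v' x) w = L2_inner \<Omega> v w - L2_inner \<Omega> v' w"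
  unfolding L2_inner_def
  using assms by (simp add: left_diff_distrib integrable_mult_L2)

lemma L2_inner_add_right:
  assumes "v \<in> L2_space \<Omega>" "w \<in> L2_space \<Omega>" "w' \<in> L2_space \<Omega>"
  shows "L2_inner \<Omega> v (\<lambda>x. w x + w' x) = L2_inner \<Omega> v w + L2_inner \<Omega> v w'"
  using L2_inner_add_left[of w \<Omega> w' v] assms by (simp add: L2_inner_commute)

lemma L2_inner_diff_right:
  assumes "v \<in> L2_space \<Omega>" "w \<in> L2_space \<Omega>" "w' \<in> L2_space \<Omega>"
  shows "L2_inner \<Omega> v (\<lambda>x. w x - w' x) = L2_inner \<Omega> v w - L2_inner \<Omega> v w'"
  using L2_inner_diff_left[of w \<Omega> w' v] assms by (simp add: L2_inner_commute)

lemma L2_inner_sum_left: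
  assumes "\<And>i. i \<in> I \<Longrightarrow> v i \<in> L2_space \<Omega>" "w \<in> L2_space \<Omega>"
  shows "L2_inner \<Omega> (\<lambda>x. \<Sum>i\<in>I. v i x) w = (\<Sum>i\<in>I. L2_inner \<Omega> (v i) w)"
  using assms
proof (induction I rule: infinite_finite_induct)
  case (insert i I)
  then show ?case by (simp add: L2_inner_add_left L2_sum)
qed auto

lemma L2_inner_cong_AE:
  assumes "v \<in> L2_space \<Omega>" "v' \<in> L2_space \<Omega>" "w \<in> L2_space \<Omega>"
    and "AE x in lebesgue_on \<Omega>. v x = v' x"
  shows "L2_inner \<Omega> v w = L2_inner \<Omega> v' w"
  unfolding L2_inner_def
  by (rule integral_cong_AE)
    (use assms in \<open>auto intro!: borel_measurable_integrable integrable_mult_L2\<close>)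

lemma L2_norm_nonneg [simp]: "0 \<le> L2_norm \<Omega> v"
  by (simp add: L2_norm_def)

lemma L2_inner_self_nonneg [simp]: "0 \<le> L2_inner \<Omega> v v"
  by (simp add: L2_inner_def)

lemma L2_norm_sq:
  fixes v :: "'a::euclidean_space \<Rightarrow> real"
  shows "(L2_norm \<Omega> v)\<^sup>2 = L2_inner \<Omega> v v"
  by (simp add: L2_norm_def L2_inner_def power2_eq_square)

lemma L2_norm_zero [simp]: "L2_norm \<Omega> (\<lambda>x. 0::real) = 0"
  by (simp add: L2_norm_def)

lemma L2_norm_minus_commute:
  fixes v w :: "'a::euclidean_space \<Rightarrow> real"
  shows "L2_norm \<Omega> (\<lambda>x. v x - w x) = L2_norm \<Omega> (\<lambda>x. w x - v x)"
  by (simp add: L2_norm_def power2_commute)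

lemma L2_norm_cong_AE:
  fixes v v' :: "'a::euclidean_space \<Rightarrow> real"
  assumes "v \<in> L2_space \<Omega>" "v' \<in> L2_space \<Omega>" "AE x in lebesgue_on \<Omega>. v x = v' x"
  shows "L2_norm \<Omega> v = L2_norm \<Omega> v'"
proof -
  have "L2_inner \<Omega> v v = L2_inner \<Omega> v' v'"
    using L2_inner_cong_AE[of v \<Omega> v' v] L2_inner_cong_AE[of v \<Omega> v' v'] assms
    by (simp add: L2_inner_commute)
  then have "(L2_norm \<Omega> v)\<^sup>2 = (L2_norm \<Omega> v')\<^sup>2" by (simp add: L2_norm_sq)
  then show ?thesis by simp
qed

lemma L2_norm_scale:
  fixes v :: "'a::euclidean_space \<Rightarrow> real"
  shows "L2_norm \<Omega> (\<lambda>x. c * v x) = \<bar>c\<bar> * L2_norm \<Omega> v"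
proof -
  have "(L2_norm \<Omega> (\<lambda>x. c * v x))\<^sup>2 = (\<bar>c\<bar> * L2_norm \<Omega> v)\<^sup>2"
    by (simp add: L2_norm_sq power_mult_distrib) (simp add: power2_eq_square)
  then show ?thesis by simp
qed

text \<open>The squared norm of v - t w is a nonnegative quadratic in t, so its discriminant is not
  positive.\<close>

lemma L2_Cauchy_Schwarz:
  assumes "v \<in> L2_space \<Omega>" "w \<in> L2_space \<Omega>"
  shows "\<bar>L2_inner \<Omega> v w\<bar> \<le> L2_norm \<Omega> v * L2_norm \<Omega> w"
proof -
  have "(L2_inner \<Omega> v w)\<^sup>2 \<le> L2_inner \<Omega> v v * L2_inner \<Omega> w w"
  proof (rule discriminant_le)
    show "0 \<le> L2_inner \<Omega> w w" by simp
    fix t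
    have "0 \<le> L2_inner \<Omega> (\<lambda>x. v x - t * w x) (\<lambda>x. v x - t * w x)" by simp
    also have "\<dots> = L2_inner \<Omega> v v - 2 * t * L2_inner \<Omega> v w + t\<^sup>2 * L2_inner \<Omega> w w"
      using assms by (simp add: L2_inner_diff_left L2_inner_diff_right L2_diff L2_scale
          L2_inner_commute[of _ w v] algebra_simps power2_eq_square)
    finally show "0 \<le> L2_inner \<Omega> v v - 2 * t * L2_inner \<Omega> v w + t\<^sup>2 * L2_inner \<Omega> w w" .
  qed
  also have "\<dots> = (L2_norm \<Omega> v * L2_norm \<Omega> w)\<^sup>2"
    by (simp add: L2_norm_sq power_mult_distrib)
  finally have "\<bar>L2_inner \<Omega> v w\<bar> \<le> \<bar>L2_norm \<Omega> v * L2_norm \<Omega> w\<bar>"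
    by (rule abs_le_square_iff[THEN iffD2])
  then show ?thesis by (simp add: abs_mult)
qed

lemma L2_norm_triangle:
  fixes v w :: "'a::euclidean_space \<Rightarrow> real"
  assumes "v \<in> L2_space \<Omega>" "w \<in> L2_space \<Omega>"
  shows "L2_norm \<Omega> (\<lambda>x. v x + w x) \<le> L2_norm \<Omega> v + L2_norm \<Omega> w"
proof (rule power2_le_imp_le)
  have "(L2_norm \<Omega> (\<lambda>x. v x + w x))\<^sup>2
      = (L2_norm \<Omega> v)\<^sup>2 + 2 * L2_inner \<Omega> v w + (L2_norm \<Omega> w)\<^sup>2"
    using assms unfolding L2_norm_sq
    by (simp only: L2_inner_add_left L2_inner_add_right L2_add L2_inner_commute[of _ w v])
  also have "\<dots> \<le> (L2_norm \<Omega> v + L2_norm \<Omega> w)\<^sup>2"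
    using L2_Cauchy_Schwarz[OF assms] by (simp add: power2_sum)
  finally show "(L2_norm \<Omega> (\<lambda>x. v x + w x))\<^sup>2 \<le> (L2_norm \<Omega> v + L2_norm \<Omega> w)\<^sup>2" .
qed simp

lemma L2_norm_sum_le:
  fixes v :: "'i \<Rightarrow> 'a::euclidean_space \<Rightarrow> real"
  assumes "\<And>i. i \<in> I \<Longrightarrow> v i \<in> L2_space \<Omega>"
  shows "L2_norm \<Omega> (\<lambda>x. \<Sum>i\<in>I. v i x) \<le> (\<Sum>i\<in>I. L2_norm \<Omega> (v i))"
  using assms
proof (induction I rule: infinite_finite_induct)
  case (insert i I)
  have "L2_norm \<Omega> (\<lambda>x. v i x + (\<Sum>i\<in>I. v i x)) \<le> L2_norm \<Omega> (v i) + L2_norm \<Omega> (\<lambda>x. \<Sum>i\<in>I. v i x)"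
    by (rule L2_norm_triangle) (use insert in \<open>auto intro: L2_sum\<close>)
  with insert show ?case by force
qed auto

lemma L2_norm_triangle_diff:
  fixes v w z :: "'a::euclidean_space \<Rightarrow> real"
  assumes "v \<in> L2_space \<Omega>" "w \<in> L2_space \<Omega>" "z \<in> L2_space \<Omega>"
  shows "L2_norm \<Omega> (\<lambda>x. v x - z x) \<le> L2_norm \<Omega> (\<lambda>x. v x - w x) + L2_norm \<Omega> (\<lambda>x. w x - z x)"
  using L2_norm_triangle[OF L2_diff[OF assms(1,2)] L2_diff[OF assms(2,3)]] by simp

lemma L2_norm_diff_ge:
  fixes v w :: "'a::euclidean_space \<Rightarrow> real"
  assumes "v \<in> L2_space \<Omega>" "w \<in> L2_space \<Omega>"
  shows "\<bar>L2_norm \<Omega> v - L2_norm \<Omega> w\<bar> \<le> L2_norm \<Omega> (\<lambda>x. v x - w x)"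
  using L2_norm_triangle_diff[of v \<Omega> w "\<lambda>x. 0"] L2_norm_triangle_diff[of w \<Omega> v "\<lambda>x. 0"] assms
    L2_norm_minus_commute[of \<Omega> v w]
  by auto

lemma L2_norm_tendsto:
  fixes v :: "'b \<Rightarrow> 'a::euclidean_space \<Rightarrow> real"
  assumes "\<And>n. v n \<in> L2_space \<Omega>" "w \<in> L2_space \<Omega>"
    and "((\<lambda>n. L2_norm \<Omega> (\<lambda>x. v n x - w x)) \<longlongrightarrow> 0) G"
  shows "((\<lambda>n. L2_norm \<Omega> (v n)) \<longlongrightarrow> L2_norm \<Omega> w) G"
proof (rule Lim_transform2[OF tendsto_const])
  show "((\<lambda>n. L2_norm \<Omega> w - L2_norm \<Omega> (v n)) \<longlongrightarrow> 0) G"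
  proof (rule tendsto_rabs_zero_cancel, rule tendsto_sandwich[OF _ _ tendsto_const assms(3)])
    show "\<forall>\<^sub>F n in G. \<bar>L2_norm \<Omega> w - L2_norm \<Omega> (v n)\<bar> \<le> L2_norm \<Omega> (\<lambda>x. v n x - w x)"
      using L2_norm_diff_ge[OF assms(1,2)] by (simp add: abs_minus_commute)
  qed simp
qed

text \<open>Membership is required only eventually, because the lemma is also applied along
  \<open>at t within {0..T}\<close>, where the functions are known to lie in the space only for
  times in the interval.\<close>

lemma L2_inner_tendsto:
  assumes "\<forall>\<^sub>F n in G. v n \<in> L2_space \<Omega> \<and> w n \<in> L2_space \<Omega>" "v' \<in> L2_space \<Omega>" "w' \<in> L2_space \<Omega>"
    and lim: "((\<lambda>n. L2_norm \<Omega> (\<lambda>x. v n x - v' x)) \<longlongrightarrow> 0) G"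
      "((\<lambda>n. L2_norm \<Omega> (\<lambda>x. w n x - w' x)) \<longlongrightarrow> 0) G"
  shows "((\<lambda>n. L2_inner \<Omega> (v n) (w n)) \<longlongrightarrow> L2_inner \<Omega> v' w') G"
proof (rule Lim_transform[OF tendsto_const])
  \<comment> \<open>The norm of \<open>w n\<close> has no bound given in advance and is replaced by
    that of w' plus the distance to w'.\<close>
  define B where "B n = L2_norm \<Omega> (\<lambda>x. v n x - v' x) * (L2_norm \<Omega> w' + L2_norm \<Omega> (\<lambda>x. w n x - w' x))
      + L2_norm \<Omega> v' * L2_norm \<Omega> (\<lambda>x. w n x - w' x)" for n
  have B: "(B \<longlongrightarrow> 0) G"
  proof -
    have "(B \<longlongrightarrow> 0 * (L2_norm \<Omega> w' + 0) + L2_norm \<Omega> v' * 0) G"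
      unfolding B_def by (intro tendsto_intros lim)
    then show ?thesis by simp
  qed
  show "((\<lambda>n. L2_inner \<Omega> (v n) (w n) - L2_inner \<Omega> v' w') \<longlongrightarrow> 0) G"
  proof (rule tendsto_rabs_zero_cancel, rule tendsto_sandwich[OF _ _ tendsto_const B])
    show "\<forall>\<^sub>F n in G. \<bar>L2_inner \<Omega> (v n) (w n) - L2_inner \<Omega> v' w'\<bar> \<le> B n"
      using assms(1)
    proof eventually_elim
      case (elim n)
      then have n: "v n \<in> L2_space \<Omega>" "w n \<in> L2_space \<Omega>" by auto
      have "L2_inner \<Omega> (v n) (w n) - L2_inner \<Omega> v' w'
          = L2_inner \<Omega> (\<lambda>x. v n x - v' x) (w n) + L2_inner \<Omega> v' (\<lambda>x. w n x - w' x)"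
        using n assms(2,3) by (simp add: L2_inner_diff_left L2_inner_diff_right)
      also have "\<bar>\<dots>\<bar> \<le> L2_norm \<Omega> (\<lambda>x. v n x - v' x) * L2_norm \<Omega> (w n)
          + L2_norm \<Omega> v' * L2_norm \<Omega> (\<lambda>x. w n x - w' x)"
        by (intro order_trans[OF abs_triangle_ineq] add_mono L2_Cauchy_Schwarz)
          (use n assms(2,3) in \<open>auto intro: L2_diff\<close>)
      also have "\<dots> \<le> B n"
        unfolding B_def using L2_norm_triangle_diff[of "w n" \<Omega> w' "\<lambda>x. 0"] n assms(3)
        by (auto intro!: add_mono mult_left_mono)
      finally show ?case .
    qed
  qed simp
qed

section \<open>Domains of finite measure: embedding into the integrable functions, and
  completeness\<close>

lemma L2_one:
  assumes "\<Omega> \<in> lmeasurable"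
  shows "(\<lambda>x. 1) \<in> L2_space \<Omega>"
  using finite_measure_lebesgue_on[OF assms] by (simp add: L2_space_def finite_measure.integrable_const)

lemma L2_imp_integrable:
  assumes "\<Omega> \<in> lmeasurable" "v \<in> L2_space \<Omega>"
  shows "integrable (lebesgue_on \<Omega>) v"
  using integrable_mult_L2[OF assms(2) L2_one[OF assms(1)]] by simp

text \<open>Cauchy-Schwarz against the constant 1. Norm bounds thereby control integrals of absolute
  values, both for completeness and for the smoothing operators.\<close>

lemma L2_integral_abs_le:
  assumes "\<Omega> \<in> lmeasurable" "v \<in> L2_space \<Omega>"
  shows "(\<integral>x. \<bar>v x\<bar> \<partial>lebesgue_on \<Omega>) \<le> L2_norm \<Omega> v * L2_norm \<Omega> (\<lambda>x. 1::real)"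
proof -
  have abs: "(\<lambda>x. \<bar>v x\<bar>) \<in> L2_space \<Omega>"
    using assms(2) by (auto simp: L2_space_def)
  have "(\<integral>x. \<bar>v x\<bar> \<partial>lebesgue_on \<Omega>) = L2_inner \<Omega> (\<lambda>x. \<bar>v x\<bar>) (\<lambda>x. 1)"
    by (simp add: L2_inner_def)
  also have "\<dots> \<le> L2_norm \<Omega> (\<lambda>x. \<bar>v x\<bar>) * L2_norm \<Omega> (\<lambda>x. 1::real)"
    using L2_Cauchy_Schwarz[OF abs L2_one[OF assms(1)]] by simp
  finally show ?thesis by (simp add: L2_norm_def)
qed

text \<open>The Riesz-Fischer argument: along a subsequence the increments have norm below 2^-k, so
  their absolute values have an integrable sum and the telescoping series converges almost
  everywhere; Fatou's lemma then controls the distance of the whole sequence to the limit.\<close>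

lemma L2_complete:
  fixes v :: "nat \<Rightarrow> 'a::euclidean_space \<Rightarrow> real"
  assumes \<Omega>: "\<Omega> \<in> lmeasurable" and v: "\<And>n. v n \<in> L2_space \<Omega>"
    and Cauchy: "\<And>e. e > 0 \<Longrightarrow> \<exists>N. \<forall>m\<ge>N. \<forall>n\<ge>N. L2_norm \<Omega> (\<lambda>x. v m x - v n x) < e"
  obtains w where "w \<in> L2_space \<Omega>" "(\<lambda>n. L2_norm \<Omega> (\<lambda>x. v n x - w x)) \<longlonglongrightarrow> 0"
proof -
  let ?M = "lebesgue_on \<Omega>"
  have vm [measurable]: "v n \<in> borel_measurable ?M" for n using v by (rule L2_measurable)
  have "\<exists>N. \<forall>m\<ge>N. \<forall>n\<ge>N. L2_norm \<Omega> (\<lambda>x. v m x - v n x) < (1/2)^k" for k :: nat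
    by (rule Cauchy) simp
  then obtain N where N: "\<And>k m n. m \<ge> N k \<Longrightarrow> n \<ge> N k \<Longrightarrow> L2_norm \<Omega> (\<lambda>x. v m x - v n x) < (1/2)^k"
    by metis
  \<comment> \<open>The sum makes \<open>r k\<close> at least \<open>N k\<close>, and
    \<open>r (Suc k)\<close> at least \<open>N k\<close>; the summand k makes \<open>r\<close>
    unbounded.\<close>
  define r where "r k = (\<Sum>i\<le>k. N i) + k" for k
  have rN: "r k \<ge> N k" for k
    unfolding r_def by (simp add: member_le_sum trans_le_add1)
  have rSuc: "r (Suc k) \<ge> N k" for k
    using rN[of k] unfolding r_def by simp
  have rk: "r k \<ge> k" for k by (simp add: r_def)
  define d where "d k x = v (r (Suc k)) x - v (r k) x" for k x
  have dL: "d k \<in> L2_space \<Omega>" for k unfolding d_def by (intro L2_diff v)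
  have [measurable]: "d k \<in> borel_measurable ?M" for k using dL by (rule L2_measurable)
  define C where "C = L2_norm \<Omega> (\<lambda>x::'a. 1::real)"
  have C0: "C \<ge> 0" by (simp add: C_def)
  have "(\<integral>\<^sup>+x. (\<Sum>k. ennreal \<bar>d k x\<bar>) \<partial>?M) = (\<Sum>k. \<integral>\<^sup>+x. ennreal \<bar>d k x\<bar> \<partial>?M)"
    by (rule nn_integral_suminf) measurable
  also have "\<dots> \<le> (\<Sum>k. ennreal (C * (1/2)^k))"
  proof (rule suminf_le)
    fix k
    have "(\<integral>\<^sup>+x. ennreal \<bar>d k x\<bar> \<partial>?M) = ennreal (\<integral>x. \<bar>d k x\<bar> \<partial>?M)"
      by (rule nn_integral_eq_integral) (use L2_imp_integrable[OF \<Omega> dL] in auto)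
    also have "\<dots> \<le> ennreal (L2_norm \<Omega> (d k) * C)"
      unfolding C_def using L2_integral_abs_le[OF \<Omega> dL] by (rule ennreal_leI)
    also have "\<dots> \<le> ennreal (C * (1/2)^k)"
      unfolding d_def using less_imp_le[OF N[OF rSuc rN]] C0
      by (auto intro!: ennreal_leI simp: mult.commute mult_left_mono)
    finally show "(\<integral>\<^sup>+x. ennreal \<bar>d k x\<bar> \<partial>?M) \<le> ennreal (C * (1/2)^k)" .
  qed auto
  also have "\<dots> = ennreal (\<Sum>k. C * (1/2)^k)"
    by (rule suminf_ennreal2) (use C0 in \<open>auto intro!: summable_mult\<close>)
  also have "\<dots> < \<infinity>" by simp
  finally have "AE x in ?M. (\<Sum>k. ennreal \<bar>d k x\<bar>) \<noteq> \<infinity>"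
    by (intro nn_integral_PInf_AE) auto
  then have conv: "AE x in ?M. convergent (\<lambda>k. v (r k) x)"
  proof eventually_elim
    case (elim x)
    have "summable (\<lambda>k. \<bar>d k x\<bar>)"
      using elim summable_iff_suminf_neq_top[of "\<lambda>k. \<bar>d k x\<bar>"] by auto
    then have "summable (\<lambda>k. d k x)" by (rule summable_rabs_cancel)
    then have "convergent (\<lambda>n. (\<Sum>k<n. d k x) + v (r 0) x)"
      by (simp add: summable_iff_convergent convergent_add_const_right_iff)
    moreover have "(\<Sum>k<n. d k x) + v (r 0) x = v (r n) x" for n
      using sum_lessThan_telescope[of "\<lambda>k. v (r k) x" n] by (simp add: d_def)
    ultimately show ?case by simp
  qed
  \<comment> \<open>With \<open>lim\<close> the function is measurable without case distinction; its
    values where the sequence diverges concern a null set only.\<close>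
  define w where "w x = lim (\<lambda>k. v (r k) x)" for x
  have [measurable]: "w \<in> borel_measurable ?M" unfolding w_def by measurable
  \<comment> \<open>Fatou's lemma in j, with n fixed and \<open>v (r j)\<close> approaching
    w.\<close>
  have bound: "(\<integral>\<^sup>+x. ennreal ((v n x - w x)\<^sup>2) \<partial>?M) \<le> ennreal (((1/2)^k)\<^sup>2)" if n: "n \<ge> N k" for n k
  proof -
    have "(\<integral>\<^sup>+x. ennreal ((v n x - w x)\<^sup>2) \<partial>?M)
        = (\<integral>\<^sup>+x. liminf (\<lambda>j. ennreal ((v n x - v (r j) x)\<^sup>2)) \<partial>?M)"
    proof (rule nn_integral_cong_AE, use conv in eventually_elim)
      case (elim x)
      then have "(\<lambda>j. v (r j) x) \<longlonglongrightarrow> w x" unfolding w_def convergent_LIMSEQ_iff .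
      then have "(\<lambda>j. ennreal ((v n x - v (r j) x)\<^sup>2)) \<longlonglongrightarrow> ennreal ((v n x - w x)\<^sup>2)"
        by (intro tendsto_intros)
      then show ?case by (intro lim_imp_Liminf[symmetric]) auto
    qed
    also have "\<dots> \<le> liminf (\<lambda>j. \<integral>\<^sup>+x. ennreal ((v n x - v (r j) x)\<^sup>2) \<partial>?M)"
      by (rule nn_integral_liminf) measurable
    also have "\<dots> \<le> liminf (\<lambda>j. ennreal (((1/2)^k)\<^sup>2))"
    proof (rule Liminf_mono)
      have "\<forall>\<^sub>F j in sequentially. r j \<ge> N k"
        using rk by (intro eventually_sequentiallyI[of "N k"]) (meson order_trans)
      then show "\<forall>\<^sub>F j in sequentially.
          (\<integral>\<^sup>+x. ennreal ((v n x - v (r j) x)\<^sup>2) \<partial>?M) \<le> ennreal (((1/2)^k)\<^sup>2)"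
      proof eventually_elim
        case (elim j)
        have "(\<integral>\<^sup>+x. ennreal ((v n x - v (r j) x)\<^sup>2) \<partial>?M)
            = ennreal (\<integral>x. (v n x - v (r j) x)\<^sup>2 \<partial>?M)"
          by (rule nn_integral_eq_integral) (use L2_diff[OF v v] in \<open>auto simp: L2_space_def\<close>)
        also have "(\<integral>x. (v n x - v (r j) x)\<^sup>2 \<partial>?M) = (L2_norm \<Omega> (\<lambda>x. v n x - v (r j) x))\<^sup>2"
          by (simp add: L2_norm_def)
        also have "ennreal \<dots> \<le> ennreal (((1/2)^k)\<^sup>2)"
          using N[OF n elim] by (intro ennreal_leI power_mono) auto
        finally show ?case .
      qed
    qed
    also have "\<dots> = ennreal (((1/2)^k)\<^sup>2)" by (rule Liminf_const) simp
    finally show ?thesis .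
  qed
  have diffL: "(\<lambda>x. v n x - w x) \<in> L2_space \<Omega>" if "n \<ge> N 0" for n
  proof -
    have "integrable ?M (\<lambda>x. (v n x - w x)\<^sup>2)"
      by (rule integrableI_bounded) (use bound[OF that] in \<open>auto simp: top_unique less_top[symmetric]\<close>)
    then show ?thesis by (simp add: L2_space_def)
  qed
  \<comment> \<open>Fatou shows that v n - w is square integrable, and w is recovered as a
    difference of two members of the space.\<close>
  have w: "w \<in> L2_space \<Omega>"
    using L2_diff[OF v[of "N 0"] diffL[OF order_refl]] by simp
  moreover have "(\<lambda>n. L2_norm \<Omega> (\<lambda>x. v n x - w x)) \<longlonglongrightarrow> 0"
  proof (rule LIMSEQ_I)
    fix e :: real assume "e > 0"
    then obtain k where k: "(1/2)^k < e"
      using real_arch_pow_inv[of e "1/2"] by auto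
    have "L2_norm \<Omega> (\<lambda>x. v n x - w x) < e" if "n \<ge> N k" for n
    proof -
      have "ennreal (\<integral>x. (v n x - w x)\<^sup>2 \<partial>?M) = (\<integral>\<^sup>+x. ennreal ((v n x - w x)\<^sup>2) \<partial>?M)"
        by (rule nn_integral_eq_integral[symmetric]) (use L2_diff[OF v w] in \<open>auto simp: L2_space_def\<close>)
      also have "\<dots> \<le> ennreal (((1/2)^k)\<^sup>2)" by (rule bound[OF that])
      finally have "(\<integral>x. (v n x - w x)\<^sup>2 \<partial>?M) \<le> ((1/2)^k)\<^sup>2" by simp
      then have "L2_norm \<Omega> (\<lambda>x. v n x - w x) \<le> (1/2)^k"
        unfolding L2_norm_def by (intro real_le_lsqrt) auto
      with k show ?thesis by simp
    qed
    then show "\<exists>no. \<forall>n\<ge>no. norm (L2_norm \<Omega> (\<lambda>x. v n x - w x) - 0) < e" by auto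
  qed
  ultimately show thesis by (rule that)
qed

section \<open>Test functions\<close>

lemma smooth_fun_class:
  assumes "\<phi> \<in> S"
    and "\<And>\<phi> x. \<phi> \<in> S \<Longrightarrow> \<phi> differentiable (at x)"
    and "\<And>\<phi> b. \<phi> \<in> S \<Longrightarrow> b \<in> Basis \<Longrightarrow> (\<lambda>x. frechet_derivative \<phi> (at x) b) \<in> S"
  shows "smooth_fun \<phi>"
proof -
  have "iterated_partial bs \<phi> \<in> S" if "set bs \<subseteq> Basis" for bs
    using that by (induction bs) (auto simp: assms)
  then show ?thesis unfolding smooth_fun_def using assms(2) by blast
qed

lemma smooth_fun_differentiable: "smooth_fun \<phi> \<Longrightarrow> \<phi> differentiable (at x)"
  unfolding smooth_fun_def by (metis empty_subsetI iterated_partial.simps(1) list.set(1))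

lemma iterated_partial_append:
  "iterated_partial (bs @ cs) \<phi> = iterated_partial bs (iterated_partial cs \<phi>)"
  by (induction bs) auto

text \<open>In \<open>iterated_partial\<close> the last list entry is differentiated first, so a
  derivative already taken appears as an entry appended at the end.\<close>

lemma smooth_fun_partial:
  assumes "smooth_fun \<phi>" "b \<in> Basis"
  shows "smooth_fun (\<lambda>x. frechet_derivative \<phi> (at x) b)"
  unfolding smooth_fun_def
proof (intro allI impI)
  fix bs x assume "set bs \<subseteq> (Basis :: 'a set)"
  then have "iterated_partial (bs @ [b]) \<phi> differentiable (at x)"
    using assms unfolding smooth_fun_def by (metis insert_subset list.simps(15) set_append Un_subset_iff list.set(1) empty_subsetI)
  then show "iterated_partial bs (\<lambda>x. frechet_derivative \<phi> (at x) b) differentiable (at x)"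
    by (simp add: iterated_partial_append)
qed

lemma smooth_fun_lincomb:
  assumes "smooth_fun \<phi>" "smooth_fun \<psi>"
  shows "smooth_fun (\<lambda>x. c * \<phi> x + d * \<psi> x)"
proof (rule smooth_fun_class)
  let ?S = "{(\<lambda>x. c * \<phi> x + d * \<psi> x) | \<phi> \<psi>. smooth_fun \<phi> \<and> smooth_fun (\<psi> :: 'a \<Rightarrow> real)}"
  show "(\<lambda>x. c * \<phi> x + d * \<psi> x) \<in> ?S" using assms by blast
  fix \<xi> x assume "\<xi> \<in> ?S"
  then obtain \<phi> \<psi> where \<xi>: "\<xi> = (\<lambda>x. c * \<phi> x + d * \<psi> x)" and s: "smooth_fun \<phi>" "smooth_fun \<psi>" by blast
  have D: "(\<xi> has_derivative (\<lambda>h. c * frechet_derivative \<phi> (at x) h + d * frechet_derivative \<psi> (at x) h)) (at x)" for x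
    unfolding \<xi>
    by (intro derivative_intros frechet_derivative_works[THEN iffD1] smooth_fun_differentiable s)
  show "\<xi> differentiable (at x)" using D differentiableI by blast
  fix b :: 'a assume b: "b \<in> Basis"
  have "(\<lambda>x. frechet_derivative \<xi> (at x) b)
      = (\<lambda>x. c * frechet_derivative \<phi> (at x) b + d * frechet_derivative \<psi> (at x) b)"
    using frechet_derivative_at[OF D] by metis
  then show "(\<lambda>x. frechet_derivative \<xi> (at x) b) \<in> ?S"
    by (intro CollectI exI[of _ "\<lambda>x. frechet_derivative \<phi> (at x) b"]
        exI[of _ "\<lambda>x. frechet_derivative \<psi> (at x) b"] conjI smooth_fun_partial s b)
qed

lemma test_lincomb:
  assumes "\<phi> \<in> test_functions \<Omega>" "\<psi> \<in> test_functions \<Omega>"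
  shows "(\<lambda>x. c * \<phi> x + d * \<psi> x) \<in> test_functions \<Omega>"
proof -
  have "{x. c * \<phi> x + d * \<psi> x \<noteq> 0} \<subseteq> {x. \<phi> x \<noteq> 0} \<union> {x. \<psi> x \<noteq> 0}" by auto
  then have sub: "closure {x. c * \<phi> x + d * \<psi> x \<noteq> 0} \<subseteq> closure {x. \<phi> x \<noteq> 0} \<union> closure {x. \<psi> x \<noteq> 0}"
    unfolding closure_Un[symmetric] by (rule closure_mono)
  have "compact (closure {x. \<phi> x \<noteq> 0} \<union> closure {x. \<psi> x \<noteq> 0})"
    using assms by (auto simp: test_functions_def)
  from bounded_subset[OF compact_imp_bounded[OF this] sub]
  have "compact (closure {x. c * \<phi> x + d * \<psi> x \<noteq> 0})"
    by (simp add: compact_eq_bounded_closed)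
  then show ?thesis
    using assms sub smooth_fun_lincomb[of \<phi> \<psi> c d] unfolding test_functions_def by blast
qed

lemma test_scale: "\<phi> \<in> test_functions \<Omega> \<Longrightarrow> (\<lambda>x. c * \<phi> x) \<in> test_functions \<Omega>"
  using test_lincomb[of \<phi> \<Omega> \<phi> c 0] by simp

lemma test_add:
  "\<phi> \<in> test_functions \<Omega> \<Longrightarrow> \<psi> \<in> test_functions \<Omega> \<Longrightarrow> (\<lambda>x. \<phi> x + \<psi> x) \<in> test_functions \<Omega>"
  using test_lincomb[of \<phi> \<Omega> \<psi> 1 1] by simp

lemma test_diff:
  "\<phi> \<in> test_functions \<Omega> \<Longrightarrow> \<psi> \<in> test_functions \<Omega> \<Longrightarrow> (\<lambda>x. \<phi> x - \<psi> x) \<in> test_functions \<Omega>"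
  using test_lincomb[of \<phi> \<Omega> \<psi> 1 "-1"] by simp

abbreviation partial :: "'a::euclidean_space \<Rightarrow> ('a \<Rightarrow> real) \<Rightarrow> 'a \<Rightarrow> real" where
  "partial b \<phi> \<equiv> (\<lambda>x. frechet_derivative \<phi> (at x) b)"

lemma partial_outside_support:
  assumes "x \<notin> closure {x. \<phi> x \<noteq> 0}"
  shows "partial b \<phi> x = 0"
proof -
  have "(\<phi> has_derivative (\<lambda>h. 0)) (at x)"
  proof (rule has_derivative_transform_within_open)
    show "((\<lambda>x. 0) has_derivative (\<lambda>h. 0)) (at x)" by simp
    show "open (- closure {x. \<phi> x \<noteq> 0})" by auto
    show "x \<in> - closure {x. \<phi> x \<noteq> 0}" using assms by auto
    show "0 = \<phi> y" if "y \<in> - closure {x. \<phi> x \<noteq> 0}" for y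
      using that closure_subset[of "{x. \<phi> x \<noteq> 0}"] by auto
  qed
  then show ?thesis using frechet_derivative_at by metis
qed

lemma test_partial:
  assumes "\<phi> \<in> test_functions \<Omega>" "b \<in> Basis"
  shows "partial b \<phi> \<in> test_functions \<Omega>"
proof -
  have "{x. partial b \<phi> x \<noteq> 0} \<subseteq> closure {x. \<phi> x \<noteq> 0}"
    using partial_outside_support[of _ \<phi> b] by blast
  then have sub: "closure {x. partial b \<phi> x \<noteq> 0} \<subseteq> closure {x. \<phi> x \<noteq> 0}"
    by (simp add: closure_minimal)
  moreover have "compact (closure {x. partial b \<phi> x \<noteq> 0})"
    using assms bounded_subset[OF compact_imp_bounded sub]
    unfolding test_functions_def by (simp add: compact_eq_bounded_closed)
  ultimately show ?thesis
    using assms smooth_fun_partial[of \<phi> b] by (auto simp: test_functions_def)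
qed

lemma test_differentiable: "\<phi> \<in> test_functions \<Omega> \<Longrightarrow> \<phi> differentiable (at x)"
  by (simp add: test_functions_def smooth_fun_differentiable)

lemma test_has_derivative:
  "\<phi> \<in> test_functions \<Omega> \<Longrightarrow> (\<phi> has_derivative frechet_derivative \<phi> (at x)) (at x)"
  using test_differentiable frechet_derivative_works by blast

lemma test_continuous: "\<phi> \<in> test_functions \<Omega> \<Longrightarrow> continuous_on S \<phi>"
  by (meson test_differentiable continuous_at_imp_continuous_on differentiable_imp_continuous_within)

lemma test_measurable [measurable_dest]: "\<phi> \<in> test_functions \<Omega> \<Longrightarrow> \<phi> \<in> borel_measurable borel"
  using test_continuous by (intro borel_measurable_continuous_onI)

lemma test_zero_outside: "\<phi> \<in> test_functions \<Omega> \<Longrightarrow> x \<notin> \<Omega> \<Longrightarrow> \<phi> x = 0"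
  using closure_subset[of "{x. \<phi> x \<noteq> 0}"] unfolding test_functions_def by auto

lemma test_bounded:
  assumes "\<phi> \<in> test_functions \<Omega>"
  obtains B where "B > 0" "\<And>x. \<bar>\<phi> x\<bar> \<le> B"
proof -
  have "compact (\<phi> ` closure {x. \<phi> x \<noteq> 0})"
    using assms by (intro compact_continuous_image test_continuous[OF assms]) (auto simp: test_functions_def)
  then obtain B where B: "B > 0" "\<And>y. y \<in> \<phi> ` closure {x. \<phi> x \<noteq> 0} \<Longrightarrow> norm y \<le> B"
    using compact_imp_bounded bounded_pos by metis
  have "\<bar>\<phi> x\<bar> \<le> B" for x
    using B closure_subset[of "{x. \<phi> x \<noteq> 0}"] by (cases "\<phi> x = 0") force+
  with B that show thesis by blast
qed

section \<open>Integration by parts for test functions\<close>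

lemma lborel_integral_translate:
  fixes F :: "'a::euclidean_space \<Rightarrow> real"
  assumes "F \<in> borel_measurable borel"
  shows "(\<integral>x. F (x + c) \<partial>lborel) = (\<integral>x. F x \<partial>lborel)"
proof -
  have "(\<integral>x. F x \<partial>lborel) = (\<integral>x. F x \<partial>distr lborel borel ((+) c))"
    by (simp add: lborel_distr_plus)
  also have "\<dots> = (\<integral>x. F (c + x) \<partial>lborel)"
    using assms by (intro integral_distr) auto
  finally show ?thesis by (simp add: add.commute)
qed

lemma integral_lebesgue_on_eq_lborel:
  fixes F :: "'a::euclidean_space \<Rightarrow> real"
  assumes "F \<in> borel_measurable borel" "\<And>x. x \<notin> \<Omega> \<Longrightarrow> F x = 0" "\<Omega> \<in> sets lebesgue"
  shows "(\<integral>x. F x \<partial>lebesgue_on \<Omega>) = (\<integral>x. F x \<partial>lborel)"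
proof -
  have "(\<lambda>x. if x \<in> \<Omega> then F x else 0) = F" using assms(2) by auto
  then have "(\<integral>x. F x \<partial>lebesgue_on \<Omega>) = (\<integral>x. F x \<partial>lebesgue)"
    using Lebesgue_Measure.integral_restrict_UNIV[OF assms(3), of F] by simp
  then show ?thesis using assms(1) by (simp add: integral_completion)
qed

text \<open>Each difference quotient of F has integral zero by translation invariance, and dominated
  convergence carries this to the derivative. No coordinate has to be singled out for Fubini's
  theorem.\<close>

lemma integral_partial_eq_0:
  fixes F G :: "'a::euclidean_space \<Rightarrow> real"
  assumes F': "\<And>x. ((\<lambda>t. F (x + t *\<^sub>R b)) has_real_derivative G x) (at 0)"
    and contF: "continuous_on UNIV F" and contG: "continuous_on UNIV G"
    and K: "compact K" "\<And>x. x \<notin> K \<Longrightarrow> F x = 0" "\<And>x. x \<notin> K \<Longrightarrow> G x = 0"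
  shows "(\<integral>x. G x \<partial>lborel) = 0"
proof -
  have [measurable]: "F \<in> borel_measurable borel" "G \<in> borel_measurable borel"
    using contF contG by (auto intro: borel_measurable_continuous_onI)
  have "compact (G ` K)"
    using continuous_on_subset[OF contG subset_UNIV] K by (intro compact_continuous_image)
  then obtain B where B: "B > 0" "\<And>y. y \<in> G ` K \<Longrightarrow> norm y \<le> B"
    using compact_imp_bounded bounded_pos by metis
  have GB: "\<bar>G x\<bar> \<le> B" for x
    using B K(3)[of x] by (cases "x \<in> K") force+
  obtain R where R: "\<And>x. x \<in> K \<Longrightarrow> norm x \<le> R"
    using K(1) compact_imp_bounded bounded_iff by metis
  \<comment> \<open>Steps of length at most 1 keep the supports of all quotients in one ball,
    enlarged by \<open>norm b\<close>; together with the mean value bound this gives the dominating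
    function.\<close>
  define h where "h n = 1 / (real n + 1)" for n
  have h: "h n > 0" "h n \<le> 1" for n by (auto simp: h_def)
  have h0: "h \<longlonglongrightarrow> 0" unfolding h_def by real_asymp
  define Q where "Q n x = (F (x + h n *\<^sub>R b) - F x) / h n" for n x
  have [measurable]: "Q n \<in> borel_measurable borel" for n unfolding Q_def by measurable
  have der: "((\<lambda>t. F (x + t *\<^sub>R b)) has_real_derivative G (x + t *\<^sub>R b)) (at t)" for x t
  proof -
    have "((\<lambda>s. F ((x + t *\<^sub>R b) + (s - t) *\<^sub>R b)) has_real_derivative G (x + t *\<^sub>R b)) (at t)"
      using DERIV_shift[of "\<lambda>s. F ((x + t *\<^sub>R b) + s *\<^sub>R b)" _ t "- t"] F'[of "x + t *\<^sub>R b"] by simp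
    moreover have "(x + t *\<^sub>R b) + (s - t) *\<^sub>R b = x + s *\<^sub>R b" for s
      by (simp add: algebra_simps)
    ultimately show ?thesis by simp
  qed
  have Qbound: "\<bar>Q n x\<bar> \<le> B" for n x
  proof -
    obtain z where "F (x + h n *\<^sub>R b) - F (x + 0 *\<^sub>R b) = (h n - 0) * G (x + z *\<^sub>R b)"
      using MVT2[OF h(1)[of n], of "\<lambda>t. F (x + t *\<^sub>R b)" "\<lambda>t. G (x + t *\<^sub>R b)"] der by auto
    then show ?thesis using h[of n] GB[of "x + z *\<^sub>R b"] by (simp add: Q_def)
  qed
  have Qzero: "Q n x = 0" if "x \<notin> cball 0 (R + norm b)" for n x
  proof -
    have "norm x > R + norm b" using that by simp
    moreover have "norm (h n *\<^sub>R b) \<le> norm b" using h[of n] by (simp add: mult_left_le_one_le)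
    moreover have "norm x \<le> norm (x + h n *\<^sub>R b) + norm (h n *\<^sub>R b)"
      using norm_triangle_ineq4[of "x + h n *\<^sub>R b" "h n *\<^sub>R b"] by simp
    moreover have "norm b \<ge> 0" by simp
    ultimately have "norm (x + h n *\<^sub>R b) > R" "norm x > R" by linarith+
    then have "x \<notin> K" "x + h n *\<^sub>R b \<notin> K" using R by force+
    then show ?thesis using K(2) by (simp add: Q_def)
  qed
  have "(\<lambda>n. \<integral>x. Q n x \<partial>lborel) \<longlonglongrightarrow> (\<integral>x. G x \<partial>lborel)"
  proof (rule integral_dominated_convergence[where w="\<lambda>x. B * indicator (cball 0 (R + norm b)) x"])
    show "integrable lborel (\<lambda>x::'a. B * indicator (cball 0 (R + norm b)) x)"
      by (intro integrable_mult_right integrable_real_indicator emeasure_lborel_cball_finite) auto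
    show "AE x in lborel. norm (Q n x) \<le> B * indicator (cball 0 (R + norm b)) x" for n
      using Qbound Qzero by (auto simp: indicator_def)
    show "AE x in lborel. (\<lambda>n. Q n x) \<longlonglongrightarrow> G x"
    proof (rule AE_I2)
      fix x
      have "(\<lambda>t. (F (x + t *\<^sub>R b) - F x) / t) \<midarrow>0\<rightarrow> G x"
        using F'[of x] by (simp add: DERIV_def)
      moreover have "filterlim h (at 0) sequentially"
        using h0 h(1) by (auto simp: filterlim_at intro!: eventuallyI) (metis less_irrefl)
      ultimately have "((\<lambda>n. (F (x + h n *\<^sub>R b) - F x) / h n) \<longlongrightarrow> G x) sequentially"
        by (rule filterlim_compose)
      then show "(\<lambda>n. Q n x) \<longlonglongrightarrow> G x" by (simp add: Q_def)
    qed
  qed auto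
  moreover have "(\<integral>x. Q n x \<partial>lborel) = 0" for n
  proof -
    have iF: "integrable lborel F"
    proof -
      have "compact (F ` K)"
        using continuous_on_subset[OF contF subset_UNIV] K by (intro compact_continuous_image)
      then obtain C where C: "C > 0" "\<And>y. y \<in> F ` K \<Longrightarrow> norm y \<le> C"
        using compact_imp_bounded bounded_pos by metis
      show ?thesis
      proof (rule Bochner_Integration.integrable_bound)
        show "integrable lborel (\<lambda>x::'a. C * indicator (cball 0 R) x)"
          by (intro integrable_mult_right integrable_real_indicator emeasure_lborel_cball_finite) auto
        show "AE x in lborel. norm (F x) \<le> norm (C * indicator (cball 0 R) x)"
        proof (rule AE_I2)
          fix x show "norm (F x) \<le> norm (C * indicator (cball 0 R) x)"
            using C K(2)[of x] R[of x] by (cases "x \<in> K") (force simp: indicator_def)+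
        qed
      qed auto
    qed
    have "integrable (distr lborel borel ((+) (h n *\<^sub>R b))) F"
      using iF by (simp add: lborel_distr_plus)
    then have "integrable lborel (\<lambda>x. F (h n *\<^sub>R b + x))"
      by (subst (asm) integrable_distr_eq) auto
    then have iF': "integrable lborel (\<lambda>x. F (x + h n *\<^sub>R b))" by (simp add: add.commute)
    have "(\<integral>x. Q n x \<partial>lborel) = ((\<integral>x. F (x + h n *\<^sub>R b) \<partial>lborel) - (\<integral>x. F x \<partial>lborel)) / h n"
      unfolding Q_def using iF iF' by simp
    also have "\<dots> = 0" by (simp add: lborel_integral_translate)
    finally show ?thesis .
  qed
  ultimately show ?thesis by (simp add: LIMSEQ_const_iff)
qed

lemma has_derivative_line:
  assumes "(F has_derivative F') (at x)"
  shows "((\<lambda>t. F (x + t *\<^sub>R b)) has_real_derivative F' b) (at 0)"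
proof -
  have "((\<lambda>t. x + t *\<^sub>R b) has_derivative (\<lambda>t. t *\<^sub>R b)) (at 0)"
    by (auto intro!: derivative_eq_intros)
  then have "((\<lambda>t. F (x + t *\<^sub>R b)) has_derivative (\<lambda>t. F' (t *\<^sub>R b))) (at 0)"
    using assms has_derivative_compose[of "\<lambda>t. x + t *\<^sub>R b" "\<lambda>t. t *\<^sub>R b" 0 UNIV F F'] by simp
  moreover have "F' (t *\<^sub>R b) = F' b * t" for t
    using linear_cmul[OF has_derivative_linear[OF assms], of t b] by simp
  ultimately show ?thesis by (simp add: has_field_derivative_def)
qed

text \<open>The product \<phi>\<psi> has compact support, so the integral of its partial derivative
  vanishes. This also identifies the classical partials of a test function as its weak ones.\<close>

lemma test_integration_by_parts:
  assumes \<Omega>: "\<Omega> \<in> sets lebesgue"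
    and \<phi>: "\<phi> \<in> test_functions \<Omega>" and \<psi>: "\<psi> \<in> test_functions \<Omega>" and b: "b \<in> Basis"
  shows "L2_inner \<Omega> \<phi> (partial b \<psi>) = - L2_inner \<Omega> (partial b \<phi>) \<psi>"
proof -
  let ?G = "\<lambda>x. \<phi> x * partial b \<psi> x + partial b \<phi> x * \<psi> x"
  note p = test_partial[OF \<phi> b] test_partial[OF \<psi> b]
  note [measurable] = test_measurable[OF \<phi>] test_measurable[OF \<psi>] test_measurable[OF p(1)] test_measurable[OF p(2)]
  have 0: "(\<integral>x. ?G x \<partial>lborel) = 0"
  proof (rule integral_partial_eq_0)
    show "((\<lambda>t. (\<lambda>x. \<phi> x * \<psi> x) (x + t *\<^sub>R b)) has_real_derivative ?G x) (at 0)" for x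
      using has_derivative_line[OF has_derivative_mult[OF test_has_derivative[OF \<phi>] test_has_derivative[OF \<psi>]], of x b]
      by (simp add: add.commute)
    show "continuous_on UNIV (\<lambda>x. \<phi> x * \<psi> x)" "continuous_on UNIV ?G"
      by (intro continuous_intros test_continuous[OF \<phi>] test_continuous[OF \<psi>] test_continuous[OF p(1)] test_continuous[OF p(2)])+
    show "compact (closure {x. \<phi> x \<noteq> 0})" using \<phi> by (simp add: test_functions_def)
    fix x assume x: "x \<notin> closure {x. \<phi> x \<noteq> 0}"
    then have "\<phi> x = 0" using closure_subset[of "{x. \<phi> x \<noteq> 0}"] by auto
    then show "\<phi> x * \<psi> x = 0" "?G x = 0" using partial_outside_support[OF x] by auto
  qed
  have int: "integrable lborel (\<lambda>x. \<alpha> x * \<beta> x)"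
    if \<alpha>: "\<alpha> \<in> test_functions \<Omega>" and \<beta>: "\<beta> \<in> test_functions \<Omega>" for \<alpha> \<beta>
  proof -
    obtain B C where B: "\<And>x. \<bar>\<alpha> x\<bar> \<le> B" "B > 0" and C: "\<And>x. \<bar>\<beta> x\<bar> \<le> C" "C > 0"
      using test_bounded[OF \<alpha>] test_bounded[OF \<beta>] by metis
    have cpt: "compact (closure {x. \<alpha> x \<noteq> 0})" using \<alpha> by (simp add: test_functions_def)
    show ?thesis
    proof (rule Bochner_Integration.integrable_bound)
      show "integrable lborel (\<lambda>x. (B * C) * indicator (closure {x. \<alpha> x \<noteq> 0}) x)"
        by (intro integrable_mult_right integrable_real_indicator emeasure_compact_finite cpt) auto
      show "AE x in lborel. norm (\<alpha> x * \<beta> x) \<le> norm ((B * C) * indicator (closure {x. \<alpha> x \<noteq> 0}) x)"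
      proof (rule AE_I2)
        fix x
        show "norm (\<alpha> x * \<beta> x) \<le> norm ((B * C) * indicator (closure {x. \<alpha> x \<noteq> 0}) x)"
        proof (cases "\<alpha> x = 0")
          case False
          then have "x \<in> closure {x. \<alpha> x \<noteq> 0}" using closure_subset[of "{x. \<alpha> x \<noteq> 0}"] by auto
          then show ?thesis using B C by (simp add: abs_mult mult_mono)
        qed simp
      qed
    qed (use test_measurable[OF \<alpha>] test_measurable[OF \<beta>] in measurable)
  qed
  have "L2_inner \<Omega> \<phi> (partial b \<psi>) = (\<integral>x. \<phi> x * partial b \<psi> x \<partial>lborel)"
    "L2_inner \<Omega> (partial b \<phi>) \<psi> = (\<integral>x. partial b \<phi> x * \<psi> x \<partial>lborel)"
    unfolding L2_inner_def
    by (rule integral_lebesgue_on_eq_lborel; use \<Omega> test_zero_outside[OF \<phi>] test_zero_outside[OF \<psi>] in auto)+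
  then show ?thesis using 0 int[OF \<phi> p(2)] int[OF p(1) \<psi>] by simp
qed

lemma test_L2:
  assumes "\<Omega> \<in> lmeasurable" "\<phi> \<in> test_functions \<Omega>"
  shows "\<phi> \<in> L2_space \<Omega>"
proof -
  have \<phi>m: "\<phi> \<in> borel_measurable (lebesgue_on \<Omega>)"
    using test_measurable[OF assms(2)] by (simp add: measurable_restrict_space1 borel_measurable_if_lebesgue_on measurable_completion)
  obtain B where B: "\<And>x. \<bar>\<phi> x\<bar> \<le> B" using test_bounded[OF assms(2)] by metis
  interpret finite_measure "lebesgue_on \<Omega>" by (rule finite_measure_lebesgue_on[OF assms(1)])
  have "integrable (lebesgue_on \<Omega>) (\<lambda>x. (\<phi> x)\<^sup>2)"
    by (rule integrable_const_bound[where B="B\<^sup>2"]) (use \<phi>m B in \<open>auto simp: abs_le_square_iff[symmetric] intro: order_trans[OF _ abs_ge_self]\<close>)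
  with \<phi>m show ?thesis by (simp add: L2_space_def)
qed

section \<open>Smooth bump functions\<close>

text \<open>Letting the polynomial vary makes this family closed under differentiation, and together with
  the coordinatewise products below it yields test functions without any Leibniz formula.\<close>

definition flat_exp :: "real poly \<Rightarrow> real \<Rightarrow> real" where
  "flat_exp p x = (if x \<le> 0 then 0 else poly p (1 / x) * exp (- (1 / x)))"

text \<open>The extra power y^k makes the induction on the polynomial work: writing the polynomial
  as a + y p(y) raises k by one.\<close>

lemma poly_exp_tendsto_0: "((\<lambda>y::real. y ^ k * poly p y * exp (- y)) \<longlongrightarrow> 0) at_top"
proof (induction p arbitrary: k)
  case (pCons a p)
  have "((\<lambda>y. a * (y ^ k / exp y) + y ^ Suc k * poly p y * exp (- y)) \<longlongrightarrow> a * 0 + 0) at_top"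
    by (intro tendsto_intros tendsto_power_div_exp_0 pCons.IH)
  then show ?case by (simp add: algebra_simps exp_minus divide_inverse)
qed simp

lemma flat_exp_tendsto_0: "(flat_exp p \<longlongrightarrow> 0) (at 0)"
proof (rule filterlim_split_at)
  show "(flat_exp p \<longlongrightarrow> 0) (at_left 0)"
    by (rule tendsto_eventually) (auto simp: flat_exp_def eventually_at_filter)
  have "((\<lambda>x. poly p (inverse x) * exp (- inverse x)) \<longlongrightarrow> 0) (at_right 0)"
    using filterlim_compose[OF poly_exp_tendsto_0[of 0 p] filterlim_inverse_at_top_right] by simp
  moreover have "\<forall>\<^sub>F x in at_right 0. poly p (inverse x) * exp (- inverse x) = flat_exp p x"
    by (auto simp: flat_exp_def eventually_at_filter inverse_eq_divide)
  ultimately show "(flat_exp p \<longlongrightarrow> 0) (at_right 0)"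
    by (rule Lim_transform_eventually)
qed

text \<open>With y = 1/x the chain rule turns p(y) exp(-y) into y^2 (p(y) - p'(y)) exp(-y), and
  \<open>[:0, 0, 1:]\<close> is y^2. At 0 the difference quotient is again of the family, because
  division by h multiplies the polynomial by y.\<close>

lemma has_derivative_flat_exp:
  "(flat_exp p has_real_derivative flat_exp ([:0, 0, 1:] * (p - pderiv p)) x) (at x)"
proof -
  consider "x < 0" | "x = 0" | "x > 0" by linarith
  then show ?thesis
  proof cases
    case 1
    have "((\<lambda>x. 0) has_real_derivative 0) (at x)" by simp
    then have "(flat_exp p has_real_derivative 0) (at x)"
      by (rule has_field_derivative_transform_within_open[where S="{..<0}"])
        (use 1 in \<open>auto simp: flat_exp_def\<close>)
    with 1 show ?thesis by (simp add: flat_exp_def)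
  next
    case 2
    have "((\<lambda>h. (flat_exp p (0 + h) - flat_exp p 0) / h) \<longlongrightarrow> 0) (at 0)"
    proof -
      have "(flat_exp p (0 + h) - flat_exp p 0) / h = flat_exp (pCons 0 p) h" for h
        by (simp add: flat_exp_def)
      with flat_exp_tendsto_0[of "pCons 0 p"] show ?thesis by simp
    qed
    with 2 show ?thesis by (simp add: DERIV_def flat_exp_def)
  next
    case 3
    have "((\<lambda>x. poly p (1 / x) * exp (- (1 / x))) has_real_derivative
        flat_exp ([:0, 0, 1:] * (p - pderiv p)) x) (at x)"
      using 3 by (auto intro!: derivative_eq_intros DERIV_chain'[OF _ poly_DERIV]
          simp: flat_exp_def field_simps power2_eq_square)
    then show ?thesis
      by (rule has_field_derivative_transform_within_open[where S="{0<..}"])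
        (use 3 in \<open>auto simp: flat_exp_def\<close>)
  qed
qed

text \<open>A negative \<open>c\<close> turns the cutoff around, so products vanish on both sides of
  an interval. Sums are what the product rule produces, and scalar factors can be moved into the
  polynomials.\<close>

inductive bump_algebra :: "(real \<Rightarrow> real) \<Rightarrow> bool" where
  base: "bump_algebra (\<lambda>x. flat_exp p (c * x + d))"
| add: "bump_algebra f \<Longrightarrow> bump_algebra g \<Longrightarrow> bump_algebra (\<lambda>x. f x + g x)"
| mult: "bump_algebra f \<Longrightarrow> bump_algebra g \<Longrightarrow> bump_algebra (\<lambda>x. f x * g x)"

lemma bump_algebra_deriv:
  assumes "bump_algebra f"
  shows "\<exists>f'. bump_algebra f' \<and> (\<forall>x. (f has_real_derivative f' x) (at x))"
  using assms
proof induction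
  case (base p c d)
  let ?q = "smult c ([:0, 0, 1:] * (p - pderiv p))"
  have "((\<lambda>x. flat_exp p (c * x + d)) has_real_derivative flat_exp ?q (c * x + d)) (at x)" for x
  proof -
    have "((\<lambda>x. c * x + d) has_real_derivative c) (at x)" by (auto intro!: derivative_eq_intros)
    from DERIV_chain'[OF this has_derivative_flat_exp[of p "c * x + d"]]
    have "((\<lambda>x. flat_exp p (c * x + d)) has_real_derivative
        flat_exp ([:0, 0, 1:] * (p - pderiv p)) (c * x + d) * c) (at x)" .
    moreover have "flat_exp ([:0, 0, 1:] * (p - pderiv p)) (c * x + d) * c = flat_exp ?q (c * x + d)"
      by (simp add: flat_exp_def)
    ultimately show ?thesis by (simp only:)
  qed
  with bump_algebra.base show ?case by blast
next
  case (add f g)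
  then obtain f' g' where "bump_algebra f'" "bump_algebra g'"
    "\<And>x. (f has_real_derivative f' x) (at x)" "\<And>x. (g has_real_derivative g' x) (at x)" by blast
  then show ?case
    by (intro exI[of _ "\<lambda>x. f' x + g' x"]) (auto intro: bump_algebra.add DERIV_add)
next
  case (mult f g)
  then obtain f' g' where *: "bump_algebra f'" "bump_algebra g'"
    "\<And>x. (f has_real_derivative f' x) (at x)" "\<And>x. (g has_real_derivative g' x) (at x)" by blast
  then have "bump_algebra (\<lambda>x. f' x * g x + g' x * f x)"
    by (intro bump_algebra.add bump_algebra.mult mult.hyps)
  then show ?case
    using * by (intro exI[of _ "\<lambda>x. f' x * g x + g' x * f x"]) (auto intro: DERIV_mult)
qed

text \<open>A partial derivative in direction b touches only the factor belonging to b, so the class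
  of coordinatewise products is preserved by the update \<open>g(b := g' b)\<close>.\<close>

lemma smooth_fun_prod_bump:
  fixes g :: "'a::euclidean_space \<Rightarrow> real \<Rightarrow> real"
  assumes "\<And>b. b \<in> Basis \<Longrightarrow> bump_algebra (g b)"
  shows "smooth_fun (\<lambda>x::'a. \<Prod>b\<in>Basis. g b (x \<bullet> b))"
proof (rule smooth_fun_class)
  let ?S = "{\<phi>. \<exists>g. (\<forall>b\<in>Basis. bump_algebra (g b)) \<and> \<phi> = (\<lambda>x::'a. \<Prod>b\<in>Basis. g b (x \<bullet> b))}"
  show "(\<lambda>x. \<Prod>b\<in>Basis. g b (x \<bullet> b)) \<in> ?S" using assms by blast
  fix \<phi> x assume "\<phi> \<in> ?S"
  then obtain g where g: "\<And>b. b \<in> Basis \<Longrightarrow> bump_algebra (g b)"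
    and \<phi>: "\<phi> = (\<lambda>x. \<Prod>b\<in>Basis. g b (x \<bullet> b))" by blast
  obtain g' where g': "\<And>b. b \<in> Basis \<Longrightarrow> bump_algebra (g' b)"
    "\<And>b y. b \<in> Basis \<Longrightarrow> (g b has_real_derivative g' b y) (at y)"
    using bump_algebra_deriv[OF g] by metis
  have D: "(\<phi> has_derivative
      (\<lambda>h. \<Sum>i\<in>Basis. (g' i (x \<bullet> i) * (h \<bullet> i)) * (\<Prod>j\<in>Basis - {i}. g j (x \<bullet> j)))) (at x)" for x
    unfolding \<phi>
  proof (rule has_derivative_prod)
    fix b :: 'a assume b: "b \<in> Basis"
    have "((\<lambda>x. x \<bullet> b) has_derivative (\<lambda>h. h \<bullet> b)) (at x)"
      by (auto intro!: derivative_eq_intros)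
    from has_derivative_compose[OF this g'(2)[OF b, of "x \<bullet> b", unfolded has_field_derivative_def]]
    show "((\<lambda>x. g b (x \<bullet> b)) has_derivative (\<lambda>h. g' b (x \<bullet> b) * (h \<bullet> b))) (at x)" .
  qed
  show "\<phi> differentiable (at x)" using D differentiableI by blast
  fix b :: 'a assume b: "b \<in> Basis"
  have "frechet_derivative \<phi> (at x) b = (\<Prod>i\<in>Basis. (g(b := g' b)) i (x \<bullet> i))" for x
  proof -
    have "frechet_derivative \<phi> (at x) b
        = (\<Sum>i\<in>Basis. (g' i (x \<bullet> i) * (b \<bullet> i)) * (\<Prod>j\<in>Basis - {i}. g j (x \<bullet> j)))"
      by (simp only: frechet_derivative_at[OF D, symmetric])
    also have "\<dots> = (\<Sum>i\<in>Basis. if i = b then g' b (x \<bullet> b) * (\<Prod>j\<in>Basis - {b}. g j (x \<bullet> j)) else 0)"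
      using b by (intro sum.cong) (auto simp: inner_Basis)
    also have "\<dots> = g' b (x \<bullet> b) * (\<Prod>j\<in>Basis - {b}. g j (x \<bullet> j))"
      using b by simp
    also have "\<dots> = (\<Prod>i\<in>Basis. (g(b := g' b)) i (x \<bullet> i))"
      using b by (simp add: prod.remove[of Basis b])
    finally show ?thesis .
  qed
  moreover have "\<forall>i\<in>Basis. bump_algebra ((g(b := g' b)) i)"
    using g g' by auto
  ultimately show "(\<lambda>x. frechet_derivative \<phi> (at x) b) \<in> ?S" by blast
qed

text \<open>Enlarging the factor n inside exp(-1/x) drives the profile to 1 at every positive
  argument, while the support stays the same and the values stay in [0, 1]. \<open>Suc n\<close>
  keeps the factor positive at n = 0.\<close>

definition box_bump :: "nat \<Rightarrow> 'a::euclidean_space \<Rightarrow> 'a \<Rightarrow> 'a \<Rightarrow> real" where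
  "box_bump n a c x =
     (\<Prod>b\<in>Basis. flat_exp 1 (real (Suc n) * (x \<bullet> b - a \<bullet> b)) * flat_exp 1 (real (Suc n) * (c \<bullet> b - x \<bullet> b)))"

lemma flat_exp_1_bounds: "0 \<le> flat_exp 1 x" "flat_exp 1 x \<le> 1"
  by (auto simp: flat_exp_def)

lemma box_bump_bounds: "0 \<le> box_bump n a c x" "box_bump n a c x \<le> 1"
  unfolding box_bump_def
  by (auto intro!: prod_nonneg prod_le_1 mult_le_one simp: flat_exp_1_bounds)

lemma box_bump_eq_0:
  assumes "x \<notin> box a c"
  shows "box_bump n a c x = 0"
proof -
  obtain b where "b \<in> Basis" "x \<bullet> b \<le> a \<bullet> b \<or> c \<bullet> b \<le> x \<bullet> b"
    using assms by (auto simp: mem_box not_less)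
  then show ?thesis
    unfolding box_bump_def by (intro prod_zero bexI[of _ b]) (auto simp: flat_exp_def mult_le_0_iff)
qed

lemma box_bump_tendsto: "(\<lambda>n. box_bump n a c x) \<longlonglongrightarrow> indicator (box a c) x"
proof (cases "x \<in> box a c")
  case True
  have lim: "(\<lambda>n. flat_exp 1 (real (Suc n) * y)) \<longlonglongrightarrow> 1" if "y > 0" for y
  proof -
    have "(\<lambda>n. exp (- (1 / (real (Suc n) * y)))) \<longlonglongrightarrow> 1"
      using that by real_asymp
    then show ?thesis using that by (simp add: flat_exp_def mult_le_0_iff)
  qed
  have "(\<lambda>n. box_bump n a c x) \<longlonglongrightarrow> (\<Prod>b\<in>(Basis::'a set). 1 * 1)"
    unfolding box_bump_def
    by (intro tendsto_prod tendsto_mult lim) (use True in \<open>auto simp: mem_box\<close>)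
  with True show ?thesis by simp
qed (simp add: box_bump_eq_0)

text \<open>The closure of the support can be the whole closed box, hence the hypothesis on
  \<open>cbox\<close>.\<close>

lemma box_bump_test:
  assumes "cbox a c \<subseteq> \<Omega>"
  shows "box_bump n a c \<in> test_functions \<Omega>"
proof -
  have "smooth_fun (\<lambda>x. \<Prod>b\<in>Basis. (\<lambda>y. flat_exp 1 (real (Suc n) * y + (- real (Suc n) * (a \<bullet> b)))
      * flat_exp 1 ((- real (Suc n)) * y + real (Suc n) * (c \<bullet> b))) (x \<bullet> b))"
    by (intro smooth_fun_prod_bump bump_algebra.intros)
  then have "smooth_fun (box_bump n a c)"
    unfolding box_bump_def[abs_def] by (simp add: algebra_simps)
  moreover have sub: "closure {x. box_bump n a c x \<noteq> 0} \<subseteq> cbox a c"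
    by (rule closure_minimal) (use box_bump_eq_0[of _ a c n] box_subset_cbox[of a c] in auto)
  moreover have "compact (closure {x. box_bump n a c x \<noteq> 0})"
    using bounded_subset[OF bounded_cbox sub] by (simp add: compact_eq_bounded_closed)
  ultimately show ?thesis using assms by (auto simp: test_functions_def)
qed

section \<open>The fundamental lemma of the calculus of variations\<close>

text \<open>The bumps exhaust the indicator of a box, so the integral of \<open>g\<close> over every box in \<open>\<Omega>\<close> vanishes;
  \<open>integrable_ccontinuous_explicit\<close> is a form of Lebesgue's differentiation theorem.\<close>

lemma L2_AE_zero_if_orthogonal_test:
  fixes g :: "'a::euclidean_space \<Rightarrow> real"
  assumes \<Omega>: "open \<Omega>" "\<Omega> \<in> lmeasurable" and g: "g \<in> L2_space \<Omega>"
    and orth: "\<And>\<phi>. \<phi> \<in> test_functions \<Omega> \<Longrightarrow> L2_inner \<Omega> g \<phi> = 0"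
  shows "AE x in lebesgue_on \<Omega>. g x = 0"
proof -
  have \<Omega>m: "\<Omega> \<in> sets lebesgue" using \<Omega>(2) by auto
  have gi: "integrable (lebesgue_on \<Omega>) g" by (rule L2_imp_integrable[OF \<Omega>(2) g])
  \<comment> \<open>Extension by zero, since the differentiation theorem concerns functions on the
    whole space.\<close>
  define G where "G x = (if x \<in> \<Omega> then g x else 0)" for x
  have Gi: "integrable lebesgue G"
    unfolding G_def using Lebesgue_Measure.integrable_restrict_UNIV[OF \<Omega>m] gi by blast
  have Gs: "set_integrable lebesgue S G" if "S \<in> sets lebesgue" for S
    unfolding set_integrable_def by (rule integrable_mult_indicator[OF that Gi])
  have box0: "integral (cbox a c) G = 0" if "cbox a c \<subseteq> \<Omega>" for a c
  proof -
    have "(\<lambda>n. L2_inner \<Omega> g (box_bump n a c)) \<longlonglongrightarrow> (\<integral>x. g x * indicator (box a c) x \<partial>lebesgue_on \<Omega>)"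
      unfolding L2_inner_def
    proof (rule integral_dominated_convergence[where w="\<lambda>x. \<bar>g x\<bar>"])
      have [measurable]: "box_bump n a c \<in> borel_measurable (lebesgue_on \<Omega>)" for n
        using test_L2[OF \<Omega>(2) box_bump_test[OF that]] by (rule L2_measurable)
      have [measurable]: "g \<in> borel_measurable (lebesgue_on \<Omega>)" using g by (rule L2_measurable)
      show "(\<lambda>x. g x * box_bump n a c x) \<in> borel_measurable (lebesgue_on \<Omega>)" for n by measurable
      have "{x \<in> \<Omega>. x \<in> box a c} = box a c \<inter> \<Omega>" by auto
      moreover have "box a c \<inter> \<Omega> \<in> sets (lebesgue_on \<Omega>)"
        by (simp add: sets_restrict_space_iff sets.Int \<Omega>m)
      ultimately show "(\<lambda>x. g x * indicator (box a c) x) \<in> borel_measurable (lebesgue_on \<Omega>)"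
        by (intro borel_measurable_times borel_measurable_indicator') auto
      show "AE x in lebesgue_on \<Omega>. norm (g x * box_bump n a c x) \<le> \<bar>g x\<bar>" for n
        using box_bump_bounds[of n a c] by (intro AE_I2) (simp add: abs_mult mult_left_le)
      show "AE x in lebesgue_on \<Omega>. (\<lambda>n. g x * box_bump n a c x) \<longlonglongrightarrow> g x * indicator (box a c) x"
        by (intro AE_I2 tendsto_intros box_bump_tendsto)
    qed (use gi in auto)
    then have "(\<integral>x. g x * indicator (box a c) x \<partial>lebesgue_on \<Omega>) = 0"
      using orth[OF box_bump_test[OF that]] by (simp add: LIMSEQ_const_iff)
    moreover have "(\<integral>x. g x * indicator (box a c) x \<partial>lebesgue_on \<Omega>)
        = (\<integral>x. (if x \<in> \<Omega> then g x * indicator (box a c) x else 0) \<partial>lebesgue)"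
      by (rule Lebesgue_Measure.integral_restrict_UNIV[OF \<Omega>m, symmetric])
    moreover have "\<dots> = (LINT x:box a c|lebesgue. G x)"
      unfolding set_lebesgue_integral_def by (intro Bochner_Integration.integral_cong) (auto simp: G_def)
    moreover have "(LINT x:box a c|lebesgue. G x) = integral (box a c) G"
      by (intro set_lebesgue_integral_eq_integral Gs) auto
    moreover have "integral (box a c) G = integral (cbox a c) G"
      by (rule integral_open_interval)
    ultimately show ?thesis by simp
  qed
  have "G integrable_on cbox a c" for a c
    by (intro set_lebesgue_integral_eq_integral(1) Gs) auto
  then obtain N where N: "negligible N"
    "\<And>x e. x \<notin> N \<Longrightarrow> 0 < e \<Longrightarrow> \<exists>d>0. \<forall>h. 0 < h \<and> h < d \<longrightarrow>
        norm (integral (cbox x (x + h *\<^sub>R One)) G /\<^sub>R h ^ DIM('a) - G x) < e"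
    using integrable_ccontinuous_explicit[of G] by metis
  have "G x = 0" if x: "x \<notin> N" for x
  proof (cases "x \<in> \<Omega>")
    case True
    then obtain r where r: "r > 0" "cball x r \<subseteq> \<Omega>"
      using \<Omega>(1) open_contains_cball by blast
    have "\<bar>G x\<bar> \<le> e" if e: "e > 0" for e
    proof -
      obtain d where d: "d > 0" "\<And>h. 0 < h \<Longrightarrow> h < d \<Longrightarrow>
          norm (integral (cbox x (x + h *\<^sub>R One)) G /\<^sub>R h ^ DIM('a) - G x) < e"
        using N(2)[OF x e] by blast
      \<comment> \<open>A box of side h has diameter at most \<open>DIM('a)\<close> times h in the
        sum norm; the second bound keeps it inside the ball of radius r around its corner x.\<close>
      define h where "h = min (d / 2) (r / DIM('a))"
      have h: "0 < h" "h < d" "h * DIM('a) \<le> r"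
        using d(1) r(1) by (auto simp: h_def min_def field_simps)
      have "cbox x (x + h *\<^sub>R One) \<subseteq> cball x r"
      proof
        fix y assume y: "y \<in> cbox x (x + h *\<^sub>R One)"
        have "norm (y - x) \<le> (\<Sum>b\<in>Basis. \<bar>(y - x) \<bullet> b\<bar>)" by (rule norm_le_l1)
        also have "\<dots> \<le> (\<Sum>b\<in>(Basis::'a set). h)"
          using y by (intro sum_mono) (auto simp: mem_box inner_diff_left inner_add_left)
        also have "\<dots> \<le> r" using h(3) by (simp add: mult.commute)
        finally show "y \<in> cball x r" by (simp add: dist_norm norm_minus_commute)
      qed
      with r have "integral (cbox x (x + h *\<^sub>R One)) G = 0" by (intro box0) auto
      with d(2)[OF h(1,2)] show ?thesis by simp
    qed
    then have "\<bar>G x\<bar> \<le> 0" by (rule field_le_epsilon) simp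
    then show ?thesis by simp
  qed (simp add: G_def)
  then have "{x. G x \<noteq> 0} \<subseteq> N" by blast
  then have "{x. G x \<noteq> 0} \<in> null_sets lebesgue"
    using N(1) negligible_subset negligible_iff_null_sets by blast
  then have "AE x in lebesgue. G x = 0"
    by (simp add: completion.AE_iff_null_sets)
  then have "AE x in lebesgue. x \<in> \<Omega> \<longrightarrow> g x = 0"
    by eventually_elim (auto simp: G_def split: if_splits)
  then show ?thesis using \<Omega>m by (simp add: AE_restrict_space_iff)
qed

section \<open>Weak derivatives\<close>

locale bounded_domain =
  fixes \<Omega> :: "'a::euclidean_space set"
  assumes open_domain: "open \<Omega>" and bounded_domain: "bounded \<Omega>"
begin

abbreviation inner2 (infixl "\<bullet>\<^sub>2" 70) where "v \<bullet>\<^sub>2 w \<equiv> L2_inner \<Omega> v w"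
abbreviation norm2 where "norm2 (v :: 'a \<Rightarrow> real) \<equiv> L2_norm \<Omega> v"
abbreviation L2 where "L2 \<equiv> L2_space \<Omega>"
abbreviation tests where "tests \<equiv> test_functions \<Omega>"
abbreviation wd where "wd \<equiv> weak_deriv \<Omega>"

lemma lmeasurable: "\<Omega> \<in> lmeasurable"
  using open_domain bounded_domain by (rule lmeasurable_open[rotated])

lemma sets_lebesgue [simp]: "\<Omega> \<in> sets lebesgue"
  using lmeasurable by auto

lemmas tests_L2 = test_L2[OF lmeasurable]

lemma is_weak_deriv_iff:
  "is_weak_deriv \<Omega> bs v g \<longleftrightarrow>
    (\<forall>\<phi>\<in>tests. v \<bullet>\<^sub>2 iterated_partial bs \<phi> = (-1) ^ length bs * (g \<bullet>\<^sub>2 \<phi>))"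
  by (simp add: is_weak_deriv_def L2_inner_def)

lemma test_iterated_partial:
  "\<phi> \<in> tests \<Longrightarrow> set bs \<subseteq> Basis \<Longrightarrow> iterated_partial bs \<phi> \<in> tests"
  by (induction bs) (auto intro: test_partial)

lemma weak_deriv_unique:
  assumes "g \<in> L2" "h \<in> L2" "is_weak_deriv \<Omega> bs v g" "is_weak_deriv \<Omega> bs v h"
  shows "AE x in lebesgue_on \<Omega>. g x = h x"
proof -
  have "AE x in lebesgue_on \<Omega>. g x - h x = 0"
  proof (rule L2_AE_zero_if_orthogonal_test[OF open_domain lmeasurable])
    show "(\<lambda>x. g x - h x) \<in> L2" using assms by (intro L2_diff)
    fix \<phi> assume \<phi>: "\<phi> \<in> tests"
    then have "(-1) ^ length bs * (g \<bullet>\<^sub>2 \<phi>) = (-1) ^ length bs * (h \<bullet>\<^sub>2 \<phi>)"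
      using assms(3,4) unfolding is_weak_deriv_iff by metis
    then show "(\<lambda>x. g x - h x) \<bullet>\<^sub>2 \<phi> = 0"
      using assms \<phi> by (simp add: L2_inner_diff_left tests_L2)
  qed
  then show ?thesis by simp
qed

lemma sobolev_L2: "v \<in> sobolev_space k \<Omega> \<Longrightarrow> v \<in> L2"
  by (simp add: sobolev_space_def)

lemma wd_props:
  assumes "v \<in> sobolev_space k \<Omega>" "set bs \<subseteq> Basis" "length bs \<le> k"
  shows "wd bs v \<in> L2" "is_weak_deriv \<Omega> bs v (wd bs v)"
proof -
  have "\<exists>g. g \<in> L2 \<and> is_weak_deriv \<Omega> bs v g"
    using assms unfolding sobolev_space_def by blast
  from someI_ex[OF this] show "wd bs v \<in> L2" "is_weak_deriv \<Omega> bs v (wd bs v)"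
    unfolding weak_deriv_def by auto
qed

text \<open>The gate from a concrete derivative to the chosen representative \<open>wd bs v\<close>:
  the two agree almost everywhere, and nothing more can be known about the choice.\<close>

lemma wd_eq:
  assumes "g \<in> L2" "is_weak_deriv \<Omega> bs v g"
  shows "wd bs v \<in> L2" "AE x in lebesgue_on \<Omega>. wd bs v x = g x"
proof -
  have "\<exists>g. g \<in> L2 \<and> is_weak_deriv \<Omega> bs v g" using assms by blast
  from someI_ex[OF this] have *: "wd bs v \<in> L2" "is_weak_deriv \<Omega> bs v (wd bs v)"
    unfolding weak_deriv_def by auto
  then show "wd bs v \<in> L2" "AE x in lebesgue_on \<Omega>. wd bs v x = g x"
    using weak_deriv_unique assms by auto
qed

lemma is_weak_deriv_diff:
  assumes "v \<in> L2" "w \<in> L2" "g \<in> L2" "h \<in> L2" "set bs \<subseteq> Basis"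
    and "is_weak_deriv \<Omega> bs v g" "is_weak_deriv \<Omega> bs w h"
  shows "is_weak_deriv \<Omega> bs (\<lambda>x. v x - w x) (\<lambda>x. g x - h x)"
  using assms unfolding is_weak_deriv_iff
  by (simp add: L2_inner_diff_left tests_L2 test_iterated_partial right_diff_distrib)

lemma sobolev_diff:
  assumes "v \<in> sobolev_space k \<Omega>" "w \<in> sobolev_space k \<Omega>"
  shows "(\<lambda>x. v x - w x) \<in> sobolev_space k \<Omega>"
  unfolding sobolev_space_def
proof (intro CollectI conjI allI impI)
  show "(\<lambda>x. v x - w x) \<in> L2" using assms[THEN sobolev_L2] by (rule L2_diff)
  fix bs :: "'a list" assume "set bs \<subseteq> Basis \<and> length bs \<le> k"
  then have bs: "set bs \<subseteq> Basis" "length bs \<le> k" by auto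
  note v = wd_props[OF assms(1) bs] and w = wd_props[OF assms(2) bs]
  show "\<exists>g\<in>L2. is_weak_deriv \<Omega> bs (\<lambda>x. v x - w x) g"
    using is_weak_deriv_diff[OF assms[THEN sobolev_L2] v(1) w(1) bs(1) v(2) w(2)] L2_diff[OF v(1) w(1)] by blast
qed

text \<open>The representatives for v, w and v - w are chosen independently, so linearity survives
  only almost everywhere.\<close>

lemma wd_diff:
  assumes "v \<in> sobolev_space k \<Omega>" "w \<in> sobolev_space k \<Omega>" "set bs \<subseteq> Basis" "length bs \<le> k"
  shows "AE x in lebesgue_on \<Omega>. wd bs (\<lambda>x. v x - w x) x = wd bs v x - wd bs w x"
proof -
  note v = wd_props[OF assms(1,3,4)] and w = wd_props[OF assms(2,3,4)]
  show ?thesis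
    by (rule wd_eq(2)[OF L2_diff[OF v(1) w(1)] is_weak_deriv_diff[OF assms(1,2)[THEN sobolev_L2] v(1) w(1) assms(3) v(2) w(2)]])
qed

lemma norm2_wd_diff:
  assumes "v \<in> sobolev_space k \<Omega>" "w \<in> sobolev_space k \<Omega>" "set bs \<subseteq> Basis" "length bs \<le> k"
  shows "norm2 (wd bs (\<lambda>x. v x - w x)) = norm2 (\<lambda>x. wd bs v x - wd bs w x)"
  by (rule L2_norm_cong_AE)
    (use assms in \<open>auto intro!: wd_diff L2_diff wd_props sobolev_diff\<close>)

lemma is_weak_deriv_Nil: "is_weak_deriv \<Omega> [] v v"
  by (simp add: is_weak_deriv_iff)

text \<open>The empty multi-index contributes to \<open>sobolev_norm\<close>, and
  \<open>wd []\<close> also makes a choice: it yields some representative of v, not necessarily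
  v.\<close>

lemma norm2_wd_Nil:
  assumes "v \<in> L2"
  shows "norm2 (wd [] v) = norm2 v"
  by (rule L2_norm_cong_AE) (use assms wd_eq[OF assms is_weak_deriv_Nil] in auto)

lemma norm2_wd_le_sobolev_norm:
  assumes "set bs \<subseteq> Basis" "length bs \<le> k"
  shows "norm2 (wd bs v) \<le> sobolev_norm k \<Omega> v"
proof -
  have "(norm2 (wd bs v))\<^sup>2 \<le> (\<Sum>bs | set bs \<subseteq> Basis \<and> length bs \<le> k. (norm2 (wd bs v))\<^sup>2)"
    using assms by (intro member_le_sum finite_lists_length_le) auto
  then show ?thesis unfolding sobolev_norm_def by (rule real_le_rsqrt)
qed

lemma sobolev_mono: "k \<le> l \<Longrightarrow> sobolev_space l \<Omega> \<subseteq> sobolev_space k \<Omega>"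
  by (auto simp: sobolev_space_def)

lemma sobolev_space_1I:
  assumes "v \<in> L2" "\<And>b. b \<in> Basis \<Longrightarrow> g b \<in> L2" "\<And>b. b \<in> Basis \<Longrightarrow> is_weak_deriv \<Omega> [b] v (g b)"
  shows "v \<in> sobolev_space 1 \<Omega>"
  unfolding sobolev_space_def
proof (intro CollectI conjI allI impI)
  fix bs :: "'a list" assume bs: "set bs \<subseteq> Basis \<and> length bs \<le> 1"
  show "\<exists>g\<in>L2. is_weak_deriv \<Omega> bs v g"
  proof (cases bs)
    case Nil
    with assms(1) is_weak_deriv_Nil[of v] show ?thesis by blast
  next
    case (Cons b bs')
    with bs have "bs = [b]" "b \<in> Basis" by auto
    with assms show ?thesis by blast
  qed
qed (rule assms)

section \<open>Test functions and their closure\<close>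

lemma test_weak_deriv:
  assumes "\<phi> \<in> tests" "b \<in> Basis"
  shows "is_weak_deriv \<Omega> [b] \<phi> (partial b \<phi>)"
  using assms by (simp add: is_weak_deriv_iff test_integration_by_parts)

lemma test_sobolev: "\<phi> \<in> tests \<Longrightarrow> \<phi> \<in> sobolev_space 1 \<Omega>"
  by (rule sobolev_space_1I[where g="\<lambda>b. partial b \<phi>"])
    (auto intro: tests_L2 test_partial test_weak_deriv)

lemma H10_sobolev: "v \<in> H10_space \<Omega> \<Longrightarrow> v \<in> sobolev_space 1 \<Omega>"
  by (simp add: H10_space_def)

lemma wd1_L2: "v \<in> sobolev_space 1 \<Omega> \<Longrightarrow> b \<in> Basis \<Longrightarrow> wd [b] v \<in> L2"
  by (rule wd_props(1)) auto

lemma norm2_wd_diff_test: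
  assumes "v \<in> sobolev_space 1 \<Omega>" "\<phi> \<in> tests" "b \<in> Basis"
  shows "norm2 (wd [b] (\<lambda>x. v x - \<phi> x)) = norm2 (\<lambda>x. wd [b] v x - partial b \<phi> x)"
proof -
  have "norm2 (wd [b] (\<lambda>x. v x - \<phi> x)) = norm2 (\<lambda>x. wd [b] v x - wd [b] \<phi> x)"
    by (rule norm2_wd_diff[OF assms(1) test_sobolev[OF assms(2)]]) (use assms in auto)
  also have "\<dots> = norm2 (\<lambda>x. wd [b] v x - partial b \<phi> x)"
  proof (rule L2_norm_cong_AE)
    note p = tests_L2[OF test_partial[OF assms(2,3)]]
    note e = wd_eq[OF p test_weak_deriv[OF assms(2,3)]]
    show "(\<lambda>x. wd [b] v x - wd [b] \<phi> x) \<in> L2" "(\<lambda>x. wd [b] v x - partial b \<phi> x) \<in> L2"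
      using assms by (auto intro!: L2_diff wd1_L2 e p)
    show "AE x in lebesgue_on \<Omega>. wd [b] v x - wd [b] \<phi> x = wd [b] v x - partial b \<phi> x"
      using e(2) by eventually_elim simp
  qed
  finally show ?thesis .
qed

text \<open>Splits the Sobolev norm into its terms and replaces the weak derivatives of test
  functions by classical ones, which is the form in which density is used from here on.\<close>

lemma H10_approx:
  assumes "v \<in> H10_space \<Omega>"
  obtains \<phi> where "\<And>n. \<phi> n \<in> tests" "(\<lambda>n. norm2 (\<lambda>x. v x - \<phi> n x)) \<longlonglongrightarrow> 0"
    "\<And>b. b \<in> Basis \<Longrightarrow> (\<lambda>n. norm2 (\<lambda>x. wd [b] v x - partial b (\<phi> n) x)) \<longlonglongrightarrow> 0"
proof -
  obtain \<phi> :: "nat \<Rightarrow> 'a \<Rightarrow> real" where \<phi>: "\<And>n. \<phi> n \<in> tests"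
    and lim: "(\<lambda>n. sobolev_norm 1 \<Omega> (\<lambda>x. v x - \<phi> n x)) \<longlonglongrightarrow> 0"
    using assms unfolding H10_space_def by blast
  have v: "v \<in> sobolev_space 1 \<Omega>" using assms by (rule H10_sobolev)
  have *: "(\<lambda>n. norm2 (wd bs (\<lambda>x. v x - \<phi> n x))) \<longlonglongrightarrow> 0" if "set bs \<subseteq> Basis" "length bs \<le> 1" for bs
  proof (rule tendsto_sandwich[OF _ _ tendsto_const lim])
    show "\<forall>\<^sub>F n in sequentially. norm2 (wd bs (\<lambda>x. v x - \<phi> n x)) \<le> sobolev_norm 1 \<Omega> (\<lambda>x. v x - \<phi> n x)"
      using norm2_wd_le_sobolev_norm[OF that] by simp
  qed simp
  show thesis
  proof (rule that[OF \<phi>])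
    show "(\<lambda>n. norm2 (\<lambda>x. v x - \<phi> n x)) \<longlonglongrightarrow> 0"
      using *[of "[]"] norm2_wd_Nil[OF L2_diff[OF sobolev_L2[OF v] tests_L2[OF \<phi>]]] by simp
    show "(\<lambda>n. norm2 (\<lambda>x. wd [b] v x - partial b (\<phi> n) x)) \<longlonglongrightarrow> 0" if "b \<in> Basis" for b
      using *[of "[b]"] norm2_wd_diff_test[OF v \<phi> that] that by simp
  qed
qed

lemma H10I:
  assumes v: "v \<in> sobolev_space 1 \<Omega>" and \<phi>: "\<And>n. \<phi> n \<in> tests"
    and lim: "(\<lambda>n. norm2 (\<lambda>x. v x - \<phi> n x)) \<longlonglongrightarrow> 0"
      "\<And>b. b \<in> Basis \<Longrightarrow> (\<lambda>n. norm2 (\<lambda>x. wd [b] v x - partial b (\<phi> n) x)) \<longlonglongrightarrow> 0"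
  shows "v \<in> H10_space \<Omega>"
proof -
  have *: "(\<lambda>n. norm2 (wd bs (\<lambda>x. v x - \<phi> n x))) \<longlonglongrightarrow> 0"
    if bs: "set bs \<subseteq> Basis" "length bs \<le> 1" for bs
  proof (cases bs)
    case Nil
    then show ?thesis
      using lim(1) norm2_wd_Nil[OF L2_diff[OF sobolev_L2[OF v] tests_L2[OF \<phi>]]] by simp
  next
    case (Cons b bs')
    with bs have b: "bs = [b]" "b \<in> Basis" by auto
    then show ?thesis using lim(2)[OF b(2)] norm2_wd_diff_test[OF v \<phi> b(2)] by simp
  qed
  have "(\<lambda>n. sobolev_norm 1 \<Omega> (\<lambda>x. v x - \<phi> n x)) \<longlonglongrightarrow>
      sqrt (\<Sum>bs | set bs \<subseteq> (Basis::'a set) \<and> length bs \<le> 1. 0\<^sup>2)"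
    unfolding sobolev_norm_def by (intro tendsto_intros *) auto
  with v \<phi> show ?thesis by (auto simp: H10_space_def)
qed

section \<open>Gradient, Laplacian and Green's formula\<close>

lemma weak_grad_component: "b \<in> Basis \<Longrightarrow> weak_grad \<Omega> v x \<bullet> b = wd [b] v x"
  by (simp add: weak_grad_def inner_sum_left_Basis)

lemma weak_grad_inner:
  assumes "v \<in> sobolev_space 1 \<Omega>" "w \<in> sobolev_space 1 \<Omega>"
  shows "(\<integral>x. weak_grad \<Omega> v x \<bullet> weak_grad \<Omega> w x \<partial>lebesgue_on \<Omega>) = (\<Sum>b\<in>Basis. wd [b] v \<bullet>\<^sub>2 wd [b] w)"
proof -
  have "weak_grad \<Omega> v x \<bullet> weak_grad \<Omega> w x = (\<Sum>b\<in>Basis. wd [b] v x * wd [b] w x)" for x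
    by (subst euclidean_inner) (simp add: weak_grad_component)
  then show ?thesis
    using assms by (simp add: L2_inner_def integrable_mult_L2 wd1_L2)
qed

lemma weak_grad_norm_sq:
  assumes "v \<in> sobolev_space 1 \<Omega>"
  shows "(L2_norm \<Omega> (weak_grad \<Omega> v))\<^sup>2 = (\<Sum>b\<in>Basis. (norm2 (wd [b] v))\<^sup>2)"
proof -
  have "(L2_norm \<Omega> (weak_grad \<Omega> v))\<^sup>2 = (\<integral>x. weak_grad \<Omega> v x \<bullet> weak_grad \<Omega> v x \<partial>lebesgue_on \<Omega>)"
    by (simp add: L2_norm_def power2_norm_eq_inner)
  then show ?thesis by (simp only: weak_grad_inner[OF assms assms] L2_norm_sq)
qed

lemma wd2_L2: "v \<in> sobolev_space 2 \<Omega> \<Longrightarrow> b \<in> Basis \<Longrightarrow> wd [b, b] v \<in> L2"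
  by (rule wd_props(1)) auto

lemma laplacian_L2: "v \<in> sobolev_space 2 \<Omega> \<Longrightarrow> weak_laplacian \<Omega> v \<in> L2"
  unfolding weak_laplacian_def[abs_def] by (intro L2_sum wd2_L2)

lemma laplacian_diff:
  assumes "v \<in> sobolev_space 2 \<Omega>" "w \<in> sobolev_space 2 \<Omega>"
  shows "AE x in lebesgue_on \<Omega>. weak_laplacian \<Omega> (\<lambda>x. v x - w x) x = weak_laplacian \<Omega> v x - weak_laplacian \<Omega> w x"
proof -
  have "AE x in lebesgue_on \<Omega>. \<forall>b\<in>Basis. wd [b, b] (\<lambda>x. v x - w x) x = wd [b, b] v x - wd [b, b] w x"
    by (intro AE_finite_allI finite_Basis wd_diff[OF assms]) auto
  then show ?thesis
    by eventually_elim (simp add: weak_laplacian_def sum_subtractf)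
qed

text \<open>Continuity of the Laplacian from H^2 to L^2, by which measurability and square
  integrability in time pass from u to \<Delta>u; the constant may be crude.\<close>

lemma norm2_laplacian_le:
  assumes "v \<in> sobolev_space 2 \<Omega>"
  shows "norm2 (weak_laplacian \<Omega> v) \<le> DIM('a) * sobolev_norm 2 \<Omega> v"
proof -
  have "norm2 (weak_laplacian \<Omega> v) \<le> (\<Sum>b\<in>(Basis::'a set). norm2 (wd [b, b] v))"
    unfolding weak_laplacian_def[abs_def] by (intro L2_norm_sum_le wd2_L2 assms)
  also have "\<dots> \<le> (\<Sum>b\<in>(Basis::'a set). sobolev_norm 2 \<Omega> v)"
    by (intro sum_mono norm2_wd_le_sobolev_norm) auto
  finally show ?thesis by simp
qed

lemma norm2_laplacian_diff_le:
  assumes "v \<in> sobolev_space 2 \<Omega>" "w \<in> sobolev_space 2 \<Omega>"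
  shows "norm2 (\<lambda>x. weak_laplacian \<Omega> v x - weak_laplacian \<Omega> w x) \<le> DIM('a) * sobolev_norm 2 \<Omega> (\<lambda>x. v x - w x)"
proof -
  have d: "(\<lambda>x. v x - w x) \<in> sobolev_space 2 \<Omega>" using assms by (rule sobolev_diff)
  have "norm2 (\<lambda>x. weak_laplacian \<Omega> v x - weak_laplacian \<Omega> w x) = norm2 (weak_laplacian \<Omega> (\<lambda>x. v x - w x))"
    by (rule L2_norm_cong_AE[symmetric])
      (use assms d in \<open>auto intro!: laplacian_L2 L2_diff laplacian_diff\<close>)
  also have "\<dots> \<le> DIM('a) * sobolev_norm 2 \<Omega> (\<lambda>x. v x - w x)"
    by (rule norm2_laplacian_le[OF d])
  finally show ?thesis .
qed

text \<open>For a test function in place of v this is the definition of weak derivatives; both sides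
  are continuous in v with respect to the H^1 norm, so density gives the rest. Boundary traces do
  not occur.\<close>

lemma Green:
  assumes "v \<in> H10_space \<Omega>" "w \<in> sobolev_space 2 \<Omega>"
  shows "(\<Sum>b\<in>Basis. wd [b] v \<bullet>\<^sub>2 wd [b] w) = - (v \<bullet>\<^sub>2 weak_laplacian \<Omega> w)"
proof -
  obtain \<phi> where \<phi>: "\<And>n. \<phi> n \<in> tests" "(\<lambda>n. norm2 (\<lambda>x. v x - \<phi> n x)) \<longlonglongrightarrow> 0"
    "\<And>b. b \<in> Basis \<Longrightarrow> (\<lambda>n. norm2 (\<lambda>x. wd [b] v x - partial b (\<phi> n) x)) \<longlonglongrightarrow> 0"
    by (rule H10_approx[OF assms(1)]) (rule that)
  have w1: "w \<in> sobolev_space 1 \<Omega>" using assms(2) sobolev_mono[of 1 2] by auto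
  have v1: "v \<in> sobolev_space 1 \<Omega>" using assms(1) by (rule H10_sobolev)
  have eq: "(\<Sum>b\<in>Basis. partial b (\<phi> n) \<bullet>\<^sub>2 wd [b] w) = - (\<phi> n \<bullet>\<^sub>2 weak_laplacian \<Omega> w)" for n
  proof -
    have "partial b (\<phi> n) \<bullet>\<^sub>2 wd [b] w = - (wd [b, b] w \<bullet>\<^sub>2 \<phi> n)" if b: "b \<in> Basis" for b
    proof -
      have "is_weak_deriv \<Omega> [b] w (wd [b] w)" "is_weak_deriv \<Omega> [b, b] w (wd [b, b] w)"
        using wd_props(2)[OF assms(2)] b by auto
      \<comment> \<open>The second classical derivative of the test function is read in two ways: as
        a first derivative of the test function \<open>partial b (\<phi> n)\<close>, and as a second
        derivative of \<open>\<phi> n\<close>.\<close>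
      then have "w \<bullet>\<^sub>2 partial b (partial b (\<phi> n)) = - (wd [b] w \<bullet>\<^sub>2 partial b (\<phi> n))"
        "w \<bullet>\<^sub>2 partial b (partial b (\<phi> n)) = wd [b, b] w \<bullet>\<^sub>2 \<phi> n"
        using \<phi>(1)[of n] test_partial[OF \<phi>(1)[of n] b] by (auto simp: is_weak_deriv_iff)
      then show ?thesis by (simp add: L2_inner_commute)
    qed
    then have "(\<Sum>b\<in>Basis. partial b (\<phi> n) \<bullet>\<^sub>2 wd [b] w) = - (\<Sum>b\<in>Basis. wd [b, b] w \<bullet>\<^sub>2 \<phi> n)"
      by (simp add: sum_negf)
    also have "(\<Sum>b\<in>Basis. wd [b, b] w \<bullet>\<^sub>2 \<phi> n) = weak_laplacian \<Omega> w \<bullet>\<^sub>2 \<phi> n"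
      unfolding weak_laplacian_def[abs_def]
      using assms \<phi> by (intro L2_inner_sum_left[symmetric]) (auto intro: wd2_L2 tests_L2)
    finally show ?thesis by (simp add: L2_inner_commute)
  qed
  have "(\<lambda>n. \<Sum>b\<in>Basis. partial b (\<phi> n) \<bullet>\<^sub>2 wd [b] w) \<longlonglongrightarrow> (\<Sum>b\<in>Basis. wd [b] v \<bullet>\<^sub>2 wd [b] w)"
  proof (intro tendsto_sum L2_inner_tendsto)
    fix b :: 'a assume b: "b \<in> Basis"
    show "\<forall>\<^sub>F n in sequentially. partial b (\<phi> n) \<in> L2 \<and> wd [b] w \<in> L2" "wd [b] v \<in> L2" "wd [b] w \<in> L2"
      by (simp_all add: tests_L2[OF test_partial[OF \<phi>(1) b]] wd1_L2[OF w1 b] wd1_L2[OF v1 b])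
    show "(\<lambda>n. norm2 (\<lambda>x. partial b (\<phi> n) x - wd [b] v x)) \<longlonglongrightarrow> 0"
      using \<phi>(3)[OF b] unfolding L2_norm_minus_commute[of \<Omega> "wd [b] v"] .
  qed auto
  moreover have "(\<lambda>n. - (\<phi> n \<bullet>\<^sub>2 weak_laplacian \<Omega> w)) \<longlonglongrightarrow> - (v \<bullet>\<^sub>2 weak_laplacian \<Omega> w)"
  proof (intro tendsto_minus L2_inner_tendsto)
    show "\<forall>\<^sub>F n in sequentially. \<phi> n \<in> L2 \<and> weak_laplacian \<Omega> w \<in> L2" "v \<in> L2" "weak_laplacian \<Omega> w \<in> L2"
      by (simp_all add: tests_L2[OF \<phi>(1)] sobolev_L2[OF v1] laplacian_L2[OF assms(2)])
    show "(\<lambda>n. norm2 (\<lambda>x. \<phi> n x - v x)) \<longlonglongrightarrow> 0"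
      using \<phi>(2) unfolding L2_norm_minus_commute[of \<Omega> v] .
  qed auto
  ultimately show ?thesis unfolding eq by (rule LIMSEQ_unique)
qed

end

section \<open>Compactness of the embedding into the space of square integrable functions\<close>

text \<open>Jensen's inequality for a weight that is not normalised. It is applied to the indicator
  of [0, 1] and to the hat kernel.\<close>

lemma weighted_Cauchy_Schwarz:
  fixes k f :: "'b \<Rightarrow> real"
  assumes "\<And>x. 0 \<le> k x" "integrable M k" "integrable M (\<lambda>x. k x * f x)" "integrable M (\<lambda>x. k x * (f x)\<^sup>2)"
  shows "(\<integral>x. k x * f x \<partial>M)\<^sup>2 \<le> (\<integral>x. k x * (f x)\<^sup>2 \<partial>M) * (\<integral>x. k x \<partial>M)"
proof (rule discriminant_le)
  show "0 \<le> (\<integral>x. k x \<partial>M)" using assms(1) by simp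
  fix t
  have "0 \<le> (\<integral>x. k x * (f x - t)\<^sup>2 \<partial>M)" using assms(1) by simp
  also have "\<dots> = (\<integral>x. k x * (f x)\<^sup>2 - 2 * t * (k x * f x) + t\<^sup>2 * k x \<partial>M)"
    by (simp add: power2_diff algebra_simps)
  also have "\<dots> = (\<integral>x. k x * (f x)\<^sup>2 \<partial>M) - 2 * t * (\<integral>x. k x * f x \<partial>M) + t\<^sup>2 * (\<integral>x. k x \<partial>M)"
    using assms by simp
  finally show "0 \<le> \<dots>" .
qed

lemma nn_integral_lborel_translate:
  fixes F :: "'a::euclidean_space \<Rightarrow> ennreal"
  assumes [measurable]: "F \<in> borel_measurable borel"
  shows "(\<integral>\<^sup>+x. F (x + c) \<partial>lborel) = (\<integral>\<^sup>+x. F x \<partial>lborel)"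
proof -
  have "(\<integral>\<^sup>+x. F x \<partial>lborel) = (\<integral>\<^sup>+x. F x \<partial>distr lborel borel ((+) c))"
    by (simp add: lborel_distr_plus)
  also have "\<dots> = (\<integral>\<^sup>+x. F (c + x) \<partial>lborel)"
    by (intro nn_integral_distr) auto
  finally show ?thesis by (simp add: add.commute)
qed

section \<open>Translation estimate and smoothing by a kernel\<close>

context bounded_domain
begin

text \<open>The Dirichlet integral written with classical partials; on test functions no choice of
  representative intervenes.\<close>

definition energy :: "('a \<Rightarrow> real) \<Rightarrow> real" where
  "energy \<phi> = (\<Sum>b\<in>Basis. (norm2 (partial b \<phi>))\<^sup>2)"

lemma energy_nonneg: "0 \<le> energy \<phi>"
  by (simp add: energy_def sum_nonneg)

lemma test_integrable_lborel:
  assumes "\<phi> \<in> tests" "\<psi> \<in> tests"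
  shows "integrable lborel (\<lambda>x. \<phi> x * \<psi> x)"
proof -
  have "(\<lambda>x. if x \<in> \<Omega> then \<phi> x * \<psi> x else 0) = (\<lambda>x. \<phi> x * \<psi> x)"
    using test_zero_outside[OF assms(1)] by auto
  then have "integrable lebesgue (\<lambda>x. \<phi> x * \<psi> x)"
    using integrable_mult_L2[OF tests_L2[OF assms(1)] tests_L2[OF assms(2)]]
      Lebesgue_Measure.integrable_restrict_UNIV[OF sets_lebesgue, of "\<lambda>x. \<phi> x * \<psi> x"] by simp
  then show ?thesis
    using test_measurable[OF assms(1)] test_measurable[OF assms(2)]
    by (subst (asm) integrable_completion) auto
qed

lemma norm2_test:
  assumes "\<phi> \<in> tests"
  shows "ennreal ((norm2 \<phi>)\<^sup>2) = (\<integral>\<^sup>+x. ennreal ((\<phi> x)\<^sup>2) \<partial>lborel)"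
proof -
  have "(norm2 \<phi>)\<^sup>2 = (\<integral>x. \<phi> x * \<phi> x \<partial>lborel)"
    unfolding L2_norm_sq L2_inner_def
    using test_measurable[OF assms] test_zero_outside[OF assms]
    by (intro integral_lebesgue_on_eq_lborel) auto
  then show ?thesis
    using test_integrable_lborel[OF assms assms]
    by (simp add: nn_integral_eq_integral power2_eq_square)
qed

lemma frechet_derivative_Basis:
  assumes "\<phi> \<in> tests"
  shows "frechet_derivative \<phi> (at x) h = (\<Sum>b\<in>Basis. (h \<bullet> b) * partial b \<phi> x)"
proof -
  have lin: "linear (frechet_derivative \<phi> (at x))"
    using test_has_derivative[OF assms] by (rule has_derivative_linear)
  have "frechet_derivative \<phi> (at x) h = frechet_derivative \<phi> (at x) (\<Sum>b\<in>Basis. (h \<bullet> b) *\<^sub>R b)"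
    by (simp add: euclidean_representation)
  also have "\<dots> = (\<Sum>b\<in>Basis. (h \<bullet> b) * partial b \<phi> x)"
    by (simp add: linear_sum[OF lin] linear_cmul[OF lin])
  finally show ?thesis .
qed

text \<open>The increment is the integral over t in [0, 1] of the derivative in direction h at x + t
  h. After Cauchy-Schwarz in t, Tonelli's theorem brings the x-integral inside, where translation
  invariance removes t.\<close>

lemma translation_estimate:
  assumes \<phi>: "\<phi> \<in> tests"
  shows "(\<integral>\<^sup>+x. ennreal ((\<phi> (x + h) - \<phi> x)\<^sup>2) \<partial>lborel) \<le> ennreal ((norm h)\<^sup>2 * energy \<phi>)"
proof -
  define g where "g x = (\<Sum>b\<in>Basis. (partial b \<phi> x)\<^sup>2)" for x
  have pc: "continuous_on UNIV (partial b \<phi>)" if "b \<in> Basis" for b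
    using test_continuous[OF test_partial[OF \<phi> that]] .
  have gc: "continuous_on UNIV g"
    unfolding g_def by (intro continuous_intros pc)
  have g0: "0 \<le> g x" for x by (simp add: g_def sum_nonneg)
  have [measurable]: "g \<in> borel_measurable borel" "\<phi> \<in> borel_measurable borel"
    using gc test_measurable[OF \<phi>] by (auto intro: borel_measurable_continuous_onI)
  have pt: "ennreal ((\<phi> (x + h) - \<phi> x)\<^sup>2)
      \<le> ennreal ((norm h)\<^sup>2) * (\<integral>\<^sup>+t. ennreal (indicator {0..1} t * g (x + t *\<^sub>R h)) \<partial>lborel)" for x
  proof -
    define f where "f t = frechet_derivative \<phi> (at (x + t *\<^sub>R h)) h" for t
    have f_eq: "f = (\<lambda>t. \<Sum>b\<in>Basis. (h \<bullet> b) * partial b \<phi> (x + t *\<^sub>R h))"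
      unfolding f_def by (rule ext) (rule frechet_derivative_Basis[OF \<phi>])
    let ?k = "indicator {0..1} :: real \<Rightarrow> real"
    have fc: "isCont f t" for t
    proof -
      have "continuous_on UNIV f"
        unfolding f_eq by (intro continuous_intros continuous_on_compose2[OF pc]) auto
      then show ?thesis
        using continuous_on_eq_continuous_at[OF open_UNIV, of f] by blast
    qed
    have gcont: "isCont (\<lambda>t. g (x + t *\<^sub>R h)) t" for t
    proof -
      have "continuous_on UNIV (\<lambda>t. g (x + t *\<^sub>R h))"
        by (intro continuous_on_compose2[OF gc] continuous_intros) auto
      then show ?thesis
        using continuous_on_eq_continuous_at[OF open_UNIV, of "\<lambda>t. g (x + t *\<^sub>R h)"] by blast
    qed
    have der: "((\<lambda>t. \<phi> (x + t *\<^sub>R h)) has_real_derivative f t) (at t)" for t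
    proof -
      have "((\<lambda>s. \<phi> ((x + t *\<^sub>R h) + s *\<^sub>R h)) has_real_derivative f t) (at 0)"
        unfolding f_def by (rule has_derivative_line[OF test_has_derivative[OF \<phi>]])
      then have "((\<lambda>s. \<phi> ((x + t *\<^sub>R h) + (s + - t) *\<^sub>R h)) has_real_derivative f t) (at t)"
        using DERIV_shift[of "\<lambda>s. \<phi> ((x + t *\<^sub>R h) + s *\<^sub>R h)" _ t "- t"] by simp
      then show ?thesis by (simp add: algebra_simps)
    qed
    have ftc: "has_bochner_integral lborel (\<lambda>t. f t * ?k t) (\<phi> (x + 1 *\<^sub>R h) - \<phi> (x + 0 *\<^sub>R h))"
      by (rule has_bochner_integral_FTC_Icc_real) (use der fc in auto)
    then have int_f: "integrable lborel (\<lambda>t. ?k t * f t)"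
      and eq: "(\<integral>t. ?k t * f t \<partial>lborel) = \<phi> (x + h) - \<phi> x"
      by (auto simp: has_bochner_integral_iff mult.commute)
    have int_f2: "integrable lborel (\<lambda>t. ?k t * (f t)\<^sup>2)"
      using borel_integrable_atLeastAtMost[of 0 1 "\<lambda>t. (f t)\<^sup>2"] fc
      by (simp add: mult.commute continuous_power)
    have int_g: "integrable lborel (\<lambda>t. ?k t * g (x + t *\<^sub>R h))"
      using borel_integrable_atLeastAtMost[of 0 1 "\<lambda>t. g (x + t *\<^sub>R h)"] gcont
      by (simp add: mult.commute)
    have "(\<phi> (x + h) - \<phi> x)\<^sup>2 \<le> (\<integral>t. ?k t * (f t)\<^sup>2 \<partial>lborel) * (\<integral>t. ?k t \<partial>lborel)"
      unfolding eq[symmetric] by (rule weighted_Cauchy_Schwarz[OF _ _ int_f int_f2]) auto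
    also have "\<dots> = (\<integral>t. ?k t * (f t)\<^sup>2 \<partial>lborel)" by simp
    \<comment> \<open>Cauchy-Schwarz in the finite-dimensional space, at each t separately.\<close>
    also have "\<dots> \<le> (\<integral>t. (norm h)\<^sup>2 * (?k t * g (x + t *\<^sub>R h)) \<partial>lborel)"
    proof (rule integral_mono)
      fix t
      have "(f t)\<^sup>2 \<le> (\<Sum>b\<in>Basis. (h \<bullet> b)\<^sup>2) * g (x + t *\<^sub>R h)"
        unfolding f_eq g_def by (rule Cauchy_Schwarz_ineq_sum)
      also have "(\<Sum>b\<in>Basis. (h \<bullet> b)\<^sup>2) = (norm h)\<^sup>2"
        unfolding power2_norm_eq_inner by (subst euclidean_inner) (simp add: power2_eq_square)
      finally show "?k t * (f t)\<^sup>2 \<le> (norm h)\<^sup>2 * (?k t * g (x + t *\<^sub>R h))"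
        by (auto simp: indicator_def)
    qed (use int_f2 int_g in auto)
    also have "\<dots> = (norm h)\<^sup>2 * (\<integral>t. ?k t * g (x + t *\<^sub>R h) \<partial>lborel)" by simp
    finally have "ennreal ((\<phi> (x + h) - \<phi> x)\<^sup>2) \<le> ennreal ((norm h)\<^sup>2 * (\<integral>t. ?k t * g (x + t *\<^sub>R h) \<partial>lborel))"
      by (rule ennreal_leI)
    also have "\<dots> = ennreal ((norm h)\<^sup>2) * ennreal (\<integral>t. ?k t * g (x + t *\<^sub>R h) \<partial>lborel)"
      by (intro ennreal_mult) (auto intro!: integral_nonneg_AE simp: g0)
    also have "ennreal (\<integral>t. ?k t * g (x + t *\<^sub>R h) \<partial>lborel) = (\<integral>\<^sup>+t. ennreal (?k t * g (x + t *\<^sub>R h)) \<partial>lborel)"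
      by (rule nn_integral_eq_integral[symmetric, OF int_g]) (simp add: g0)
    finally show ?thesis .
  qed
  have "(\<integral>\<^sup>+x. ennreal ((\<phi> (x + h) - \<phi> x)\<^sup>2) \<partial>lborel)
      \<le> (\<integral>\<^sup>+x. ennreal ((norm h)\<^sup>2) * (\<integral>\<^sup>+t. ennreal (indicator {0..1} t * g (x + t *\<^sub>R h)) \<partial>lborel) \<partial>lborel)"
    by (intro nn_integral_mono pt)
  also have "\<dots> = ennreal ((norm h)\<^sup>2) * (\<integral>\<^sup>+x. (\<integral>\<^sup>+t. ennreal (indicator {0..1} t * g (x + t *\<^sub>R h)) \<partial>lborel) \<partial>lborel)"
    by (rule nn_integral_cmult) measurable
  also have "(\<integral>\<^sup>+x. (\<integral>\<^sup>+t. ennreal (indicator {0..1} t * g (x + t *\<^sub>R h)) \<partial>lborel) \<partial>lborel)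
      = (\<integral>\<^sup>+t. (\<integral>\<^sup>+x. ennreal (indicator {0..1::real} t * g (x + t *\<^sub>R h)) \<partial>lborel) \<partial>lborel)"
    by (rule lborel_pair.Fubini'[symmetric]) measurable
  also have "\<dots> = (\<integral>\<^sup>+t. ennreal (indicator {0..1::real} t) * (\<integral>\<^sup>+x. ennreal (g x) \<partial>lborel) \<partial>lborel)"
  proof (rule nn_integral_cong)
    fix t :: real
    have "(\<integral>\<^sup>+x. ennreal (indicator {0..1} t * g (x + t *\<^sub>R h)) \<partial>lborel)
        = ennreal (indicator {0..1} t) * (\<integral>\<^sup>+x. ennreal (g (x + t *\<^sub>R h)) \<partial>lborel)"
      by (subst nn_integral_cmult[symmetric]) (auto simp: ennreal_mult g0)
    then show "(\<integral>\<^sup>+x. ennreal (indicator {0..1} t * g (x + t *\<^sub>R h)) \<partial>lborel)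
        = ennreal (indicator {0..1} t) * (\<integral>\<^sup>+x. ennreal (g x) \<partial>lborel)"
      by (simp add: nn_integral_lborel_translate[of "\<lambda>x. ennreal (g x)"])
  qed
  also have "\<dots> = (\<integral>\<^sup>+x. ennreal (g x) \<partial>lborel)"
    by (subst nn_integral_multc) (auto simp: ennreal_indicator)
  also have "\<dots> = (\<Sum>b\<in>Basis. \<integral>\<^sup>+x. ennreal ((partial b \<phi> x)\<^sup>2) \<partial>lborel)"
  proof -
    have eq: "ennreal (g x) = (\<Sum>b\<in>Basis. ennreal ((partial b \<phi> x)\<^sup>2))" for x
      by (simp add: g_def)
    show ?thesis
      unfolding eq using test_measurable[OF test_partial[OF \<phi>]] by (intro nn_integral_sum) simp
  qed
  also have "\<dots> = ennreal (energy \<phi>)"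
    by (simp add: norm2_test[OF test_partial[OF \<phi>], symmetric] energy_def)
  finally show ?thesis by (simp add: ennreal_mult energy_nonneg)
qed

text \<open>The hat kernel is not normalised. Its Lipschitz constant is what lets convergence of the
  smeared functions spread from a countable dense set to all points.\<close>

definition kern :: "real \<Rightarrow> 'a \<Rightarrow> real" where
  "kern \<delta> z = max 0 (1 - norm z / \<delta>)"

definition kmass :: "real \<Rightarrow> real" where
  "kmass \<delta> = (\<integral>z. kern \<delta> z \<partial>lborel)"

definition smear :: "real \<Rightarrow> ('a \<Rightarrow> real) \<Rightarrow> 'a \<Rightarrow> real" where
  "smear \<delta> v x = (\<integral>z. kern \<delta> z * v (x + z) \<partial>lborel)"

lemma kern_bounds: "0 \<le> kern \<delta> z" "\<delta> > 0 \<Longrightarrow> kern \<delta> z \<le> 1"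
  by (auto simp: kern_def)

lemma kern_eq_0: "\<delta> > 0 \<Longrightarrow> norm z \<ge> \<delta> \<Longrightarrow> kern \<delta> z = 0"
  by (simp add: kern_def)

lemma kern_measurable [measurable]: "kern \<delta> \<in> borel_measurable borel"
  unfolding kern_def[abs_def] by measurable

lemma kern_Lipschitz:
  assumes "\<delta> > 0"
  shows "\<bar>kern \<delta> y - kern \<delta> z\<bar> \<le> norm (y - z) / \<delta>"
proof -
  have "\<bar>kern \<delta> y - kern \<delta> z\<bar> \<le> \<bar>norm y / \<delta> - norm z / \<delta>\<bar>"
    unfolding kern_def by (auto simp: max_def abs_if)
  also have "\<dots> = \<bar>norm y - norm z\<bar> / \<delta>"
    using assms by (simp add: diff_divide_distrib[symmetric])
  also have "\<dots> \<le> norm (y - z) / \<delta>"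
    using assms norm_triangle_ineq3[of y z] by (intro divide_right_mono) auto
  finally show ?thesis .
qed

lemma integrable_kern_mult:
  assumes "\<delta> > 0" "f \<in> borel_measurable borel" "\<And>z. \<bar>f z\<bar> \<le> B"
  shows "integrable lborel (\<lambda>z. kern \<delta> z * f z)"
proof (rule Bochner_Integration.integrable_bound)
  show "integrable lborel (\<lambda>z::'a. B * indicator (cball 0 \<delta>) z)"
    by (intro integrable_mult_right integrable_real_indicator emeasure_lborel_cball_finite) auto
  show "AE z in lborel. norm (kern \<delta> z * f z) \<le> norm (B * indicator (cball 0 \<delta>) z)"
  proof (rule AE_I2)
    fix z :: 'a
    have "B \<ge> 0" using assms(3)[of z] by simp
    show "norm (kern \<delta> z * f z) \<le> norm (B * indicator (cball 0 \<delta>) z)"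
    proof (cases "norm z \<ge> \<delta>")
      case False
      have "kern \<delta> z * \<bar>f z\<bar> \<le> 1 * B"
        using kern_bounds[of \<delta> z] assms by (intro mult_mono) auto
      with False \<open>B \<ge> 0\<close> show ?thesis by (simp add: abs_mult kern_bounds)
    qed (simp add: kern_eq_0 assms)
  qed
  show "(\<lambda>z. kern \<delta> z * f z) \<in> borel_measurable lborel" using assms(2) by measurable
qed

lemma integrable_kern: "\<delta> > 0 \<Longrightarrow> integrable lborel (kern \<delta>)"
  using integrable_kern_mult[of \<delta> "\<lambda>_. 1" 1] by simp

text \<open>The kernel is at least 1/2 on the ball of half the radius. Positivity allows division by
  the mass when the smoothed functions are compared with the original ones.\<close>

lemma kmass_pos:
  assumes "\<delta> > 0"
  shows "kmass \<delta> > 0"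
proof -
  have "1/2 * measure lborel (ball (0::'a) (\<delta>/2)) = (\<integral>z. 1/2 * indicator (ball (0::'a) (\<delta>/2)) z \<partial>lborel)"
    by simp
  also have "\<dots> \<le> kmass \<delta>"
    unfolding kmass_def
  proof (rule integral_mono)
    show "integrable lborel (\<lambda>z. 1/2 * indicator (ball (0::'a) (\<delta>/2)) z :: real)"
      by (intro integrable_mult_right integrable_real_indicator emeasure_lborel_ball_finite) auto
    show "1/2 * indicator (ball 0 (\<delta>/2)) z \<le> kern \<delta> z" for z :: 'a
      using assms by (auto simp: kern_def indicator_def field_simps max_def)
  qed (rule integrable_kern[OF assms])
  finally have "1/2 * measure lborel (ball (0::'a) (\<delta>/2)) \<le> kmass \<delta>" .
  moreover have "measure lborel (ball (0::'a) (\<delta>/2)) > 0"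
    using assms by (intro content_ball_pos) simp
  ultimately show ?thesis by linarith
qed

lemma integrable_kern_test:
  assumes "\<delta> > 0" "\<phi> \<in> tests"
  shows "integrable lborel (\<lambda>z. kern \<delta> z * \<phi> (x + z))"
proof -
  obtain B where "\<And>x. \<bar>\<phi> x\<bar> \<le> B" using test_bounded[OF assms(2)] by blast
  then show ?thesis
    using test_measurable[OF assms(2)] by (intro integrable_kern_mult assms(1)) auto
qed

lemma smear_diff:
  assumes "\<delta> > 0" "\<phi> \<in> tests" "\<psi> \<in> tests"
  shows "smear \<delta> (\<lambda>x. \<phi> x - \<psi> x) x = smear \<delta> \<phi> x - smear \<delta> \<psi> x"
  unfolding smear_def using assms by (simp add: right_diff_distrib integrable_kern_test)

lemma test_integral_abs_le:
  assumes "\<phi> \<in> tests"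
  shows "integrable lborel \<phi>" "(\<integral>x. \<bar>\<phi> x\<bar> \<partial>lborel) \<le> norm2 \<phi> * L2_norm \<Omega> (\<lambda>x. 1::real)"
proof -
  have m [measurable]: "\<phi> \<in> borel_measurable borel" using assms by (rule test_measurable)
  have "(\<lambda>x. if x \<in> \<Omega> then \<phi> x else 0) = \<phi>"
    using test_zero_outside[OF assms] by auto
  then have "integrable lebesgue \<phi>"
    using L2_imp_integrable[OF lmeasurable tests_L2[OF assms]]
      Lebesgue_Measure.integrable_restrict_UNIV[OF sets_lebesgue, of \<phi>] by simp
  then show "integrable lborel \<phi>"
    by (subst (asm) integrable_completion) auto
  have "(\<integral>x. \<bar>\<phi> x\<bar> \<partial>lborel) = (\<integral>x. \<bar>\<phi> x\<bar> \<partial>lebesgue_on \<Omega>)"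
    using test_zero_outside[OF assms]
    by (intro integral_lebesgue_on_eq_lborel[symmetric]) auto
  then show "(\<integral>x. \<bar>\<phi> x\<bar> \<partial>lborel) \<le> norm2 \<phi> * L2_norm \<Omega> (\<lambda>x. 1::real)"
    using L2_integral_abs_le[OF lmeasurable tests_L2[OF assms]] by simp
qed

text \<open>Moves the dependence on x from \<phi> to the kernel, whose Lipschitz bound then applies
  without any regularity of \<phi>.\<close>

lemma smear_eq:
  assumes "\<phi> \<in> tests"
  shows "smear \<delta> \<phi> x = (\<integral>y. kern \<delta> (y - x) * \<phi> y \<partial>lborel)"
proof -
  have [measurable]: "\<phi> \<in> borel_measurable borel" using assms by (rule test_measurable)
  have "(\<integral>y. (\<lambda>y. kern \<delta> (y - x) * \<phi> y) (y + x) \<partial>lborel) = (\<integral>y. kern \<delta> (y - x) * \<phi> y \<partial>lborel)"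
    by (rule lborel_integral_translate) measurable
  then show ?thesis by (simp add: smear_def add.commute)
qed

text \<open>Only the integral of |\<phi>| enters. For fixed \<delta> a family bounded in
  \<open>L2\<close> is therefore smeared into a uniformly bounded and equi-Lipschitz family.\<close>

lemma smear_bounds:
  assumes \<delta>: "\<delta> > 0" and \<phi>: "\<phi> \<in> tests" and K: "(\<integral>x. \<bar>\<phi> x\<bar> \<partial>lborel) \<le> K"
  shows "\<bar>smear \<delta> \<phi> x\<bar> \<le> K" "\<bar>smear \<delta> \<phi> x - smear \<delta> \<phi> q\<bar> \<le> norm (x - q) / \<delta> * K"
proof -
  have [measurable]: "\<phi> \<in> borel_measurable borel" using \<phi> by (rule test_measurable)
  have i\<phi>: "integrable lborel (\<lambda>y. \<bar>\<phi> y\<bar>)" using test_integral_abs_le(1)[OF \<phi>] by simp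
  have ik: "integrable lborel (\<lambda>y. kern \<delta> (y - x) * \<phi> y)" for x
    by (rule Bochner_Integration.integrable_bound[OF i\<phi>])
      (auto intro!: AE_I2 mult_left_le_one_le simp: abs_mult kern_bounds \<delta>)
  have "\<bar>smear \<delta> \<phi> x\<bar> \<le> (\<integral>y. \<bar>kern \<delta> (y - x) * \<phi> y\<bar> \<partial>lborel)"
    unfolding smear_eq[OF \<phi>] by (rule integral_abs_bound)
  also have "\<dots> \<le> (\<integral>y. \<bar>\<phi> y\<bar> \<partial>lborel)"
  proof (rule integral_mono)
    show "integrable lborel (\<lambda>y. \<bar>kern \<delta> (y - x) * \<phi> y\<bar>)" by (rule integrable_abs[OF ik])
    show "\<bar>kern \<delta> (y - x) * \<phi> y\<bar> \<le> \<bar>\<phi> y\<bar>" for y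
      by (auto intro!: mult_left_le_one_le simp: abs_mult kern_bounds \<delta>)
  qed (rule i\<phi>)
  finally show "\<bar>smear \<delta> \<phi> x\<bar> \<le> K" using K by simp
  have "smear \<delta> \<phi> x - smear \<delta> \<phi> q = (\<integral>y. (kern \<delta> (y - x) - kern \<delta> (y - q)) * \<phi> y \<partial>lborel)"
    unfolding smear_eq[OF \<phi>] using ik by (simp add: left_diff_distrib)
  also have "\<bar>\<dots>\<bar> \<le> (\<integral>y. \<bar>(kern \<delta> (y - x) - kern \<delta> (y - q)) * \<phi> y\<bar> \<partial>lborel)"
    by (rule integral_abs_bound)
  also have "\<dots> \<le> (\<integral>y. norm (x - q) / \<delta> * \<bar>\<phi> y\<bar> \<partial>lborel)"
  proof (rule integral_mono)
    show "integrable lborel (\<lambda>y. \<bar>(kern \<delta> (y - x) - kern \<delta> (y - q)) * \<phi> y\<bar>)"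
      using Bochner_Integration.integrable_diff[OF ik[of x] ik[of q]] by (simp add: left_diff_distrib)
    show "\<bar>(kern \<delta> (y - x) - kern \<delta> (y - q)) * \<phi> y\<bar> \<le> norm (x - q) / \<delta> * \<bar>\<phi> y\<bar>" for y
      using mult_right_mono[OF kern_Lipschitz[OF \<delta>, of "y - x" "y - q"], of "\<bar>\<phi> y\<bar>"]
      by (simp add: abs_mult norm_minus_commute)
  qed (use i\<phi> in auto)
  also have "\<dots> \<le> norm (x - q) / \<delta> * K"
    using \<delta> K by (simp del: times_divide_eq_left add: mult_left_mono)
  finally show "\<bar>smear \<delta> \<phi> x - smear \<delta> \<phi> q\<bar> \<le> norm (x - q) / \<delta> * K" .
qed

lemma smear_continuous:
  assumes "\<delta> > 0" "\<phi> \<in> tests"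
  shows "continuous_on UNIV (smear \<delta> \<phi>)"
proof -
  let ?K = "\<integral>x. \<bar>\<phi> x\<bar> \<partial>lborel"
  have "(?K / \<delta>)-lipschitz_on UNIV (smear \<delta> \<phi>)"
  proof (rule lipschitz_onI)
    show "dist (smear \<delta> \<phi> x) (smear \<delta> \<phi> y) \<le> ?K / \<delta> * dist x y" for x y
      using smear_bounds(2)[OF assms order_refl, of x y] by (simp add: dist_norm mult.commute)
  qed (use assms in auto)
  then show ?thesis by (rule lipschitz_on_continuous_on)
qed

lemma smear_L2:
  assumes "\<delta> > 0" "\<phi> \<in> tests"
  shows "smear \<delta> \<phi> \<in> L2"
proof -
  have m: "smear \<delta> \<phi> \<in> borel_measurable (lebesgue_on \<Omega>)"
    using borel_measurable_continuous_onI[OF smear_continuous[OF assms]]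
    by (simp add: measurable_restrict_space1 measurable_completion)
  interpret finite_measure "lebesgue_on \<Omega>" by (rule finite_measure_lebesgue_on[OF lmeasurable])
  have "integrable (lebesgue_on \<Omega>) (\<lambda>x. (smear \<delta> \<phi> x)\<^sup>2)"
  proof (rule integrable_const_bound[where B="(\<integral>x. \<bar>\<phi> x\<bar> \<partial>lborel)\<^sup>2"])
    show "AE x in lebesgue_on \<Omega>. norm ((smear \<delta> \<phi> x)\<^sup>2) \<le> (\<integral>x. \<bar>\<phi> x\<bar> \<partial>lborel)\<^sup>2"
      using power_mono[OF smear_bounds(1)[OF assms order_refl], where n=2] by (intro AE_I2) simp
  qed (use m in measurable)
  with m show ?thesis by (simp add: L2_space_def)
qed

text \<open>The difference is the kernel average of \<phi>(x) - \<phi>(x + z). Squaring by weighted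
  Cauchy-Schwarz and exchanging integrals leaves translation errors with |z| < \<delta>, so smearing
  is close to the identity uniformly on sets of bounded energy.\<close>

lemma smear_error:
  assumes \<delta>: "\<delta> > 0" and \<phi>: "\<phi> \<in> tests"
  shows "norm2 (\<lambda>x. kmass \<delta> * \<phi> x - smear \<delta> \<phi> x) \<le> kmass \<delta> * \<delta> * sqrt (energy \<phi>)"
proof -
  let ?c = "kmass \<delta>"
  have c: "?c > 0" by (rule kmass_pos[OF \<delta>])
  have [measurable]: "\<phi> \<in> borel_measurable borel" using \<phi> by (rule test_measurable)
  have [measurable]: "smear \<delta> \<phi> \<in> borel_measurable borel"
    by (rule borel_measurable_continuous_onI[OF smear_continuous[OF \<delta> \<phi>]])
  obtain B where B: "\<And>x. \<bar>\<phi> x\<bar> \<le> B" using test_bounded[OF \<phi>] by blast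
  have pt: "ennreal ((?c * \<phi> x - smear \<delta> \<phi> x)\<^sup>2)
      \<le> ennreal ?c * (\<integral>\<^sup>+z. ennreal (kern \<delta> z * (\<phi> (x + z) - \<phi> x)\<^sup>2) \<partial>lborel)" for x
  proof -
    have B2: "\<bar>\<phi> (x + z) - \<phi> x\<bar> \<le> 2 * B" for z
      using B[of "x + z"] B[of x] by linarith
    then have B3: "\<bar>(\<phi> (x + z) - \<phi> x)\<^sup>2\<bar> \<le> (2 * B)\<^sup>2" for z
      using power_mono[OF B2, where n=2] by simp
    have i1: "integrable lborel (\<lambda>z. kern \<delta> z * (\<phi> (x + z) - \<phi> x))"
      by (rule integrable_kern_mult[OF \<delta> _ B2]) measurable
    have i2: "integrable lborel (\<lambda>z. kern \<delta> z * (\<phi> (x + z) - \<phi> x)\<^sup>2)"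
      by (rule integrable_kern_mult[OF \<delta> _ B3]) measurable
    have "smear \<delta> \<phi> x - ?c * \<phi> x = (\<integral>z. kern \<delta> z * (\<phi> (x + z) - \<phi> x) \<partial>lborel)"
      unfolding smear_def kmass_def using \<phi> \<delta> integrable_kern[OF \<delta>]
      by (simp add: right_diff_distrib integrable_kern_test)
    then have "(?c * \<phi> x - smear \<delta> \<phi> x)\<^sup>2 = (\<integral>z. kern \<delta> z * (\<phi> (x + z) - \<phi> x) \<partial>lborel)\<^sup>2"
      by (simp add: power2_commute)
    also have "\<dots> \<le> (\<integral>z. kern \<delta> z * (\<phi> (x + z) - \<phi> x)\<^sup>2 \<partial>lborel) * ?c"
      unfolding kmass_def
      by (rule weighted_Cauchy_Schwarz[OF kern_bounds(1) integrable_kern[OF \<delta>] i1 i2])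
    finally have "ennreal ((?c * \<phi> x - smear \<delta> \<phi> x)\<^sup>2)
        \<le> ennreal (?c * (\<integral>z. kern \<delta> z * (\<phi> (x + z) - \<phi> x)\<^sup>2 \<partial>lborel))"
      by (intro ennreal_leI) (simp add: mult.commute)
    also have "\<dots> = ennreal ?c * ennreal (\<integral>z. kern \<delta> z * (\<phi> (x + z) - \<phi> x)\<^sup>2 \<partial>lborel)"
      using c by (intro ennreal_mult integral_nonneg_AE) (auto simp: kern_bounds)
    also have "ennreal (\<integral>z. kern \<delta> z * (\<phi> (x + z) - \<phi> x)\<^sup>2 \<partial>lborel)
        = (\<integral>\<^sup>+z. ennreal (kern \<delta> z * (\<phi> (x + z) - \<phi> x)\<^sup>2) \<partial>lborel)"
      by (rule nn_integral_eq_integral[symmetric, OF i2]) (simp add: kern_bounds)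
    finally show ?thesis .
  qed
  have "(\<integral>\<^sup>+x. ennreal ((?c * \<phi> x - smear \<delta> \<phi> x)\<^sup>2) \<partial>lborel)
      \<le> (\<integral>\<^sup>+x. ennreal ?c * (\<integral>\<^sup>+z. ennreal (kern \<delta> z * (\<phi> (x + z) - \<phi> x)\<^sup>2) \<partial>lborel) \<partial>lborel)"
    by (intro nn_integral_mono pt)
  also have "\<dots> = ennreal ?c * (\<integral>\<^sup>+x. (\<integral>\<^sup>+z. ennreal (kern \<delta> z * (\<phi> (x + z) - \<phi> x)\<^sup>2) \<partial>lborel) \<partial>lborel)"
    by (rule nn_integral_cmult) measurable
  also have "(\<integral>\<^sup>+x. (\<integral>\<^sup>+z. ennreal (kern \<delta> z * (\<phi> (x + z) - \<phi> x)\<^sup>2) \<partial>lborel) \<partial>lborel)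
      = (\<integral>\<^sup>+z. (\<integral>\<^sup>+x. ennreal (kern \<delta> z * (\<phi> (x + z) - \<phi> x)\<^sup>2) \<partial>lborel) \<partial>lborel)"
    by (rule lborel_pair.Fubini'[symmetric]) measurable
  also have "\<dots> \<le> (\<integral>\<^sup>+z. ennreal (\<delta>\<^sup>2 * energy \<phi>) * ennreal (kern \<delta> z) \<partial>lborel)"
  proof (rule nn_integral_mono)
    fix z :: 'a
    have "(\<integral>\<^sup>+x. ennreal (kern \<delta> z * (\<phi> (x + z) - \<phi> x)\<^sup>2) \<partial>lborel)
        = ennreal (kern \<delta> z) * (\<integral>\<^sup>+x. ennreal ((\<phi> (x + z) - \<phi> x)\<^sup>2) \<partial>lborel)"
      by (subst nn_integral_cmult[symmetric]) (auto simp: ennreal_mult kern_bounds)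
    also have "\<dots> \<le> ennreal (kern \<delta> z) * ennreal (\<delta>\<^sup>2 * energy \<phi>)"
    \<comment> \<open>Beyond \<delta> the kernel vanishes; within, the squared length of z is at
      most \<delta>^2.\<close>
    proof (cases "norm z \<ge> \<delta>")
      case False
      have "(norm z)\<^sup>2 * energy \<phi> \<le> \<delta>\<^sup>2 * energy \<phi>"
        using False energy_nonneg by (intro mult_right_mono power_mono) auto
      then show ?thesis
        using translation_estimate[OF \<phi>, of z]
        by (intro mult_left_mono) (auto intro: order_trans ennreal_leI)
    qed (simp add: kern_eq_0 \<delta>)
    finally show "(\<integral>\<^sup>+x. ennreal (kern \<delta> z * (\<phi> (x + z) - \<phi> x)\<^sup>2) \<partial>lborel)
        \<le> ennreal (\<delta>\<^sup>2 * energy \<phi>) * ennreal (kern \<delta> z)" by (simp add: mult.commute)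
  qed
  also have "\<dots> = ennreal (\<delta>\<^sup>2 * energy \<phi>) * ennreal ?c"
    unfolding kmass_def using nn_integral_eq_integral[OF integrable_kern[OF \<delta>]]
    by (subst nn_integral_cmult) (auto simp: kern_bounds)
  also have "ennreal ?c * (ennreal (\<delta>\<^sup>2 * energy \<phi>) * ennreal ?c) = ennreal ((?c * \<delta>)\<^sup>2 * energy \<phi>)"
  proof -
    have *: "ennreal a * (ennreal b * ennreal a) = ennreal (a * (b * a))" if "0 \<le> a" "0 \<le> b" for a b
      using that by (simp add: ennreal_mult)
    have "ennreal ?c * (ennreal (\<delta>\<^sup>2 * energy \<phi>) * ennreal ?c) = ennreal (?c * ((\<delta>\<^sup>2 * energy \<phi>) * ?c))"
      by (rule *) (use c energy_nonneg[of \<phi>] in auto)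
    also have "?c * ((\<delta>\<^sup>2 * energy \<phi>) * ?c) = (?c * \<delta>)\<^sup>2 * energy \<phi>"
      by (simp add: power2_eq_square)
    finally show ?thesis .
  qed
  finally have le: "(\<integral>\<^sup>+x. ennreal ((?c * \<phi> x - smear \<delta> \<phi> x)\<^sup>2) \<partial>lborel) \<le> ennreal ((?c * \<delta>)\<^sup>2 * energy \<phi>)"
    by (simp add: mult_left_mono)
  let ?d = "\<lambda>x. ?c * \<phi> x - smear \<delta> \<phi> x"
  have dL: "?d \<in> L2" by (intro L2_diff L2_scale tests_L2[OF \<phi>] smear_L2[OF \<delta> \<phi>])
  \<comment> \<open>The norm sees only the domain, the estimate above the whole space; the integrand
    is nonnegative, so enlarging the set is harmless.\<close>
  have "ennreal ((norm2 ?d)\<^sup>2) = ennreal (\<integral>x. (?d x)\<^sup>2 \<partial>lebesgue_on \<Omega>)"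
    by (simp add: L2_norm_def)
  also have "\<dots> = (\<integral>\<^sup>+x. ennreal ((?d x)\<^sup>2) \<partial>lebesgue_on \<Omega>)"
    using dL by (intro nn_integral_eq_integral[symmetric]) (auto simp: L2_space_def)
  also have "\<dots> = (\<integral>\<^sup>+x. ennreal ((?d x)\<^sup>2) * indicator \<Omega> x \<partial>lebesgue)"
    by (rule nn_integral_restrict_space) simp
  also have "\<dots> \<le> (\<integral>\<^sup>+x. ennreal ((?d x)\<^sup>2) \<partial>lebesgue)"
    by (intro nn_integral_mono) (auto simp: indicator_def)
  also have "\<dots> = (\<integral>\<^sup>+x. ennreal ((?d x)\<^sup>2) \<partial>lborel)"
    by (rule nn_integral_completion)
  also note le
  finally have "(norm2 ?d)\<^sup>2 \<le> (?c * \<delta>)\<^sup>2 * energy \<phi>"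
    using energy_nonneg[of \<phi>] by simp
  then have "norm2 ?d \<le> sqrt ((?c * \<delta>)\<^sup>2 * energy \<phi>)" by (rule real_le_rsqrt)
  then show ?thesis using c \<delta> by (simp add: real_sqrt_mult)
qed

end

section \<open>The Rellich compactness theorem\<close>

context bounded_domain
begin

lemma partial_lincomb:
  assumes "\<phi> \<in> tests" "\<psi> \<in> tests"
  shows "partial b (\<lambda>x. c * \<phi> x + d * \<psi> x) = (\<lambda>x. c * partial b \<phi> x + d * partial b \<psi> x)"
proof
  fix x
  have "((\<lambda>x. c * \<phi> x + d * \<psi> x) has_derivative
      (\<lambda>h. c * frechet_derivative \<phi> (at x) h + d * frechet_derivative \<psi> (at x) h)) (at x)"
    by (intro derivative_intros test_has_derivative[OF assms(1)] test_has_derivative[OF assms(2)])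
  from frechet_derivative_at[OF this]
  show "partial b (\<lambda>x. c * \<phi> x + d * \<psi> x) x = c * partial b \<phi> x + d * partial b \<psi> x"
    by metis
qed

lemma partial_diff:
  assumes "\<phi> \<in> tests" "\<psi> \<in> tests"
  shows "partial b (\<lambda>x. \<phi> x - \<psi> x) = (\<lambda>x. partial b \<phi> x - partial b \<psi> x)"
  using partial_lincomb[OF assms, where c=1 and d="-1"] by simp

lemma energy_diff_le:
  assumes "\<phi> \<in> tests" "\<psi> \<in> tests"
  shows "energy (\<lambda>x. \<phi> x - \<psi> x) \<le> 2 * energy \<phi> + 2 * energy \<psi>"
proof -
  have "(norm2 (partial b (\<lambda>x. \<phi> x - \<psi> x)))\<^sup>2 \<le> 2 * (norm2 (partial b \<phi>))\<^sup>2 + 2 * (norm2 (partial b \<psi>))\<^sup>2"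
    if b: "b \<in> Basis" for b
  proof -
    note p = tests_L2[OF test_partial[OF assms(1) b]] tests_L2[OF test_partial[OF assms(2) b]]
    have "norm2 (partial b (\<lambda>x. \<phi> x - \<psi> x)) \<le> norm2 (partial b \<phi>) + norm2 (partial b \<psi>)"
      unfolding partial_diff[OF assms]
      using L2_norm_triangle_diff[OF p(1) L2_zero p(2)] by (simp add: L2_norm_def)
    then have "(norm2 (partial b (\<lambda>x. \<phi> x - \<psi> x)))\<^sup>2 \<le> (norm2 (partial b \<phi>) + norm2 (partial b \<psi>))\<^sup>2"
      by (intro power_mono) auto
    also have "\<dots> \<le> 2 * (norm2 (partial b \<phi>))\<^sup>2 + 2 * (norm2 (partial b \<psi>))\<^sup>2"
      using sum_squares_bound[of "norm2 (partial b \<phi>)" "norm2 (partial b \<psi>)"] by (simp add: power2_sum)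
    finally show ?thesis .
  qed
  then show ?thesis
    unfolding energy_def sum_distrib_left sum.distrib[symmetric] by (rule sum_mono)
qed

text \<open>At each scale the smeared functions are bounded and equi-Lipschitz, so convergence at
  countably many points forces convergence everywhere and, by dominated convergence, in
  \<open>L2\<close>. The smearing error is uniformly small at small scales, hence the extracted
  subsequence is itself Cauchy.\<close>

lemma Rellich:
  fixes \<phi> :: "nat \<Rightarrow> 'a \<Rightarrow> real"
  assumes \<phi>: "\<And>n. \<phi> n \<in> tests" and B: "\<And>n. norm2 (\<phi> n) \<le> B" and C: "\<And>n. energy (\<phi> n) \<le> C"
  obtains r :: "nat \<Rightarrow> nat" where "strict_mono r"
    "\<And>e. e > 0 \<Longrightarrow> \<exists>N. \<forall>m\<ge>N. \<forall>n\<ge>N. norm2 (\<lambda>x. \<phi> (r m) x - \<phi> (r n) x) < e"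
proof -
  obtain D :: "'a set" where D: "countable D" "\<And>X. open X \<Longrightarrow> X \<noteq> {} \<Longrightarrow> \<exists>d\<in>D. d \<in> X"
    using countable_dense_exists by metis
  define K where "K = B * L2_norm \<Omega> (\<lambda>x::'a. 1::real)"
  have K: "(\<integral>x. \<bar>\<phi> n x\<bar> \<partial>lborel) \<le> K" for n
    using test_integral_abs_le(2)[OF \<phi>, of n] B[of n] unfolding K_def
    by (meson L2_norm_nonneg mult_right_mono order_trans)
  define \<delta> where "\<delta> k = 1 / (real k + 1)" for k
  have \<delta>: "\<delta> k > 0" for k by (simp add: \<delta>_def)
  note sb = smear_bounds[OF \<delta> \<phi> K]
  \<comment> \<open>Scale and point are joined into one countable index set, so a single extraction
    serves all scales.\<close>
  define F where "F n = (\<lambda>(k, q). smear (\<delta> k) (\<phi> n) q)" for n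
  obtain r where r: "strict_mono (r::nat\<Rightarrow>nat)"
    and conv: "\<And>p. p \<in> UNIV \<times> D \<Longrightarrow> \<exists>l. (\<lambda>n. F (r n) p) \<longlonglongrightarrow> l"
  proof (rule function_convergent_subsequence[of "UNIV \<times> D" F K])
    show "countable ((UNIV :: nat set) \<times> D)" using D(1) by auto
    show "norm (F n p) \<le> K" if "p \<in> UNIV \<times> D" for n p
      using sb(1) by (simp add: F_def split: prod.splits)
  qed (rule that)
  have Cauchy: "Cauchy (\<lambda>n. smear (\<delta> k) (\<phi> (r n)) x)" for k x
  proof (rule metric_CauchyI)
    fix e :: real assume e: "e > 0"
    \<comment> \<open>A Lipschitz constant with |K| + 1 in place of K, so that it is positive and
      may be divided by.\<close>
    define A where "A = 1 / \<delta> k * (\<bar>K\<bar> + 1)"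
    have A: "A > 0" unfolding A_def using \<delta>[of k] by (intro mult_pos_pos) auto
    define s where "s = e / 3 / A"
    have s: "s > 0" using e A by (simp add: s_def)
    obtain q where q: "q \<in> D" "q \<in> ball x s"
      using D(2)[of "ball x s"] s by auto
    have near: "\<bar>smear (\<delta> k) (\<phi> n) x - smear (\<delta> k) (\<phi> n) q\<bar> < e / 3" for n
    proof -
      have "\<bar>smear (\<delta> k) (\<phi> n) x - smear (\<delta> k) (\<phi> n) q\<bar> \<le> norm (x - q) / \<delta> k * K" by (rule sb(2))
      also have "\<dots> \<le> norm (x - q) / \<delta> k * (\<bar>K\<bar> + 1)"
        using \<delta>[of k] by (intro mult_left_mono) auto
      also have "\<dots> = norm (x - q) * A" by (simp add: A_def)
      also have "\<dots> < s * A"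
        using q(2) A by (intro mult_strict_right_mono) (auto simp: dist_norm)
      also have "\<dots> = e / 3" using A by (simp add: s_def)
      finally show ?thesis .
    qed
    have "Cauchy (\<lambda>n. F (r n) (k, q))"
      using conv[of "(k, q)"] q(1) by (auto intro: LIMSEQ_imp_Cauchy)
    then obtain N where N: "\<And>m n. m \<ge> N \<Longrightarrow> n \<ge> N \<Longrightarrow> dist (F (r m) (k, q)) (F (r n) (k, q)) < e / 3"
      using e unfolding Cauchy_def by (meson divide_pos_pos zero_less_numeral)
    have "dist (smear (\<delta> k) (\<phi> (r m)) x) (smear (\<delta> k) (\<phi> (r n)) x) < e" if "m \<ge> N" "n \<ge> N" for m n
      using N[OF that] near[of "r m"] near[of "r n"] unfolding F_def dist_real_def prod.case by arith
    then show "\<exists>M. \<forall>m\<ge>M. \<forall>n\<ge>M. dist (smear (\<delta> k) (\<phi> (r m)) x) (smear (\<delta> k) (\<phi> (r n)) x) < e" by blast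
  qed
  define g where "g k x = lim (\<lambda>n. smear (\<delta> k) (\<phi> (r n)) x)" for k x
  have g: "(\<lambda>n. smear (\<delta> k) (\<phi> (r n)) x) \<longlonglongrightarrow> g k x" for k x
    using Cauchy[of k x] unfolding g_def by (simp add: Cauchy_convergent_iff convergent_LIMSEQ_iff)
  have gK: "\<bar>g k x\<bar> \<le> K" for k x
    by (rule tendsto_upperbound[OF tendsto_rabs[OF g]]) (auto intro!: always_eventually sb(1))
  interpret finite_measure "lebesgue_on \<Omega>" by (rule finite_measure_lebesgue_on[OF lmeasurable])
  have sm: "smear (\<delta> k) (\<phi> n) \<in> L2" for k n by (rule smear_L2[OF \<delta> \<phi>])
  have gm: "g k \<in> borel_measurable (lebesgue_on \<Omega>)" for k
    by (rule borel_measurable_LIMSEQ_real[OF g]) (rule L2_measurable[OF sm])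
  have gL: "g k \<in> L2" for k
  proof -
    have "integrable (lebesgue_on \<Omega>) (\<lambda>x. (g k x)\<^sup>2)"
    proof (rule integrable_const_bound[where B="K\<^sup>2"])
      show "AE x in lebesgue_on \<Omega>. norm ((g k x)\<^sup>2) \<le> K\<^sup>2"
        using power_mono[OF gK, where n=2] by (intro AE_I2) simp
    qed (use gm in measurable)
    with gm show ?thesis by (simp add: L2_space_def)
  qed
  have glim: "(\<lambda>n. norm2 (\<lambda>x. smear (\<delta> k) (\<phi> (r n)) x - g k x)) \<longlonglongrightarrow> 0" for k
  proof -
    have "(\<lambda>n. \<integral>x. (norm (smear (\<delta> k) (\<phi> (r n)) x - g k x))\<^sup>2 \<partial>lebesgue_on \<Omega>) \<longlonglongrightarrow> (\<integral>x. 0 \<partial>lebesgue_on \<Omega>)"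
    proof (rule integral_dominated_convergence[where w="\<lambda>x. (2 * K)\<^sup>2"])
      show "AE x in lebesgue_on \<Omega>. norm ((norm (smear (\<delta> k) (\<phi> (r n)) x - g k x))\<^sup>2) \<le> (2 * K)\<^sup>2" for n
      proof (rule AE_I2)
        fix x
        have "norm (smear (\<delta> k) (\<phi> (r n)) x - g k x) \<le> 2 * K"
          using sb(1)[of k "r n" x] gK[of k x] by (simp add: abs_le_iff)
        from power_mono[OF this, of 2]
        show "norm ((norm (smear (\<delta> k) (\<phi> (r n)) x - g k x))\<^sup>2) \<le> (2 * K)\<^sup>2" by simp
      qed
      show "AE x in lebesgue_on \<Omega>. (\<lambda>n. (norm (smear (\<delta> k) (\<phi> (r n)) x - g k x))\<^sup>2) \<longlonglongrightarrow> 0"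
      proof (rule AE_I2)
        fix x
        have "(\<lambda>n. (norm (smear (\<delta> k) (\<phi> (r n)) x - g k x))\<^sup>2) \<longlonglongrightarrow> (norm (g k x - g k x))\<^sup>2"
          by (intro tendsto_intros g)
        then show "(\<lambda>n. (norm (smear (\<delta> k) (\<phi> (r n)) x - g k x))\<^sup>2) \<longlonglongrightarrow> 0" by simp
      qed
      show "(\<lambda>x. (norm (smear (\<delta> k) (\<phi> (r n)) x - g k x))\<^sup>2) \<in> borel_measurable (lebesgue_on \<Omega>)" for n
        using gm[of k] L2_measurable[OF sm[of k "r n"]] by measurable
    qed auto
    then have "(\<lambda>n. sqrt (\<integral>x. (norm (smear (\<delta> k) (\<phi> (r n)) x - g k x))\<^sup>2 \<partial>lebesgue_on \<Omega>)) \<longlonglongrightarrow> sqrt 0"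
      by (intro tendsto_real_sqrt) simp
    then show ?thesis by (simp add: L2_norm_def)
  qed
  show thesis
  proof (rule that[OF r])
    fix e :: real assume e: "e > 0"
    have C0: "C \<ge> 0" using order_trans[OF energy_nonneg C] .
    \<comment> \<open>The number 4 C bounds the energy of a difference of two members:
      \<open>energy_diff_le\<close> gives 2 C + 2 C.\<close>
    obtain k where k: "\<delta> k * sqrt (4 * C) < e / 2"
    proof -
      have "(\<lambda>k. \<delta> k * sqrt (4 * C)) \<longlonglongrightarrow> 0" unfolding \<delta>_def by real_asymp
      then have "\<forall>\<^sub>F k in sequentially. \<delta> k * sqrt (4 * C) < e / 2"
        by (rule order_tendstoD) (use e in simp)
      then show thesis using that unfolding eventually_sequentially by blast
    qed
    \<comment> \<open>Every estimate below carries this mass as a factor, which cancels in the last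
      line.\<close>
    let ?c = "kmass (\<delta> k)"
    have c: "?c > 0" by (rule kmass_pos[OF \<delta>])
    have "\<forall>\<^sub>F n in sequentially. norm2 (\<lambda>x. smear (\<delta> k) (\<phi> (r n)) x - g k x) < ?c * e / 4"
      by (rule order_tendstoD[OF glim]) (use c e in simp)
    then obtain N where N: "\<And>n. n \<ge> N \<Longrightarrow> norm2 (\<lambda>x. smear (\<delta> k) (\<phi> (r n)) x - g k x) < ?c * e / 4"
      unfolding eventually_sequentially by blast
    have "norm2 (\<lambda>x. \<phi> (r m) x - \<phi> (r n) x) < e" if mn: "m \<ge> N" "n \<ge> N" for m n
    proof -
      let ?w = "\<lambda>x. \<phi> (r m) x - \<phi> (r n) x"
      have w: "?w \<in> tests" by (intro test_diff \<phi>)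
      have "energy ?w \<le> 4 * C"
        using energy_diff_le[OF \<phi> \<phi>, of "r m" "r n"] C[of "r m"] C[of "r n"] by linarith
      then have "norm2 (\<lambda>x. ?c * ?w x - smear (\<delta> k) ?w x) \<le> ?c * \<delta> k * sqrt (4 * C)"
        using c \<delta>[of k] by (intro order_trans[OF smear_error[OF \<delta>[of k] w]] mult_left_mono real_sqrt_le_mono) auto
      also have "\<dots> < ?c * (e / 2)"
        using k c by (simp add: mult.assoc)
      finally have 1: "norm2 (\<lambda>x. ?c * ?w x - smear (\<delta> k) ?w x) < ?c * (e / 2)" .
      have "norm2 (smear (\<delta> k) ?w) = norm2 (\<lambda>x. smear (\<delta> k) (\<phi> (r m)) x - smear (\<delta> k) (\<phi> (r n)) x)"
        by (simp add: smear_diff[OF \<delta> \<phi> \<phi>, abs_def])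
      also have "\<dots> \<le> norm2 (\<lambda>x. smear (\<delta> k) (\<phi> (r m)) x - g k x) + norm2 (\<lambda>x. smear (\<delta> k) (\<phi> (r n)) x - g k x)"
        using L2_norm_triangle_diff[OF sm[of k "r m"] gL[of k] sm[of k "r n"]]
        by (simp only: L2_norm_minus_commute[of \<Omega> "g k"])
      also have "\<dots> < ?c * e / 4 + ?c * e / 4" using N mn by (intro add_strict_mono) auto
      finally have 2: "norm2 (smear (\<delta> k) ?w) < ?c * (e / 2)" by (simp add: mult.commute)
      have "?c * norm2 ?w = norm2 (\<lambda>x. ?c * ?w x)"
        using c by (simp add: L2_norm_scale)
      also have "\<dots> = norm2 (\<lambda>x. (?c * ?w x - smear (\<delta> k) ?w x) + smear (\<delta> k) ?w x)" by simp
      also have "\<dots> \<le> norm2 (\<lambda>x. ?c * ?w x - smear (\<delta> k) ?w x) + norm2 (smear (\<delta> k) ?w)"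
        by (intro L2_norm_triangle L2_diff L2_scale tests_L2[OF w] smear_L2[OF \<delta> w])
      also have "\<dots> < ?c * (e / 2) + ?c * (e / 2)" using 1 2 by (rule add_strict_mono)
      also have "\<dots> = ?c * e" by simp
      finally show ?thesis using c by simp
    qed
    then show "\<exists>N. \<forall>m\<ge>N. \<forall>n\<ge>N. norm2 (\<lambda>x. \<phi> (r m) x - \<phi> (r n) x) < e" by blast
  qed
qed

end

section \<open>The smallest Dirichlet eigenvalue bounds the Rayleigh quotient\<close>

context bounded_domain
begin

definition energy_inner :: "('a \<Rightarrow> real) \<Rightarrow> ('a \<Rightarrow> real) \<Rightarrow> real" where
  "energy_inner \<phi> \<psi> = (\<Sum>b\<in>Basis. partial b \<phi> \<bullet>\<^sub>2 partial b \<psi>)"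

lemma energy_lincomb:
  assumes "\<phi> \<in> tests" "\<psi> \<in> tests"
  shows "energy (\<lambda>x. c * \<phi> x + d * \<psi> x) = c\<^sup>2 * energy \<phi> + 2 * c * d * energy_inner \<phi> \<psi> + d\<^sup>2 * energy \<psi>"
proof -
  have "(norm2 (partial b (\<lambda>x. c * \<phi> x + d * \<psi> x)))\<^sup>2
      = c\<^sup>2 * (norm2 (partial b \<phi>))\<^sup>2 + 2 * c * d * (partial b \<phi> \<bullet>\<^sub>2 partial b \<psi>) + d\<^sup>2 * (norm2 (partial b \<psi>))\<^sup>2"
    if b: "b \<in> Basis" for b
  proof -
    note p = tests_L2[OF test_partial[OF assms(1) b]] tests_L2[OF test_partial[OF assms(2) b]]
    show ?thesis
      unfolding partial_lincomb[OF assms] L2_norm_sq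
      using p by (simp add: L2_inner_add_left L2_inner_add_right L2_add L2_scale
          L2_inner_commute[of _ "partial b \<psi>" "partial b \<phi>"] algebra_simps power2_eq_square)
  qed
  then show ?thesis
    by (simp add: energy_def energy_inner_def sum.distrib sum_distrib_left)
qed

lemma norm2_lincomb:
  assumes "v \<in> L2" "w \<in> L2"
  shows "(norm2 (\<lambda>x. c * v x + d * w x))\<^sup>2 = c\<^sup>2 * (norm2 v)\<^sup>2 + 2 * c * d * (v \<bullet>\<^sub>2 w) + d\<^sup>2 * (norm2 w)\<^sup>2"
  unfolding L2_norm_sq
  using assms by (simp add: L2_inner_add_left L2_inner_add_right L2_add L2_scale
      L2_inner_commute[of _ w v] algebra_simps power2_eq_square)

lemma energy_scale:
  assumes "\<phi> \<in> tests"
  shows "energy (\<lambda>x. c * \<phi> x) = c\<^sup>2 * energy \<phi>"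
  using energy_lincomb[OF assms assms, of c 0] by simp

text \<open>The parallelogram law turns a minimizing sequence that is Cauchy in \<open>L\<^sup>2\<close> into one with Cauchy
  gradients. The weak eigenvalue equation of the limit comes from the Cauchy-Schwarz inequality for
  the semidefinite form \<open>energy_inner \<phi> \<psi> - \<mu> (\<phi> \<bullet>\<^sub>2 \<psi>)\<close>, whose value at \<open>\<psi> n\<close> tends to \<open>0\<close>.\<close>

lemma minimizer_is_eigenvalue:
  fixes \<psi> :: "nat \<Rightarrow> 'a \<Rightarrow> real"
  assumes \<mu>: "\<And>\<phi>. \<phi> \<in> tests \<Longrightarrow> \<mu> * (norm2 \<phi>)\<^sup>2 \<le> energy \<phi>"
    and \<psi>: "\<And>n. \<psi> n \<in> tests" "\<And>n. norm2 (\<psi> n) = 1" "(\<lambda>n. energy (\<psi> n)) \<longlonglongrightarrow> \<mu>"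
    and Cauchy: "\<And>e. e > 0 \<Longrightarrow> \<exists>N. \<forall>m\<ge>N. \<forall>n\<ge>N. norm2 (\<lambda>x. \<psi> m x - \<psi> n x) < e"
  shows "dirichlet_eigenvalue \<Omega> \<mu>"
proof -
  have en: "energy (\<lambda>x. \<psi> m x - \<psi> n x)
      \<le> 2 * (energy (\<psi> m) - \<mu>) + 2 * (energy (\<psi> n) - \<mu>) + \<mu> * (norm2 (\<lambda>x. \<psi> m x - \<psi> n x))\<^sup>2" for m n
  proof -
    note L = tests_L2[OF \<psi>(1)]
    have "energy (\<lambda>x. \<psi> m x - \<psi> n x) + energy (\<lambda>x. \<psi> m x + \<psi> n x) = 2 * energy (\<psi> m) + 2 * energy (\<psi> n)"
      using energy_lincomb[OF \<psi>(1)[of m] \<psi>(1)[of n], of 1 1] energy_lincomb[OF \<psi>(1)[of m] \<psi>(1)[of n], of 1 "-1"]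
      by simp
    moreover have "\<mu> * (norm2 (\<lambda>x. \<psi> m x - \<psi> n x))\<^sup>2 + \<mu> * (norm2 (\<lambda>x. \<psi> m x + \<psi> n x))\<^sup>2 = \<mu> * 4"
    proof -
      have "(norm2 (\<lambda>x. \<psi> m x - \<psi> n x))\<^sup>2 + (norm2 (\<lambda>x. \<psi> m x + \<psi> n x))\<^sup>2 = 4"
        using norm2_lincomb[OF L[of m] L[of n], of 1 1] norm2_lincomb[OF L[of m] L[of n], of 1 "-1"] \<psi>(2) by simp
      then show ?thesis by (simp only: distrib_left[symmetric])
    qed
    moreover have "\<mu> * (norm2 (\<lambda>x. \<psi> m x + \<psi> n x))\<^sup>2 \<le> energy (\<lambda>x. \<psi> m x + \<psi> n x)"
      by (intro \<mu> test_add \<psi>)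
    moreover have "a \<le> 2 * (p - \<mu>) + 2 * (q - \<mu>) + x"
      if "a + b = 2 * p + 2 * q" "x + y = \<mu> * 4" "y \<le> b" for a b p q x y :: real
      using that by (simp add: algebra_simps)
    ultimately show ?thesis by blast
  qed
  have \<mu>0: "\<mu> \<ge> 0" by (rule tendsto_lowerbound[OF \<psi>(3)]) (auto simp: energy_nonneg)
  have enCauchy: "\<exists>N. \<forall>m\<ge>N. \<forall>n\<ge>N. energy (\<lambda>x. \<psi> m x - \<psi> n x) < e" if e: "e > 0" for e
  proof -
    have "\<forall>\<^sub>F n in sequentially. energy (\<psi> n) < \<mu> + e / 8"
      by (rule order_tendstoD[OF \<psi>(3)]) (use e in simp)
    then obtain N1 where N1: "\<And>n. n \<ge> N1 \<Longrightarrow> energy (\<psi> n) < \<mu> + e / 8"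
      unfolding eventually_sequentially by blast
    \<comment> \<open>Chosen so that \<mu> times the squared distance is at most e/2; the two energy
      excesses, each below e/8 and doubled, make up the other half. Adding 1 to \<mu> covers the
      case \<mu> = 0.\<close>
    obtain N2 where N2: "\<And>m n. m \<ge> N2 \<Longrightarrow> n \<ge> N2 \<Longrightarrow> norm2 (\<lambda>x. \<psi> m x - \<psi> n x) < sqrt (e / 2 / (\<mu> + 1))"
      using Cauchy[of "sqrt (e / 2 / (\<mu> + 1))"] e \<mu>0 by auto
    have "energy (\<lambda>x. \<psi> m x - \<psi> n x) < e" if mn: "m \<ge> max N1 N2" "n \<ge> max N1 N2" for m n
    proof -
      have "(norm2 (\<lambda>x. \<psi> m x - \<psi> n x))\<^sup>2 \<le> (sqrt (e / 2 / (\<mu> + 1)))\<^sup>2"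
        using N2[of m n] mn by (intro power_mono) auto
      also have "\<dots> = e / 2 / (\<mu> + 1)" using e \<mu>0 by simp
      finally have "\<mu> * (norm2 (\<lambda>x. \<psi> m x - \<psi> n x))\<^sup>2 \<le> \<mu> * (e / 2 / (\<mu> + 1))"
        using \<mu>0 by (rule mult_left_mono)
      also have "\<dots> \<le> e / 2" using e \<mu>0 by (simp add: field_simps)
      finally show ?thesis using en[of m n] N1[of m] N1[of n] mn by simp
    qed
    then show ?thesis by blast
  qed
  obtain v where v: "v \<in> L2" "(\<lambda>n. norm2 (\<lambda>x. \<psi> n x - v x)) \<longlonglongrightarrow> 0"
    using L2_complete[OF lmeasurable tests_L2[OF \<psi>(1)] Cauchy] by blast
  have "\<exists>h. h \<in> L2 \<and> (\<lambda>n. norm2 (\<lambda>x. partial b (\<psi> n) x - h x)) \<longlonglongrightarrow> 0" if b: "b \<in> Basis" for b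
  proof -
    have Cb: "\<exists>N. \<forall>m\<ge>N. \<forall>n\<ge>N. norm2 (\<lambda>x. partial b (\<psi> m) x - partial b (\<psi> n) x) < e" if e: "e > 0" for e
    proof -
      obtain N where N: "\<And>m n. m \<ge> N \<Longrightarrow> n \<ge> N \<Longrightarrow> energy (\<lambda>x. \<psi> m x - \<psi> n x) < e\<^sup>2"
        using enCauchy[of "e\<^sup>2"] e by auto
      have "norm2 (\<lambda>x. partial b (\<psi> m) x - partial b (\<psi> n) x) < e" if mn: "m \<ge> N" "n \<ge> N" for m n
      proof -
        have "(norm2 (partial b (\<lambda>x. \<psi> m x - \<psi> n x)))\<^sup>2 \<le> energy (\<lambda>x. \<psi> m x - \<psi> n x)"
          unfolding energy_def using b by (intro member_le_sum) auto
        also have "\<dots> < e\<^sup>2" using mn by (rule N)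
        finally have "norm2 (partial b (\<lambda>x. \<psi> m x - \<psi> n x)) < e"
          by (rule power2_less_imp_less) (use e in simp)
        then show ?thesis by (simp only: partial_diff[OF \<psi>(1) \<psi>(1)])
      qed
      then show ?thesis by blast
    qed
    show ?thesis
      using L2_complete[OF lmeasurable tests_L2[OF test_partial[OF \<psi>(1) b]] Cb] by blast
  qed
  then have "\<exists>h. \<forall>b\<in>Basis. h b \<in> L2 \<and> (\<lambda>n. norm2 (\<lambda>x. partial b (\<psi> n) x - h b x)) \<longlonglongrightarrow> 0"
    by (intro bchoice ballI)
  then obtain h where h': "\<forall>b\<in>Basis. h b \<in> L2 \<and> (\<lambda>n. norm2 (\<lambda>x. partial b (\<psi> n) x - h b x)) \<longlonglongrightarrow> 0" ..
  then have h: "\<And>b. b \<in> Basis \<Longrightarrow> h b \<in> L2"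
    "\<And>b. b \<in> Basis \<Longrightarrow> (\<lambda>n. norm2 (\<lambda>x. partial b (\<psi> n) x - h b x)) \<longlonglongrightarrow> 0"
    by auto
  have lim_v: "(\<lambda>n. \<psi> n \<bullet>\<^sub>2 w) \<longlonglongrightarrow> v \<bullet>\<^sub>2 w" if "w \<in> L2" for w
    by (rule L2_inner_tendsto[OF _ v(1) that v(2)]) (auto simp: tests_L2 \<psi>(1) that)
  have lim_h: "(\<lambda>n. partial b (\<psi> n) \<bullet>\<^sub>2 w) \<longlonglongrightarrow> h b \<bullet>\<^sub>2 w" if "w \<in> L2" "b \<in> Basis" for b w
    by (rule L2_inner_tendsto[OF _ h(1)[OF that(2)] that(1) h(2)[OF that(2)]])
      (auto simp: tests_L2 test_partial \<psi>(1) that)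
  \<comment> \<open>Integration by parts for the approximating test functions passes to the limit,
    which identifies the limits of the gradients as weak derivatives.\<close>
  have wdh: "is_weak_deriv \<Omega> [b] v (h b)" if b: "b \<in> Basis" for b
    unfolding is_weak_deriv_iff
  proof
    fix \<phi> assume \<phi>: "\<phi> \<in> tests"
    have "(\<lambda>n. \<psi> n \<bullet>\<^sub>2 partial b \<phi>) \<longlonglongrightarrow> v \<bullet>\<^sub>2 partial b \<phi>"
      by (rule lim_v) (rule tests_L2[OF test_partial[OF \<phi> b]])
    moreover have "(\<lambda>n. - (partial b (\<psi> n) \<bullet>\<^sub>2 \<phi>)) \<longlonglongrightarrow> - (h b \<bullet>\<^sub>2 \<phi>)"
      by (intro tendsto_minus lim_h tests_L2 \<phi> b)
    moreover have "\<psi> n \<bullet>\<^sub>2 partial b \<phi> = - (partial b (\<psi> n) \<bullet>\<^sub>2 \<phi>)" for n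
      by (intro test_integration_by_parts sets_lebesgue \<psi> \<phi> b)
    ultimately have "v \<bullet>\<^sub>2 partial b \<phi> = - (h b \<bullet>\<^sub>2 \<phi>)"
      using LIMSEQ_unique by simp
    then show "v \<bullet>\<^sub>2 iterated_partial [b] \<phi> = (-1) ^ length [b] * (h b \<bullet>\<^sub>2 \<phi>)" by simp
  qed
  have v1: "v \<in> sobolev_space 1 \<Omega>" by (rule sobolev_space_1I[OF v(1) h(1) wdh])
  note wdv = wd_eq[OF h(1) wdh]
  have vH: "v \<in> H10_space \<Omega>"
  proof (rule H10I[OF v1 \<psi>(1)])
    show "(\<lambda>n. norm2 (\<lambda>x. v x - \<psi> n x)) \<longlonglongrightarrow> 0"
      using v(2) by (simp only: L2_norm_minus_commute[of \<Omega> v])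
    fix b :: 'a assume b: "b \<in> Basis"
    have "norm2 (\<lambda>x. wd [b] v x - partial b (\<psi> n) x) = norm2 (\<lambda>x. h b x - partial b (\<psi> n) x)" for n
    proof (rule L2_norm_cong_AE)
      note p = tests_L2[OF test_partial[OF \<psi>(1) b]]
      show "(\<lambda>x. wd [b] v x - partial b (\<psi> n) x) \<in> L2" "(\<lambda>x. h b x - partial b (\<psi> n) x) \<in> L2"
        by (intro L2_diff p wdv(1) h(1) b)+
      show "AE x in lebesgue_on \<Omega>. wd [b] v x - partial b (\<psi> n) x = h b x - partial b (\<psi> n) x"
        using wdv(2)[OF b b] by eventually_elim simp
    qed
    then show "(\<lambda>n. norm2 (\<lambda>x. wd [b] v x - partial b (\<psi> n) x)) \<longlonglongrightarrow> 0"
      using h(2)[OF b] by (simp only: L2_norm_minus_commute[of \<Omega> "h b"])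
  qed
  \<comment> \<open>Strong convergence in \<open>L2\<close> preserves the normalisation, so the
    eigenfunction is not zero.\<close>
  have norm_v: "norm2 v = 1"
    using L2_norm_tendsto[OF tests_L2[OF \<psi>(1)] v] \<psi>(2) by (simp add: LIMSEQ_const_iff)
  have weak_test: "(\<Sum>b\<in>Basis. h b \<bullet>\<^sub>2 partial b \<phi>) = \<mu> * (v \<bullet>\<^sub>2 \<phi>)" if \<phi>: "\<phi> \<in> tests" for \<phi>
  proof -
    have "(energy_inner (\<psi> n) \<phi> - \<mu> * (\<psi> n \<bullet>\<^sub>2 \<phi>))\<^sup>2 \<le> (energy (\<psi> n) - \<mu>) * (energy \<phi> - \<mu> * (norm2 \<phi>)\<^sup>2)" for n
    proof (rule discriminant_le)
      show "0 \<le> energy \<phi> - \<mu> * (norm2 \<phi>)\<^sup>2" using \<mu>[OF \<phi>] by simp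
      fix t
      have "0 \<le> energy (\<lambda>x. 1 * \<psi> n x + (- t) * \<phi> x) - \<mu> * (norm2 (\<lambda>x. 1 * \<psi> n x + (- t) * \<phi> x))\<^sup>2"
        unfolding diff_ge_0_iff_ge by (intro \<mu> test_lincomb \<psi>(1) \<phi>)
      then show "0 \<le> energy (\<psi> n) - \<mu> - 2 * t * (energy_inner (\<psi> n) \<phi> - \<mu> * (\<psi> n \<bullet>\<^sub>2 \<phi>))
          + t\<^sup>2 * (energy \<phi> - \<mu> * (norm2 \<phi>)\<^sup>2)"
        unfolding energy_lincomb[OF \<psi>(1) \<phi>] norm2_lincomb[OF tests_L2[OF \<psi>(1)] tests_L2[OF \<phi>]]
        using \<psi>(2) by (simp add: algebra_simps)
    qed
    moreover have "(\<lambda>n. (energy (\<psi> n) - \<mu>) * (energy \<phi> - \<mu> * (norm2 \<phi>)\<^sup>2)) \<longlonglongrightarrow> (\<mu> - \<mu>) * (energy \<phi> - \<mu> * (norm2 \<phi>)\<^sup>2)"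
      by (intro tendsto_intros \<psi>(3))
    moreover have "(\<lambda>n. (energy_inner (\<psi> n) \<phi> - \<mu> * (\<psi> n \<bullet>\<^sub>2 \<phi>))\<^sup>2)
        \<longlonglongrightarrow> ((\<Sum>b\<in>Basis. h b \<bullet>\<^sub>2 partial b \<phi>) - \<mu> * (v \<bullet>\<^sub>2 \<phi>))\<^sup>2"
      unfolding energy_inner_def
      by (intro tendsto_intros lim_v lim_h tests_L2 test_partial \<phi>)
    ultimately have "((\<Sum>b\<in>Basis. h b \<bullet>\<^sub>2 partial b \<phi>) - \<mu> * (v \<bullet>\<^sub>2 \<phi>))\<^sup>2 \<le> (\<mu> - \<mu>) * (energy \<phi> - \<mu> * (norm2 \<phi>)\<^sup>2)"
      by (intro LIMSEQ_le) auto
    then show ?thesis by simp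
  qed
  \<comment> \<open>From test functions to all of \<open>H10_space\<close> by density, both sides
    being continuous in w.\<close>
  have weak: "(\<Sum>b\<in>Basis. wd [b] v \<bullet>\<^sub>2 wd [b] w) = \<mu> * (v \<bullet>\<^sub>2 w)" if w: "w \<in> H10_space \<Omega>" for w
  proof -
    have w1: "w \<in> sobolev_space 1 \<Omega>" using w by (rule H10_sobolev)
    obtain \<phi> where \<phi>: "\<And>n. \<phi> n \<in> tests" "(\<lambda>n. norm2 (\<lambda>x. w x - \<phi> n x)) \<longlonglongrightarrow> 0"
      "\<And>b. b \<in> Basis \<Longrightarrow> (\<lambda>n. norm2 (\<lambda>x. wd [b] w x - partial b (\<phi> n) x)) \<longlonglongrightarrow> 0"
      by (rule H10_approx[OF w]) (rule that)
    have "(\<lambda>n. \<Sum>b\<in>Basis. h b \<bullet>\<^sub>2 partial b (\<phi> n)) \<longlonglongrightarrow> (\<Sum>b\<in>Basis. h b \<bullet>\<^sub>2 wd [b] w)"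
    proof (intro tendsto_sum)
      fix b :: 'a assume b: "b \<in> Basis"
      show "(\<lambda>n. h b \<bullet>\<^sub>2 partial b (\<phi> n)) \<longlonglongrightarrow> h b \<bullet>\<^sub>2 wd [b] w"
      proof (rule L2_inner_tendsto[OF _ h(1)[OF b] wd1_L2[OF w1 b]])
        show "(\<lambda>n. norm2 (\<lambda>x. partial b (\<phi> n) x - wd [b] w x)) \<longlonglongrightarrow> 0"
          using \<phi>(3)[OF b] unfolding L2_norm_minus_commute[of \<Omega> "wd [b] w"] .
      qed (auto simp: h(1) b tests_L2 test_partial \<phi>(1))
    qed
    moreover have "(\<lambda>n. \<mu> * (v \<bullet>\<^sub>2 \<phi> n)) \<longlonglongrightarrow> \<mu> * (v \<bullet>\<^sub>2 w)"
    proof (intro tendsto_mult_left, rule L2_inner_tendsto[OF _ v(1) sobolev_L2[OF w1]])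
      show "(\<lambda>n. norm2 (\<lambda>x. \<phi> n x - w x)) \<longlonglongrightarrow> 0"
        using \<phi>(2) unfolding L2_norm_minus_commute[of \<Omega> w] .
    qed (auto simp: v(1) tests_L2 \<phi>(1))
    ultimately have "(\<Sum>b\<in>Basis. h b \<bullet>\<^sub>2 wd [b] w) = \<mu> * (v \<bullet>\<^sub>2 w)"
      unfolding weak_test[OF \<phi>(1)] by (rule LIMSEQ_unique)
    moreover have "wd [b] v \<bullet>\<^sub>2 wd [b] w = h b \<bullet>\<^sub>2 wd [b] w" if b: "b \<in> Basis" for b
      by (rule L2_inner_cong_AE[OF wdv(1)[OF b b] h(1)[OF b] wd1_L2[OF w1 b] wdv(2)[OF b b]])
    ultimately show ?thesis by simp
  qed
  show ?thesis
    unfolding dirichlet_eigenvalue_def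
  proof (intro bexI[OF _ vH] conjI ballI)
    show "\<not> (AE x in lebesgue_on \<Omega>. v x = 0)"
    proof
      assume "AE x in lebesgue_on \<Omega>. v x = 0"
      then have "norm2 v = norm2 (\<lambda>x. 0)"
        by (intro L2_norm_cong_AE v(1) L2_zero)
      with norm_v show False by simp
    qed
    fix w assume w: "w \<in> H10_space \<Omega>"
    show "(\<integral>x. weak_grad \<Omega> v x \<bullet> weak_grad \<Omega> w x \<partial>lebesgue_on \<Omega>) = \<mu> * (\<integral>x. v x * w x \<partial>lebesgue_on \<Omega>)"
      using weak[OF w] weak_grad_inner[OF v1 H10_sobolev[OF w]] by (simp add: L2_inner_def)
  qed
qed

text \<open>With \<mu> the infimum of the energy over normalised test functions, the inequality for
  \<mu> is homogeneity. Rellich compactness makes \<mu> an eigenvalue, and minimality of l then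
  gives l \<le> \<mu>. A test function of nonzero norm is needed for the infimum to range over a
  nonempty set.\<close>

lemma Poincare_test:
  assumes l: "smallest_dirichlet_eigenvalue \<Omega> l" and \<phi>: "\<phi> \<in> tests"
  shows "l * (norm2 \<phi>)\<^sup>2 \<le> energy \<phi>"
proof (cases "norm2 \<phi> = 0")
  case True
  then show ?thesis by (simp add: energy_nonneg)
next
  case False
  define R where "R = {energy \<psi> | \<psi>. \<psi> \<in> tests \<and> norm2 \<psi> = 1}"
  define \<mu> where "\<mu> = Inf R"
  have unit: "energy \<psi> / (norm2 \<psi>)\<^sup>2 \<in> R" if \<psi>: "\<psi> \<in> tests" "norm2 \<psi> \<noteq> 0" for \<psi>
  proof -
    let ?\<psi> = "\<lambda>x. (1 / norm2 \<psi>) * \<psi> x"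
    have "?\<psi> \<in> tests" using \<psi>(1) by (rule test_scale)
    moreover have "norm2 ?\<psi> = 1"
      using \<psi>(2) L2_norm_nonneg[of \<Omega> \<psi>] unfolding L2_norm_scale by simp
    moreover have "energy ?\<psi> = energy \<psi> / (norm2 \<psi>)\<^sup>2"
      unfolding energy_scale[OF \<psi>(1)] by (simp add: power_divide)
    ultimately show ?thesis unfolding R_def by (metis (mono_tags, lifting) mem_Collect_eq)
  qed
  have bdd: "bdd_below R"
    by (rule bdd_belowI[of _ 0]) (auto simp: R_def energy_nonneg)
  have R_ne: "R \<noteq> {}" using unit[OF \<phi> False] by blast
  have \<mu>: "\<mu> * (norm2 \<psi>)\<^sup>2 \<le> energy \<psi>" if \<psi>: "\<psi> \<in> tests" for \<psi>
  proof (cases "norm2 \<psi> = 0")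
    case True
    then show ?thesis by (simp add: energy_nonneg)
  next
    case False
    have "\<mu> \<le> energy \<psi> / (norm2 \<psi>)\<^sup>2"
      unfolding \<mu>_def by (rule cInf_lower[OF unit[OF \<psi> False] bdd])
    with False show ?thesis by (simp add: field_simps)
  qed
  have "\<exists>\<psi>. \<psi> \<in> tests \<and> norm2 \<psi> = 1 \<and> energy \<psi> < \<mu> + 1 / (real n + 1)" for n
  proof -
    have "Inf R < \<mu> + 1 / (real n + 1)" by (simp add: \<mu>_def)
    then obtain y where "y \<in> R" "y < \<mu> + 1 / (real n + 1)"
      using cInf_less_iff[OF R_ne bdd] by blast
    then show ?thesis unfolding R_def by blast
  qed
  then obtain \<psi> where \<psi>: "\<And>n. \<psi> n \<in> tests" "\<And>n. norm2 (\<psi> n) = 1" "\<And>n. energy (\<psi> n) < \<mu> + 1 / (real n + 1)"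
    by metis
  have \<mu>_le: "\<mu> \<le> energy (\<psi> n)" for n using \<mu>[OF \<psi>(1), of n] \<psi>(2) by simp
  have bound: "energy (\<psi> n) \<le> \<mu> + 1" for n
  proof -
    have "1 / (real n + 1) \<le> 1" by simp
    then show ?thesis using \<psi>(3)[of n] by linarith
  qed
  obtain r :: "nat \<Rightarrow> nat" where r: "strict_mono r"
    "\<And>e. e > 0 \<Longrightarrow> \<exists>N. \<forall>m\<ge>N. \<forall>n\<ge>N. norm2 (\<lambda>x. \<psi> (r m) x - \<psi> (r n) x) < e"
    by (rule Rellich[of \<psi> 1 "\<mu> + 1"]) (use \<psi> bound that in auto)
  have "(\<lambda>n. energy (\<psi> n)) \<longlonglongrightarrow> \<mu>"
  proof (rule tendsto_sandwich)
    show "\<forall>\<^sub>F n in sequentially. \<mu> \<le> energy (\<psi> n)" using \<mu>_le by simp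
    show "\<forall>\<^sub>F n in sequentially. energy (\<psi> n) \<le> \<mu> + 1 / (real n + 1)"
      using \<psi>(3) by (intro always_eventually allI less_imp_le)
    show "(\<lambda>n. \<mu> + 1 / (real n + 1)) \<longlonglongrightarrow> \<mu>" by real_asymp
  qed simp
  then have "(\<lambda>n. energy (\<psi> (r n))) \<longlonglongrightarrow> \<mu>"
    using LIMSEQ_subseq_LIMSEQ[OF _ r(1)] by (simp add: o_def)
  then have "dirichlet_eigenvalue \<Omega> \<mu>"
    by (intro minimizer_is_eigenvalue[of \<mu> "\<lambda>n. \<psi> (r n)"] \<mu> \<psi> r(2))
  then have "l \<le> \<mu>" using l by (simp add: smallest_dirichlet_eigenvalue_def)
  then have "l * (norm2 \<phi>)\<^sup>2 \<le> \<mu> * (norm2 \<phi>)\<^sup>2" by (rule mult_right_mono) simp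
  with \<mu>[OF \<phi>] show ?thesis by simp
qed

lemma Poincare:
  assumes l: "smallest_dirichlet_eigenvalue \<Omega> l" and w: "w \<in> H10_space \<Omega>"
  shows "l * (norm2 w)\<^sup>2 \<le> (L2_norm \<Omega> (weak_grad \<Omega> w))\<^sup>2"
proof -
  have w1: "w \<in> sobolev_space 1 \<Omega>" using w by (rule H10_sobolev)
  obtain \<phi> where \<phi>: "\<And>n. \<phi> n \<in> tests" "(\<lambda>n. norm2 (\<lambda>x. w x - \<phi> n x)) \<longlonglongrightarrow> 0"
    "\<And>b. b \<in> Basis \<Longrightarrow> (\<lambda>n. norm2 (\<lambda>x. wd [b] w x - partial b (\<phi> n) x)) \<longlonglongrightarrow> 0"
    by (rule H10_approx[OF w]) (rule that)
  have "(\<lambda>n. norm2 (\<phi> n)) \<longlonglongrightarrow> norm2 w"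
    by (rule L2_norm_tendsto[OF tests_L2[OF \<phi>(1)] sobolev_L2[OF w1]])
      (use \<phi>(2) in \<open>unfold L2_norm_minus_commute[of \<Omega> w]\<close>)
  moreover have "(\<lambda>n. norm2 (partial b (\<phi> n))) \<longlonglongrightarrow> norm2 (wd [b] w)" if b: "b \<in> Basis" for b
    by (rule L2_norm_tendsto[OF tests_L2[OF test_partial[OF \<phi>(1) b]] wd1_L2[OF w1 b]])
      (use \<phi>(3)[OF b] in \<open>unfold L2_norm_minus_commute[of \<Omega> "wd [b] w"]\<close>)
  ultimately have "l * (norm2 w)\<^sup>2 \<le> (\<Sum>b\<in>Basis. (norm2 (wd [b] w))\<^sup>2)"
    using Poincare_test[OF l \<phi>(1)] unfolding energy_def
    by (intro LIMSEQ_le[of "\<lambda>n. l * (norm2 (\<phi> n))\<^sup>2" _ "\<lambda>n. \<Sum>b\<in>Basis. (norm2 (partial b (\<phi> n)))\<^sup>2"]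
        tendsto_intros) auto
  then show ?thesis by (simp only: weak_grad_norm_sq[OF w1])
qed

text \<open>Green's formula with w itself gives E \<le> |w| |\<Delta>w|. Squaring produces |w|^2,
  where Poincare's inequality replaces l |w|^2 by E, and one factor E cancels.\<close>

lemma eigenvalue_laplacian_bound:
  assumes l: "smallest_dirichlet_eigenvalue \<Omega> l" "0 < l" and w: "w \<in> H10_space \<Omega>" "w \<in> sobolev_space 2 \<Omega>"
  shows "l * (L2_norm \<Omega> (weak_grad \<Omega> w))\<^sup>2 \<le> (norm2 (weak_laplacian \<Omega> w))\<^sup>2"
proof -
  let ?E = "(L2_norm \<Omega> (weak_grad \<Omega> w))\<^sup>2"
  have w1: "w \<in> sobolev_space 1 \<Omega>" using w(1) by (rule H10_sobolev)
  have "?E = - (w \<bullet>\<^sub>2 weak_laplacian \<Omega> w)"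
    using Green[OF w] by (simp add: weak_grad_norm_sq[OF w1] L2_norm_sq)
  also have "\<dots> \<le> norm2 w * norm2 (weak_laplacian \<Omega> w)"
    using L2_Cauchy_Schwarz[OF sobolev_L2[OF w1] laplacian_L2[OF w(2)]] by linarith
  finally have "?E\<^sup>2 \<le> (norm2 w * norm2 (weak_laplacian \<Omega> w))\<^sup>2"
    by (intro power_mono) auto
  then have "l * ?E\<^sup>2 \<le> (l * (norm2 w)\<^sup>2) * (norm2 (weak_laplacian \<Omega> w))\<^sup>2"
    using l(2) by (simp add: power_mult_distrib mult.assoc)
  also have "\<dots> \<le> ?E * (norm2 (weak_laplacian \<Omega> w))\<^sup>2"
    by (intro mult_right_mono Poincare[OF l(1) w(1)]) auto
  finally have *: "?E * (l * ?E) \<le> ?E * (norm2 (weak_laplacian \<Omega> w))\<^sup>2"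
    by (simp add: power2_eq_square mult_ac)
  show ?thesis
  proof (cases "?E = 0")
    case False
    then have "?E > 0" by simp
    with * show ?thesis by (simp only: mult_le_cancel_left_pos)
  qed simp
qed

end

section \<open>Functions of time with values in the square integrable functions\<close>

text \<open>Rests on completeness of Lebesgue measure: the limit is determined only almost
  everywhere, and changes on null sets preserve measurability.\<close>

lemma borel_measurable_AE_LIMSEQ:
  fixes f :: "nat \<Rightarrow> real \<Rightarrow> real"
  assumes I: "I \<in> sets lebesgue" and f: "\<And>n. f n \<in> borel_measurable (lebesgue_on I)"
    and lim: "AE t in lebesgue_on I. (\<lambda>n. f n t) \<longlonglongrightarrow> g t"
  shows "g \<in> borel_measurable (lebesgue_on I)"
proof -
  have [measurable]: "(\<lambda>t. if t \<in> I then f n t else 0) \<in> borel_measurable lebesgue" for n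
    using f[of n] borel_measurable_if[OF I] by blast
  have "(\<lambda>t. lim (\<lambda>n. if t \<in> I then f n t else 0)) \<in> borel_measurable lebesgue"
    by measurable
  moreover have "AE t in lebesgue. t \<in> I \<longrightarrow> (\<lambda>n. f n t) \<longlonglongrightarrow> g t"
    using lim I by (simp add: AE_restrict_space_iff)
  then have "AE t in lebesgue. lim (\<lambda>n. if t \<in> I then f n t else 0) = (if t \<in> I then g t else 0)"
    by eventually_elim (auto intro: limI)
  ultimately have "(\<lambda>t. if t \<in> I then g t else 0) \<in> borel_measurable lebesgue"
    by (rule borel_measurable_AE)
  then show ?thesis using borel_measurable_if[OF I] by blast
qed

lemma AE_lebesgue_on_subset:
  assumes "AE t in lebesgue_on S. P t" "S \<in> sets lebesgue" "A \<in> sets lebesgue" "A \<subseteq> S"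
  shows "AE t in lebesgue_on A. P t"
proof -
  have "AE t in lebesgue. t \<in> S \<longrightarrow> P t" using assms by (simp add: AE_restrict_space_iff)
  then have "AE t in lebesgue. t \<in> A \<longrightarrow> P t" by eventually_elim (use assms(4) in auto)
  then show ?thesis using assms by (simp add: AE_restrict_space_iff)
qed

lemma integrable_lebesgue_on_subset:
  fixes f :: "'a::euclidean_space \<Rightarrow> real"
  assumes "integrable (lebesgue_on S) f" "S \<in> sets lebesgue" "A \<in> sets lebesgue" "A \<subseteq> S"
  shows "integrable (lebesgue_on A) f"
proof -
  have "set_integrable lebesgue S f" using assms by (simp add: set_integrable_def integrable_restrict_space)
  from set_integrable_subset[OF this assms(3,4)] have "set_integrable lebesgue A f" .
  then show ?thesis using assms by (simp add: set_integrable_def integrable_restrict_space)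
qed

text \<open>The values of s are functions, a type used here without a measurable structure.
  Splitting over the finitely many values reduces measurability and integrals to \<open>h\<close>
  with a fixed second argument.\<close>

lemma simple_function_split_integral:
  fixes s :: "real \<Rightarrow> 'b" and h :: "real \<Rightarrow> 'b \<Rightarrow> real"
  assumes "simple_function (lebesgue_on I) s" "t \<in> I"
  shows "h t (s t) = (\<Sum>y\<in>s ` I. indicator {r \<in> I. s r = y} t * h t y)"
proof -
  have fin: "finite (s ` I)" using assms by (simp add: simple_function_def)
  have "(\<Sum>y\<in>s ` I. indicator {r \<in> I. s r = y} t * h t y) = (\<Sum>y\<in>s ` I. if y = s t then h t y else 0)"
    using assms(2) by (intro sum.cong) (auto simp: indicator_def)
  also have "\<dots> = h t (s t)" using fin assms(2) by simp
  finally show ?thesis by simp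
qed

lemma simple_function_level_set:
  assumes "simple_function (lebesgue_on I) s" "y \<in> s ` I"
  shows "{r \<in> I. s r = y} \<in> sets (lebesgue_on I)"
proof -
  have "s -` {y} \<inter> space (lebesgue_on I) \<in> sets (lebesgue_on I)"
    using assms by (auto simp: simple_function_def)
  moreover have "s -` {y} \<inter> space (lebesgue_on I) = {r \<in> I. s r = y}" by auto
  ultimately show ?thesis by simp
qed

context bounded_domain
begin

text \<open>Only w is approximated by simple functions; of g weak measurability suffices. With g = w
  it yields measurability of the norm, and later g is a time difference of the solution, which is
  known to be weakly continuous.\<close>

lemma inner2_measurable:
  assumes I: "I \<in> sets lebesgue" and w: "bochner_measurable I L2 norm2 w"
    and g: "\<And>y. y \<in> L2 \<Longrightarrow> (\<lambda>t. y \<bullet>\<^sub>2 g t) \<in> borel_measurable (lebesgue_on I)"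
    and gL: "AE t in lebesgue_on I. g t \<in> L2"
  shows "(\<lambda>t. w t \<bullet>\<^sub>2 g t) \<in> borel_measurable (lebesgue_on I)"
proof -
  obtain s :: "nat \<Rightarrow> real \<Rightarrow> 'a \<Rightarrow> real"
    where s: "\<And>n. simple_function (lebesgue_on I) (s n)" "\<And>n. s n ` I \<subseteq> L2"
      and lim: "AE t in lebesgue_on I. (\<lambda>n. norm2 (\<lambda>x. s n t x - w t x)) \<longlonglongrightarrow> 0"
      and wL: "AE t in lebesgue_on I. w t \<in> L2"
    using w unfolding bochner_measurable_def by blast
  show ?thesis
  proof (rule borel_measurable_AE_LIMSEQ[OF I])
    fix n
    have "(\<lambda>t. \<Sum>y\<in>s n ` I. indicator {r \<in> I. s n r = y} t * (y \<bullet>\<^sub>2 g t)) \<in> borel_measurable (lebesgue_on I)"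
      using s(2)[of n] by (intro borel_measurable_sum borel_measurable_times g borel_measurable_indicator
          simple_function_level_set s(1)) auto
    then show "(\<lambda>t. s n t \<bullet>\<^sub>2 g t) \<in> borel_measurable (lebesgue_on I)"
      by (subst measurable_lebesgue_cong) (rule simple_function_split_integral[OF s(1), where h="\<lambda>t y. y \<bullet>\<^sub>2 g t"])
  next
    have "AE t in lebesgue_on I. t \<in> I" by (rule AE_I2) simp
    with lim wL gL show "AE t in lebesgue_on I. (\<lambda>n. s n t \<bullet>\<^sub>2 g t) \<longlonglongrightarrow> w t \<bullet>\<^sub>2 g t"
    proof eventually_elim
      case (elim t)
      have "s n t \<in> L2" for n using s(2)[of n] elim(4) by blast
      then show ?case
        using elim by (intro L2_inner_tendsto) (auto simp: L2_norm_def)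
    qed
  qed
qed

lemma inner2_const_measurable:
  assumes "I \<in> sets lebesgue" "bochner_measurable I L2 norm2 w" "y \<in> L2"
  shows "(\<lambda>t. y \<bullet>\<^sub>2 w t) \<in> borel_measurable (lebesgue_on I)"
  using inner2_measurable[OF assms(1,2), of "\<lambda>_. y"] assms(3) by (simp add: L2_inner_commute[of _ y])

lemma bochner_measurable_L2: "bochner_measurable I L2 norm2 w \<Longrightarrow> AE t in lebesgue_on I. w t \<in> L2"
  by (simp add: bochner_measurable_def)

lemma norm2_measurable:
  assumes "I \<in> sets lebesgue" "bochner_measurable I L2 norm2 w"
  shows "(\<lambda>t. norm2 (w t)) \<in> borel_measurable (lebesgue_on I)"
proof -
  have "(\<lambda>t. sqrt (w t \<bullet>\<^sub>2 w t)) \<in> borel_measurable (lebesgue_on I)"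
    using inner2_measurable[OF assms inner2_const_measurable[OF assms] bochner_measurable_L2[OF assms(2)]]
    by measurable
  moreover have "sqrt (w t \<bullet>\<^sub>2 w t) = norm2 (w t)" for t
    by (simp add: L2_norm_sq[symmetric])
  ultimately show ?thesis by simp
qed

lemma bochner_measurable_simple_diff:
  assumes w: "bochner_measurable I L2 norm2 w" and s: "simple_function (lebesgue_on I) s" "s ` I \<subseteq> L2"
  shows "bochner_measurable I L2 norm2 (\<lambda>t x. s t x - w t x)"
  unfolding bochner_measurable_def
proof (intro conjI)
  have "AE t in lebesgue_on I. t \<in> I" by (rule AE_I2) simp
  with bochner_measurable_L2[OF w] show "AE t in lebesgue_on I. (\<lambda>x. s t x - w t x) \<in> L2"
    by eventually_elim (use s(2) in \<open>auto intro: L2_diff\<close>)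
  obtain r :: "nat \<Rightarrow> real \<Rightarrow> 'a \<Rightarrow> real"
    where r: "\<And>n. simple_function (lebesgue_on I) (r n)" "\<And>n. r n ` I \<subseteq> L2"
      and lim: "AE t in lebesgue_on I. (\<lambda>n. norm2 (\<lambda>x. r n t x - w t x)) \<longlonglongrightarrow> 0"
    using w unfolding bochner_measurable_def by blast
  have "simple_function (lebesgue_on I) (\<lambda>t x. s t x - r k t x)" for k
    using simple_function_compose2[OF s(1) r(1)[of k], of "\<lambda>v v' x. v x - v' x"] .
  moreover have "(\<lambda>t x. s t x - r k t x) ` I \<subseteq> L2" for k
    using s(2) r(2)[of k] by (auto intro!: L2_diff)
  moreover have "norm2 (\<lambda>x. s t x - r k t x - (s t x - w t x)) = norm2 (\<lambda>x. r k t x - w t x)" for t k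
    by (simp add: L2_norm_def power2_commute)
  ultimately show "\<exists>r. (\<forall>n. simple_function (lebesgue_on I) (r n) \<and> r n ` I \<subseteq> L2) \<and>
      (AE t in lebesgue_on I. (\<lambda>k. norm2 (\<lambda>x. r k t x - (s t x - w t x))) \<longlonglongrightarrow> 0)"
    using lim by (intro exI[of _ "\<lambda>k t x. s t x - r k t x"]) simp
qed

lemma simple_integral_inner2:
  assumes I: "I \<in> lmeasurable" and s: "simple_function (lebesgue_on I) s" "s ` I \<subseteq> L2" and y: "y \<in> L2"
  shows "integrable (lebesgue_on I) (\<lambda>t. s t \<bullet>\<^sub>2 y)"
    "(\<integral>t. s t \<bullet>\<^sub>2 y \<partial>lebesgue_on I) = simple_integral_on I s \<bullet>\<^sub>2 y"
proof -
  interpret finite_measure "lebesgue_on I" by (rule finite_measure_lebesgue_on[OF I])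
  let ?f = "\<lambda>t. \<Sum>v\<in>s ` I. indicator {r \<in> I. s r = v} t * (v \<bullet>\<^sub>2 y)"
  have eq: "s t \<bullet>\<^sub>2 y = ?f t" if "t \<in> space (lebesgue_on I)" for t
    using simple_function_split_integral[OF s(1), where h="\<lambda>t v. v \<bullet>\<^sub>2 y"] that by simp
  have ind: "integrable (lebesgue_on I) (\<lambda>t. indicator {r \<in> I. s r = v} t * (v \<bullet>\<^sub>2 y))" if "v \<in> s ` I" for v
    using simple_function_level_set[OF s(1) that]
    by (intro integrable_mult_left integrable_real_indicator) (auto simp: emeasure_eq_measure)
  show "integrable (lebesgue_on I) (\<lambda>t. s t \<bullet>\<^sub>2 y)"
    by (rule Bochner_Integration.integrable_cong[THEN iffD2, OF refl eq Bochner_Integration.integrable_sum[OF ind]])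
  have "(\<integral>t. s t \<bullet>\<^sub>2 y \<partial>lebesgue_on I) = (\<integral>t. ?f t \<partial>lebesgue_on I)"
    by (rule Bochner_Integration.integral_cong[OF refl eq])
  also have "\<dots> = (\<Sum>v\<in>s ` I. (\<integral>t. indicator {r \<in> I. s r = v} t * (v \<bullet>\<^sub>2 y) \<partial>lebesgue_on I))"
    using ind by (rule Bochner_Integration.integral_sum)
  also have "\<dots> = (\<Sum>v\<in>s ` I. measure (lebesgue_on I) {t \<in> I. s t = v} * (v \<bullet>\<^sub>2 y))"
  proof (intro sum.cong refl)
    fix v
    have "{r \<in> I. s r = v} \<inter> I = {r \<in> I. s r = v}" by auto
    then show "(\<integral>t. indicator {r \<in> I. s r = v} t * (v \<bullet>\<^sub>2 y) \<partial>lebesgue_on I)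
        = measure (lebesgue_on I) {t \<in> I. s t = v} * (v \<bullet>\<^sub>2 y)" by simp
  qed
  also have "\<dots> = (\<Sum>v\<in>s ` I. (\<lambda>x. measure (lebesgue_on I) {t \<in> I. s t = v} * v x) \<bullet>\<^sub>2 y)"
    by simp
  also have "\<dots> = simple_integral_on I s \<bullet>\<^sub>2 y"
    unfolding simple_integral_on_def[abs_def]
    using s(2) by (intro L2_inner_sum_left[symmetric] L2_scale y) auto
  finally show "(\<integral>t. s t \<bullet>\<^sub>2 y \<partial>lebesgue_on I) = simple_integral_on I s \<bullet>\<^sub>2 y" .
qed

lemma simple_integral_L2: "s ` I \<subseteq> L2 \<Longrightarrow> simple_integral_on I s \<in> L2"
  unfolding simple_integral_on_def[abs_def] by (intro L2_sum L2_scale) auto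

text \<open>Pairing with y is a bounded functional, so it commutes with the limit of simple
  functions that defines the integral. This turns the weak time derivative into scalar identities,
  one for each y.\<close>

lemma bochner_integral_inner2:
  assumes I: "I \<in> lmeasurable" and w: "has_bochner_integral_on I L2 norm2 w z" and y: "y \<in> L2"
    and int: "integrable (lebesgue_on I) (\<lambda>t. w t \<bullet>\<^sub>2 y)"
  shows "(\<integral>t. w t \<bullet>\<^sub>2 y \<partial>lebesgue_on I) = z \<bullet>\<^sub>2 y"
proof -
  have I': "I \<in> sets lebesgue" using I by auto
  obtain s :: "nat \<Rightarrow> real \<Rightarrow> 'a \<Rightarrow> real"
    where s: "\<And>n. simple_function (lebesgue_on I) (s n)" "\<And>n. s n ` I \<subseteq> L2"
      and lim1: "(\<lambda>n. \<integral>\<^sup>+t. ennreal (norm2 (\<lambda>x. s n t x - w t x)) \<partial>lebesgue_on I) \<longlonglongrightarrow> 0"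
      and lim2: "(\<lambda>n. norm2 (\<lambda>x. simple_integral_on I (s n) x - z x)) \<longlonglongrightarrow> 0"
      and z: "z \<in> L2" and wb: "bochner_measurable I L2 norm2 w"
    using w unfolding has_bochner_integral_on_def by blast
  have wL: "AE t in lebesgue_on I. w t \<in> L2" by (rule bochner_measurable_L2[OF wb])
  have "(\<lambda>n. simple_integral_on I (s n) \<bullet>\<^sub>2 y) \<longlonglongrightarrow> z \<bullet>\<^sub>2 y"
    by (rule L2_inner_tendsto[OF _ z y lim2]) (auto simp: simple_integral_L2 s(2) y)
  then have l1: "(\<lambda>n. \<integral>t. s n t \<bullet>\<^sub>2 y \<partial>lebesgue_on I) \<longlonglongrightarrow> z \<bullet>\<^sub>2 y"
    by (simp add: simple_integral_inner2[OF I s y])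
  have bound: "ennreal \<bar>(\<integral>t. s n t \<bullet>\<^sub>2 y \<partial>lebesgue_on I) - (\<integral>t. w t \<bullet>\<^sub>2 y \<partial>lebesgue_on I)\<bar>
      \<le> ennreal (norm2 y) * (\<integral>\<^sup>+t. ennreal (norm2 (\<lambda>x. s n t x - w t x)) \<partial>lebesgue_on I)" for n
  proof -
    note si = simple_integral_inner2(1)[OF I s y, of n]
    note sb = bochner_measurable_simple_diff[OF wb s(1)[of n] s(2)[of n]]
    have "\<bar>(\<integral>t. s n t \<bullet>\<^sub>2 y \<partial>lebesgue_on I) - (\<integral>t. w t \<bullet>\<^sub>2 y \<partial>lebesgue_on I)\<bar>
        = norm (\<integral>t. s n t \<bullet>\<^sub>2 y - w t \<bullet>\<^sub>2 y \<partial>lebesgue_on I)"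
      using si int by simp
    then have "ennreal \<bar>(\<integral>t. s n t \<bullet>\<^sub>2 y \<partial>lebesgue_on I) - (\<integral>t. w t \<bullet>\<^sub>2 y \<partial>lebesgue_on I)\<bar>
        \<le> (\<integral>\<^sup>+t. ennreal (norm (s n t \<bullet>\<^sub>2 y - w t \<bullet>\<^sub>2 y)) \<partial>lebesgue_on I)"
      using integral_norm_bound_ennreal[OF Bochner_Integration.integrable_diff[OF si int]] by simp
    also have "\<dots> \<le> (\<integral>\<^sup>+t. ennreal (norm2 y) * ennreal (norm2 (\<lambda>x. s n t x - w t x)) \<partial>lebesgue_on I)"
    proof (rule nn_integral_mono_AE)
      have "AE t in lebesgue_on I. t \<in> I" by (rule AE_I2) simp
      with wL show "AE t in lebesgue_on I. ennreal (norm (s n t \<bullet>\<^sub>2 y - w t \<bullet>\<^sub>2 y))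
          \<le> ennreal (norm2 y) * ennreal (norm2 (\<lambda>x. s n t x - w t x))"
      proof eventually_elim
        case (elim t)
        then have st: "s n t \<in> L2" using s(2)[of n] by blast
        have "norm (s n t \<bullet>\<^sub>2 y - w t \<bullet>\<^sub>2 y) = \<bar>(\<lambda>x. s n t x - w t x) \<bullet>\<^sub>2 y\<bar>"
          using st elim(1) y by (simp add: L2_inner_diff_left)
        also have "\<dots> \<le> norm2 y * norm2 (\<lambda>x. s n t x - w t x)"
          using L2_Cauchy_Schwarz[OF L2_diff[OF st elim(1)] y] by (simp add: mult.commute)
        finally show ?case
          by (simp add: ennreal_mult[symmetric] ennreal_leI)
      qed
    qed
    also have "\<dots> = ennreal (norm2 y) * (\<integral>\<^sup>+t. ennreal (norm2 (\<lambda>x. s n t x - w t x)) \<partial>lebesgue_on I)"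
      using norm2_measurable[OF I' sb] by (intro nn_integral_cmult) measurable
    finally show ?thesis .
  qed
  let ?d = "\<lambda>n. \<bar>(\<integral>t. s n t \<bullet>\<^sub>2 y \<partial>lebesgue_on I) - (\<integral>t. w t \<bullet>\<^sub>2 y \<partial>lebesgue_on I)\<bar>"
  have lim3: "(\<lambda>n. ennreal (norm2 y) * (\<integral>\<^sup>+t. ennreal (norm2 (\<lambda>x. s n t x - w t x)) \<partial>lebesgue_on I)) \<longlonglongrightarrow> ennreal (norm2 y) * 0"
    using lim1 by (intro ennreal_tendsto_cmult) auto
  have "(\<lambda>n. ennreal (?d n)) \<longlonglongrightarrow> 0"
  proof (rule tendsto_sandwich[OF _ _ _ lim3[unfolded mult_zero_right]])
    show "\<forall>\<^sub>F n in sequentially. 0 \<le> ennreal (?d n)" by simp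
    show "\<forall>\<^sub>F n in sequentially. ennreal (?d n)
        \<le> ennreal (norm2 y) * (\<integral>\<^sup>+t. ennreal (norm2 (\<lambda>x. s n t x - w t x)) \<partial>lebesgue_on I)"
      by (intro always_eventually allI bound)
  qed (rule tendsto_const)
  then have "(\<lambda>n. ennreal (?d n)) \<longlonglongrightarrow> ennreal 0" by simp
  then have "?d \<longlonglongrightarrow> 0"
    by (rule tendsto_ennreal_iff[THEN iffD1, rotated 2]) auto
  then have "(\<lambda>n. (\<integral>t. s n t \<bullet>\<^sub>2 y \<partial>lebesgue_on I) - (\<integral>t. w t \<bullet>\<^sub>2 y \<partial>lebesgue_on I)) \<longlonglongrightarrow> 0"
    by (rule tendsto_rabs_zero_cancel)
  then have "(\<lambda>n. \<integral>t. s n t \<bullet>\<^sub>2 y \<partial>lebesgue_on I) \<longlonglongrightarrow> (\<integral>t. w t \<bullet>\<^sub>2 y \<partial>lebesgue_on I)"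
    by (simp add: LIM_zero_iff)
  with l1 show ?thesis using LIMSEQ_unique by blast
qed

end

section \<open>Smooth steps in time\<close>

text \<open>P is the normalised antiderivative of exp(-1/x) exp(-1/(1 - x)) on (0, 1).\<close>

lemma smooth_step_exists:
  obtains P \<rho> :: "real \<Rightarrow> real"
  where "bump_algebra \<rho>" "\<And>x. (P has_real_derivative \<rho> x) (at x)" "\<And>x. 0 \<le> \<rho> x"
    "\<And>x. x \<le> 0 \<Longrightarrow> P x = 0" "\<And>x. 1 \<le> x \<Longrightarrow> P x = 1" "\<And>x. 0 \<le> P x" "\<And>x. P x \<le> 1"
    "\<And>x. x \<le> 0 \<or> 1 \<le> x \<Longrightarrow> \<rho> x = 0"
proof -
  \<comment> \<open>The constant polynomial \<open>[:c:]\<close> carries the scalar, so the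
    normalised bump is again a member of \<open>bump_algebra\<close>.\<close>
  define \<sigma> where "\<sigma> c x = flat_exp [:c:] (1 * x + 0) * flat_exp 1 ((-1) * x + 1)" for c x :: real
  have \<sigma>_alg: "bump_algebra (\<sigma> c)" for c
    unfolding \<sigma>_def by (intro bump_algebra.intros)
  have \<sigma>_scale: "\<sigma> c x = c * \<sigma> 1 x" for c x
    by (simp add: \<sigma>_def flat_exp_def)
  have \<sigma>0: "\<sigma> 1 x \<ge> 0" for x by (simp add: \<sigma>_def flat_exp_def)
  have \<sigma>_out: "\<sigma> 1 x = 0" if "x \<le> 0 \<or> 1 \<le> x" for x using that by (auto simp: \<sigma>_def flat_exp_def)
  have \<sigma>_pos: "\<sigma> 1 x > 0" if "0 < x" "x < 1" for x using that by (auto simp: \<sigma>_def flat_exp_def)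
  have cont: "isCont (\<sigma> 1) x" for x
    using bump_algebra_deriv[OF \<sigma>_alg[of 1]] DERIV_isCont by blast
  obtain Q where Q': "\<And>x. (Q has_vector_derivative \<sigma> 1 x) (at x)"
    using einterval_antiderivative[of "-\<infinity>" \<infinity> "\<sigma> 1"] cont by auto
  then have Q: "(Q has_real_derivative \<sigma> 1 x) (at x)" for x
    by (simp add: has_real_derivative_iff_has_vector_derivative)
  have mono: "Q x \<le> Q y" if "x \<le> y" for x y
    using DERIV_nonneg_imp_nondecreasing[OF that, of Q] Q \<sigma>0 by blast
  have Q_left: "Q x = Q 0" if "x \<le> 0" for x
  proof (cases "x < 0")
    case True
    then obtain z where z: "x < z" "z < 0" "Q 0 - Q x = (0 - x) * \<sigma> 1 z"
      using MVT2[of x 0 Q "\<sigma> 1"] Q by blast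
    then show ?thesis using \<sigma>_out[of z] by simp
  qed (use that in simp)
  have Q_right: "Q x = Q 1" if "x \<ge> 1" for x
  proof (cases "x > 1")
    case True
    then obtain z where z: "1 < z" "z < x" "Q x - Q 1 = (x - 1) * \<sigma> 1 z"
      using MVT2[of 1 x Q "\<sigma> 1"] Q by blast
    then show ?thesis using \<sigma>_out[of z] by simp
  qed (use that in simp)
  define k where "k = Q 1 - Q 0"
  obtain z where z: "0 < z" "z < 1" "Q 1 - Q 0 = (1 - 0) * \<sigma> 1 z"
    using MVT2[of 0 1 Q "\<sigma> 1"] Q by auto
  have k: "k > 0" unfolding k_def using z \<sigma>_pos by simp
  show thesis
  proof (rule that[of "\<sigma> (1 / k)" "\<lambda>x. (Q x - Q 0) / k"])
    show "((\<lambda>x. (Q x - Q 0) / k) has_real_derivative \<sigma> (1 / k) x) (at x)" for x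
      unfolding \<sigma>_scale[of "1 / k"] using k by (auto intro!: derivative_eq_intros Q)
    show "0 \<le> \<sigma> (1 / k) x" for x unfolding \<sigma>_scale[of "1 / k"] using k \<sigma>0 by simp
    show "(Q x - Q 0) / k = 0" if "x \<le> 0" for x using Q_left[OF that] by simp
    show "(Q x - Q 0) / k = 1" if "1 \<le> x" for x using Q_right[OF that] k by (simp add: k_def)
    show "0 \<le> (Q x - Q 0) / k" for x
      using mono[of 0 x] Q_left[of x] k by (cases "x \<le> 0") auto
    show "(Q x - Q 0) / k \<le> 1" for x
      using mono[of x 1] Q_right[of x] k unfolding k_def by (cases "x \<le> 1") (auto simp: field_simps)
    show "\<sigma> (1 / k) x = 0" if "x \<le> 0 \<or> 1 \<le> x" for x unfolding \<sigma>_scale[of "1 / k"] using \<sigma>_out[OF that] by simp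
  qed (rule \<sigma>_alg)
qed

lemma bump_algebra_affine:
  assumes "bump_algebra f"
  shows "bump_algebra (\<lambda>x. f (m * x + e))"
  using assms
proof induction
  case (base p c d)
  have "(\<lambda>x. flat_exp p (c * (m * x + e) + d)) = (\<lambda>x. flat_exp p ((c * m) * x + (c * e + d)))"
    by (simp add: algebra_simps)
  then show ?case using bump_algebra.base by metis
qed (auto intro: bump_algebra.intros)

lemma bump_algebra_scale:
  assumes "bump_algebra f"
  shows "bump_algebra (\<lambda>x. k * f x)"
  using assms
proof induction
  case (base p c d)
  have "(\<lambda>x. k * flat_exp p (c * x + d)) = (\<lambda>x. flat_exp (smult k p) (c * x + d))"
    by (auto simp: flat_exp_def)
  then show ?case using bump_algebra.base by metis
next
  case (add f g)
  then show ?case using bump_algebra.add[of "\<lambda>x. k * f x" "\<lambda>x. k * g x"] by (simp add: distrib_left)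
next
  case (mult f g)
  then show ?case using bump_algebra.mult[of "\<lambda>x. k * f x" g] by (simp add: mult.assoc)
qed

text \<open>The step P is characterised through its derivative. The antiderivatives of members of
  \<open>bump_algebra\<close> form a class closed under differentiation, because every member has
  its derivative in the algebra.\<close>

lemma smooth_fun_real_antiderivative:
  fixes F f :: "real \<Rightarrow> real"
  assumes "bump_algebra f" "\<And>x. (F has_real_derivative f x) (at x)"
  shows "smooth_fun F"
proof (rule smooth_fun_class)
  let ?S = "{F. \<exists>f. bump_algebra f \<and> (\<forall>x. (F has_real_derivative f x) (at x))}"
  show "F \<in> ?S" using assms by blast
  fix G :: "real \<Rightarrow> real" and x assume "G \<in> ?S"
  then obtain g where g: "bump_algebra g" "\<And>x. (G has_real_derivative g x) (at x)" by blast
  show "G differentiable (at x)" using g(2) real_differentiable_def by blast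
  fix b :: real assume "b \<in> Basis"
  then have b: "b = 1" by simp
  have "frechet_derivative G (at x) b = g x" for x
    using frechet_derivative_at[OF g(2)[of x, unfolded has_field_derivative_def]] b by (metis mult.right_neutral)
  then show "(\<lambda>x. frechet_derivative G (at x) b) \<in> ?S"
    using bump_algebra_deriv[OF g(1)] by simp
qed

text \<open>The functions n \<rho>(n (t - a)) are an approximate identity: nonnegative, concentrated
  on [a, a + 1/n], and of mass 1 by the fundamental theorem for P.\<close>

lemma smooth_step_delta:
  fixes P \<rho> U :: "real \<Rightarrow> real"
  assumes P: "\<And>x. (P has_real_derivative \<rho> x) (at x)" "\<And>x. 0 \<le> \<rho> x"
    "\<And>x. x \<le> 0 \<Longrightarrow> P x = 0" "\<And>x. 1 \<le> x \<Longrightarrow> P x = 1" "\<And>x. x \<le> 0 \<or> 1 \<le> x \<Longrightarrow> \<rho> x = 0"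
    and \<rho>: "continuous_on UNIV \<rho>"
    and U: "continuous_on {0..T} U" and a: "0 < a" "a < T"
  shows "(\<lambda>n. integral {0..T} (\<lambda>t. real n * \<rho> (real n * (t - a)) * U t)) \<longlonglongrightarrow> U a"
proof (rule LIMSEQ_I)
  fix e :: real assume e: "e > 0"
  have "a \<in> {0..T}" using a by simp
  then obtain d where d: "d > 0" "\<And>t. t \<in> {0..T} \<Longrightarrow> dist t a < d \<Longrightarrow> dist (U t) (U a) < e / 2"
    using U e unfolding continuous_on_iff by (meson half_gt_zero)
  \<comment> \<open>The first bound puts the whole mass inside [0, T], the second puts it where U is
    within e/2 of U a.\<close>
  obtain N :: nat where N: "real N > 1 / (T - a)" "real N > 1 / d"
    by (metis reals_Archimedean2 max_less_iff_conj)
  have N0: "real N > 0" using N(2) d(1) by (meson divide_pos_pos less_trans zero_less_one)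
  have "norm (integral {0..T} (\<lambda>t. real n * \<rho> (real n * (t - a)) * U t) - U a) < e" if n: "n \<ge> N" for n
  proof -
    define D where "D t = real n * \<rho> (real n * (t - a))" for t
    have nN: "real n \<ge> real N" using n by simp
    have n0: "real n > 0" using nN N0 by linarith
    have D0: "0 \<le> D t" for t using P(2) by (simp add: D_def)
    have Dc: "continuous_on S D" for S
      unfolding D_def using \<rho> by (intro continuous_intros continuous_on_compose2[OF \<rho>]) auto
    have "(D has_integral (P (real n * (T - a)) - P (real n * (0 - a)))) {0..T}"
    proof (rule fundamental_theorem_of_calculus)
      fix t
      have "((\<lambda>t. real n * (t - a)) has_real_derivative real n) (at t)"
        by (auto intro!: derivative_eq_intros)
      from DERIV_chain'[OF this P(1)]
      have "((\<lambda>t. P (real n * (t - a))) has_real_derivative D t) (at t)"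
        by (simp add: D_def mult.commute)
      then show "((\<lambda>t. P (real n * (t - a))) has_vector_derivative D t) (at t within {0..T})"
        by (simp add: has_real_derivative_iff_has_vector_derivative has_vector_derivative_at_within)
    qed (use a in simp)
    moreover have "real n * (T - a) \<ge> 1"
    proof -
      have "1 < real N * (T - a)" using N(1) a by (simp add: field_simps)
      also have "\<dots> \<le> real n * (T - a)" using nN a by (intro mult_right_mono) auto
      finally show ?thesis by simp
    qed
    ultimately have D1: "(D has_integral 1) {0..T}"
      using P(3)[of "real n * (0 - a)"] P(4)[of "real n * (T - a)"] a n0 by (simp add: mult_nonneg_nonpos)
    have i1: "(\<lambda>t. D t * U t) integrable_on {0..T}" "(\<lambda>t. D t * (U t - U a)) integrable_on {0..T}"
      "(\<lambda>t. D t * U a) integrable_on {0..T}"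
      by (intro integrable_continuous_real continuous_intros Dc U)+
    have "integral {0..T} (\<lambda>t. D t * U t) - U a = integral {0..T} (\<lambda>t. D t * U t) - integral {0..T} (\<lambda>t. D t * U a)"
      using D1 by (simp add: integral_unique)
    also have "\<dots> = integral {0..T} (\<lambda>t. D t * (U t - U a))"
      unfolding right_diff_distrib
      by (rule Henstock_Kurzweil_Integration.integral_diff[symmetric, OF i1(1) i1(3)])
    also have "norm \<dots> \<le> integral {0..T} (\<lambda>t. D t * (e / 2))"
    proof (rule Henstock_Kurzweil_Integration.integral_norm_bound_integral[OF i1(2)])
      show "(\<lambda>t. D t * (e / 2)) integrable_on {0..T}"
        by (intro integrable_continuous_real continuous_intros Dc)
      fix t assume t: "t \<in> {0..T}"
      show "norm (D t * (U t - U a)) \<le> D t * (e / 2)"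
      proof (cases "t \<le> a \<or> a + 1 / real n \<le> t")
        case True
        then have "real n * (t - a) \<le> 0 \<or> 1 \<le> real n * (t - a)"
          using n0 by (auto simp: field_simps mult_nonneg_nonpos)
        then have "D t = 0" using P(5) by (auto simp: D_def)
        then show ?thesis by simp
      next
        case False
        moreover have "1 / real n < d"
        proof -
          have "1 / real n \<le> 1 / real N" using nN N0 by (intro divide_left_mono) auto
          also have "\<dots> < d" using N(2) d(1) N0 by (simp add: field_simps)
          finally show ?thesis .
        qed
        ultimately have "dist t a < d" by (simp add: dist_real_def)
        from d(2)[OF t this] have "\<bar>U t - U a\<bar> \<le> e / 2" by (simp add: dist_real_def)
        from mult_left_mono[OF this D0[of t]] show ?thesis
          using D0[of t] by (simp add: abs_mult)
      qed
    qed
    also have "\<dots> = e / 2" using D1 by (simp add: integral_unique)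
    finally show ?thesis using e unfolding D_def by simp
  qed
  then show "\<exists>N. \<forall>n\<ge>N. norm (integral {0..T} (\<lambda>t. real n * \<rho> (real n * (t - a)) * U t) - U a) < e" by blast
qed

lemma AE_lebesgue_on_neq: "S \<in> sets lebesgue \<Longrightarrow> AE t in lebesgue_on S. t \<noteq> (a::real)"
proof -
  assume S: "S \<in> sets lebesgue"
  have "AE t in lebesgue. t \<noteq> a" by (rule AE_completion) (rule AE_lborel_singleton)
  then have "AE t in lebesgue. t \<in> S \<longrightarrow> t \<noteq> a" by eventually_elim simp
  then show ?thesis using S by (simp add: AE_restrict_space_iff)
qed

context bounded_domain
begin

text \<open>The fundamental theorem of calculus for the pairing with a fixed y. The test functions
  are smooth steps up at a and down at b: their derivatives are approximate deltas at the two ends,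
  and they themselves tend boundedly to an indicator.\<close>

lemma inner2_weak_time_deriv:
  assumes T: "0 < T" and wt: "is_weak_time_deriv \<Omega> T u ut"
    and ut: "ut \<in> bochner_L2 {0<..<T} L2 norm2"
    and y: "y \<in> L2" and U: "continuous_on {0..T} (\<lambda>t. u t \<bullet>\<^sub>2 y)"
    and ab: "0 < a" "a \<le> b" "b < T"
  shows "integrable (lebesgue_on {0<..<T}) (\<lambda>r. ut r \<bullet>\<^sub>2 y)"
    and "u b \<bullet>\<^sub>2 y - u a \<bullet>\<^sub>2 y = (\<integral>r. ut r \<bullet>\<^sub>2 y \<partial>lebesgue_on {a..b})"
proof -
  let ?I = "{0<..<T}"
  have I: "?I \<in> sets lebesgue" "?I \<in> lmeasurable" by auto
  interpret finite_measure "lebesgue_on ?I" by (rule finite_measure_lebesgue_on[OF I(2)])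
  have ub: "bochner_measurable ?I L2 norm2 ut" and ui: "integrable (lebesgue_on ?I) (\<lambda>t. (norm2 (ut t))\<^sup>2)"
    using ut by (auto simp: bochner_L2_def)
  define V where "V r = ut r \<bullet>\<^sub>2 y" for r
  have Vm: "V \<in> borel_measurable (lebesgue_on ?I)"
    using inner2_const_measurable[OF I(1) ub y] unfolding V_def by (simp add: L2_inner_commute[of _ y])
  have Vi: "integrable (lebesgue_on ?I) V"
  proof (rule Bochner_Integration.integrable_bound)
    show "integrable (lebesgue_on ?I) (\<lambda>t. (norm2 (ut t))\<^sup>2 + (norm2 y)\<^sup>2)"
      using ui by (intro Bochner_Integration.integrable_add) auto
    show "AE t in lebesgue_on ?I. norm (V t) \<le> norm ((norm2 (ut t))\<^sup>2 + (norm2 y)\<^sup>2)"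
      using bochner_measurable_L2[OF ub]
    proof eventually_elim
      case (elim t)
      have "\<bar>V t\<bar> \<le> norm2 (ut t) * norm2 y" unfolding V_def by (rule L2_Cauchy_Schwarz[OF elim y])
      moreover have "2 * (norm2 (ut t) * norm2 y) \<le> (norm2 (ut t))\<^sup>2 + (norm2 y)\<^sup>2"
        using sum_squares_bound[of "norm2 (ut t)" "norm2 y"] by simp
      moreover have "0 \<le> norm2 (ut t) * norm2 y" by simp
      ultimately have "\<bar>V t\<bar> \<le> (norm2 (ut t))\<^sup>2 + (norm2 y)\<^sup>2" by linarith
      then show ?case by simp
    qed
  qed (rule Vm)
  then show "integrable (lebesgue_on ?I) (\<lambda>r. ut r \<bullet>\<^sub>2 y)" by (simp add: V_def[abs_def])
  obtain P \<rho> where \<rho>A: "bump_algebra \<rho>" and P': "\<And>x. (P has_real_derivative \<rho> x) (at x)" "\<And>x. 0 \<le> \<rho> x"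
    "\<And>x. x \<le> 0 \<Longrightarrow> P x = 0" "\<And>x. 1 \<le> x \<Longrightarrow> P x = 1" 
    and P01: "\<And>x. 0 \<le> P x" "\<And>x. P x \<le> 1"
    and \<rho>0: "\<And>x. x \<le> 0 \<or> 1 \<le> x \<Longrightarrow> \<rho> x = 0"
    by (rule smooth_step_exists) (rule that)
  note P = P' \<rho>0
  obtain \<rho>' where "\<forall>x. (\<rho> has_real_derivative \<rho>' x) (at x)"
    using bump_algebra_deriv[OF \<rho>A] by blast
  then have \<rho>c: "continuous_on UNIV \<rho>"
    by (intro continuous_at_imp_continuous_on ballI DERIV_isCont) (rule spec)
  define U' where "U' t = u t \<bullet>\<^sub>2 y" for t
  have Uc: "continuous_on {0..T} U'" using U by (simp add: U'_def)
  define \<eta> where "\<eta> n t = P (real n * (t - a)) - P (real n * (t - b))" for n :: nat and t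
  define \<eta>' where "\<eta>' n t = real n * \<rho> (real n * (t - a)) - real n * \<rho> (real n * (t - b))" for n :: nat and t
  have \<eta>D: "(\<eta> n has_real_derivative \<eta>' n t) (at t)" for n t
  proof -
    have "((\<lambda>t. P (real n * (t - c))) has_real_derivative \<rho> (real n * (t - c)) * real n) (at t)" for c
    proof -
      have "((\<lambda>t. real n * (t - c)) has_real_derivative real n) (at t)"
        by (auto intro!: derivative_eq_intros)
      from DERIV_chain'[OF this P(1)] show ?thesis .
    qed
    from DERIV_diff[OF this[of a] this[of b]] show ?thesis
      unfolding \<eta>_def \<eta>'_def by (simp add: mult.commute)
  qed
  have \<eta>'A: "bump_algebra (\<eta>' n)" for n
  proof -
    have "\<eta>' n = (\<lambda>t. real n * \<rho> (real n * t + (- real n * a)) + (- real n) * \<rho> (real n * t + (- real n * b)))"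
      unfolding \<eta>'_def by (auto simp: right_diff_distrib)
    moreover have "bump_algebra \<dots>"
      by (intro bump_algebra.add bump_algebra_scale bump_algebra_affine \<rho>A)
    ultimately show ?thesis by (simp only:)
  qed
  \<comment> \<open>The step down occupies [b, b + 1/n], which has to end before T for the function
    to be admissible.\<close>
  obtain N :: nat where "real N > 1 / (T - b)" using reals_Archimedean2 by blast
  then have N: "real N * (T - b) > 1" using ab by (simp add: field_simps)
  have N0: "real N > 0" using N ab by (cases "N = 0") auto
  have test: "\<eta> n \<in> test_functions ?I" if n: "n \<ge> N" for n
  proof -
    have nN: "real n \<ge> real N" using n by simp
    have n0: "real n > 0" using nN N0 by linarith
    have out: "\<eta> n t = 0" if "t \<notin> {a..b + 1 / real n}" for t
    proof (cases "t < a")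
      case True
      then have "real n * (t - a) \<le> 0" "real n * (t - b) \<le> 0"
        using n0 ab by (auto simp: mult_nonneg_nonpos)
      then show ?thesis by (simp add: \<eta>_def P(3))
    next
      case False
      with that have "t > b + 1 / real n" by auto
      then have "real n * (t - b) \<ge> 1" using n0 by (simp add: field_simps)
      moreover have "real n * (t - a) \<ge> real n * (t - b)" using n0 ab by simp
      ultimately have "real n * (t - b) \<ge> 1" "real n * (t - a) \<ge> 1" by linarith+
      then show ?thesis by (simp add: \<eta>_def P(4))
    qed
    have sub: "closure {t. \<eta> n t \<noteq> 0} \<subseteq> {a..b + 1 / real n}"
    proof (rule closure_minimal)
      show "{t. \<eta> n t \<noteq> 0} \<subseteq> {a..b + 1 / real n}" using out by blast
    qed simp
    have "1 / real n < T - b"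
    proof -
      have "real N * (T - b) \<le> real n * (T - b)" using nN ab by (intro mult_right_mono) auto
      then show ?thesis using N n0 by (simp add: field_simps)
    qed
    then have sub2: "{a..b + 1 / real n} \<subseteq> ?I" using ab by auto
    have "compact (closure {t. \<eta> n t \<noteq> 0})"
      using bounded_subset[OF _ sub] by (simp add: compact_eq_bounded_closed)
    moreover have "smooth_fun (\<eta> n)" by (rule smooth_fun_real_antiderivative[OF \<eta>'A \<eta>D])
    ultimately show ?thesis using sub sub2 by (auto simp: test_functions_def)
  qed
  have \<eta>'c: "continuous_on S (\<eta>' n)" for n S
    unfolding \<eta>'_def by (intro continuous_intros continuous_on_compose2[OF \<rho>c]) auto
  have \<eta>c: "continuous_on S (\<eta> n)" for n S
    by (intro continuous_at_imp_continuous_on ballI DERIV_isCont[OF \<eta>D])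
  have \<eta>bound: "\<bar>\<eta> n t\<bar> \<le> 1" for n t
    using P01[of "real n * (t - a)"] P01[of "real n * (t - b)"] unfolding \<eta>_def by linarith
  have \<eta>m: "\<eta> n \<in> borel_measurable (lebesgue_on ?I)" for n
    by (rule continuous_imp_measurable_on_sets_lebesgue[OF \<eta>c I(1)])
  have weak: "integral {0..T} (\<lambda>t. \<eta>' n t * U' t) = - (\<integral>t. \<eta> n t * V t \<partial>lebesgue_on ?I)" if n: "n \<ge> N" for n
  proof -
    obtain z where z: "has_bochner_integral_on ?I L2 norm2 (\<lambda>t x. deriv (\<eta> n) t * u t x) z"
      "has_bochner_integral_on ?I L2 norm2 (\<lambda>t x. - (\<eta> n t * ut t x)) z"
      using wt test[OF n] unfolding is_weak_time_deriv_def by blast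
    have d: "deriv (\<eta> n) t = \<eta>' n t" for t using \<eta>D by (rule DERIV_imp_deriv)
    have e1: "(\<lambda>x. deriv (\<eta> n) t * u t x) \<bullet>\<^sub>2 y = \<eta>' n t * U' t" for t
      by (simp add: d U'_def)
    have e2: "(\<lambda>x. - (\<eta> n t * ut t x)) \<bullet>\<^sub>2 y = - (\<eta> n t * V t)" for t
      using L2_inner_scale_left[of \<Omega> "- \<eta> n t" "ut t" y] by (simp add: V_def)
    have "integrable (lebesgue_on {0..T}) (\<lambda>t. \<eta>' n t * U' t)"
      by (intro continuous_imp_integrable_real continuous_intros \<eta>'c Uc)
    then have i1: "integrable (lebesgue_on ?I) (\<lambda>t. \<eta>' n t * U' t)"
      by (rule integrable_lebesgue_on_subset) auto
    have i2: "integrable (lebesgue_on ?I) (\<lambda>t. \<eta> n t * V t)"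
    proof (rule Bochner_Integration.integrable_bound[OF Vi])
      show "AE t in lebesgue_on ?I. norm (\<eta> n t * V t) \<le> norm (V t)"
        using \<eta>bound by (intro AE_I2) (simp add: abs_mult mult_left_le_one_le)
    qed (use \<eta>m Vm in measurable)
    have "(\<integral>t. \<eta>' n t * U' t \<partial>lebesgue_on ?I) = z \<bullet>\<^sub>2 y"
      using bochner_integral_inner2[OF I(2) z(1) y] i1 unfolding e1 by simp
    moreover have "(\<integral>t. - (\<eta> n t * V t) \<partial>lebesgue_on ?I) = z \<bullet>\<^sub>2 y"
      using bochner_integral_inner2[OF I(2) z(2) y] i2 unfolding e2 by simp
    moreover have "(\<integral>t. \<eta>' n t * U' t \<partial>lebesgue_on ?I) = integral {0..T} (\<lambda>t. \<eta>' n t * U' t)"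
      by (simp only: lebesgue_integral_eq_integral[OF i1 I(1)] integral_open_interval_real)
    ultimately show ?thesis by simp
  qed
  have lim1: "(\<lambda>n. integral {0..T} (\<lambda>t. \<eta>' n t * U' t)) \<longlonglongrightarrow> U' a - U' b"
  proof -
    have "integral {0..T} (\<lambda>t. \<eta>' n t * U' t) = integral {0..T} (\<lambda>t. real n * \<rho> (real n * (t - a)) * U' t)
        - integral {0..T} (\<lambda>t. real n * \<rho> (real n * (t - b)) * U' t)" for n
      unfolding \<eta>'_def left_diff_distrib
      by (intro Henstock_Kurzweil_Integration.integral_diff integrable_continuous_real continuous_intros Uc
          continuous_on_compose2[OF \<rho>c]) auto
    then show ?thesis
      using tendsto_diff[OF smooth_step_delta[OF P \<rho>c Uc, of a] smooth_step_delta[OF P \<rho>c Uc, of b]] ab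
      by simp
  qed
  have lim2: "(\<lambda>n. - (\<integral>t. \<eta> n t * V t \<partial>lebesgue_on ?I))
      \<longlonglongrightarrow> - (\<integral>t. (if t \<in> {a..b} then V t else 0) \<partial>lebesgue_on ?I)"
  proof (intro tendsto_minus integral_dominated_convergence[where w="\<lambda>t. \<bar>V t\<bar>"])
    have "{a..b} \<inter> space (lebesgue_on ?I) \<in> sets (lebesgue_on ?I)"
      by (subst sets_restrict_space_iff) auto
    then show "(\<lambda>t. if t \<in> {a..b} then V t else 0) \<in> borel_measurable (lebesgue_on ?I)"
      by (intro measurable_If_set Vm borel_measurable_const)
    show "(\<lambda>t. \<eta> n t * V t) \<in> borel_measurable (lebesgue_on ?I)" for n
      using \<eta>m Vm by measurable
    show "integrable (lebesgue_on ?I) (\<lambda>t. \<bar>V t\<bar>)" using Vi by simp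
    show "AE t in lebesgue_on ?I. norm (\<eta> n t * V t) \<le> \<bar>V t\<bar>" for n
      using \<eta>bound by (intro AE_I2) (simp add: abs_mult mult_left_le_one_le)
    \<comment> \<open>Both steps begin to the right of their points, so the limit is 1 on the
      half-open interval from a (excluded) to b (included); the point a is discarded.\<close>
    show "AE t in lebesgue_on ?I. (\<lambda>n. \<eta> n t * V t) \<longlonglongrightarrow> (if t \<in> {a..b} then V t else 0)"
      using AE_lebesgue_on_neq[OF I(1), of a]
    proof eventually_elim
      case (elim t)
      have Pz: "\<forall>\<^sub>F n in sequentially. P (real n * (t - c)) = (if t \<le> c then 0 else 1)" for c
      proof (cases "t \<le> c")
        case True
        then show ?thesis by (simp add: P(3) mult_nonneg_nonpos)
      next
        case False
        obtain M :: nat where M: "real M > 1 / (t - c)" using reals_Archimedean2 by blast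
        have "P (real n * (t - c)) = 1" if "n \<ge> M" for n
        proof (rule P(4))
          have "1 < real M * (t - c)" using M False by (simp add: field_simps)
          also have "\<dots> \<le> real n * (t - c)" using that False by (intro mult_right_mono) auto
          finally show "1 \<le> real n * (t - c)" by simp
        qed
        then show ?thesis using False by (auto simp: eventually_sequentially)
      qed
      have "\<forall>\<^sub>F n in sequentially. \<eta> n t * V t = (if t \<in> {a..b} then V t else 0)"
        using Pz[of a] Pz[of b] by eventually_elim (use elim ab in \<open>auto simp: \<eta>_def\<close>)
      then show ?case by (rule tendsto_eventually)
    qed
  qed
  have "\<forall>\<^sub>F n in sequentially. integral {0..T} (\<lambda>t. \<eta>' n t * U' t) = - (\<integral>t. \<eta> n t * V t \<partial>lebesgue_on ?I)"
    using weak by (auto simp: eventually_sequentially)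
  from LIMSEQ_unique[OF Lim_transform_eventually[OF lim1 this] lim2]
  have "U' a - U' b = - (\<integral>t. (if t \<in> {a..b} then V t else 0) \<partial>lebesgue_on ?I)" .
  also have "(\<integral>t. (if t \<in> {a..b} then V t else 0) \<partial>lebesgue_on ?I) = (\<integral>t. V t \<partial>lebesgue_on {a..b})"
    by (rule Lebesgue_Measure.integral_restrict) (use ab in auto)
  finally show "u b \<bullet>\<^sub>2 y - u a \<bullet>\<^sub>2 y = (\<integral>r. ut r \<bullet>\<^sub>2 y \<partial>lebesgue_on {a..b})"
    by (simp add: U'_def V_def)
qed

end

section \<open>Averages over short time intervals\<close>

text \<open>\<open>integrable_ccontinuous_explicit\<close> concerns forward averages, hence the
  reflection of the time axis. One exceptional set serves every sequence h.\<close>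

lemma backward_average:
  fixes f :: "real \<Rightarrow> real"
  assumes f: "\<And>a b. f integrable_on {a..b}"
  obtains N where "negligible N"
    "\<And>t h. t \<notin> N \<Longrightarrow> (\<And>n::nat. 0 < h n) \<Longrightarrow> h \<longlonglongrightarrow> 0 \<Longrightarrow> (\<lambda>n. integral {t - h n..t} f / h n) \<longlonglongrightarrow> f t"
proof -
  have "(\<lambda>x. f (- x)) integrable_on cbox a b" for a b
    using f[of "-b" "-a"] Henstock_Kurzweil_Integration.integrable_reflect_real[of f "-a" "-b"] by simp
  then obtain N where N: "negligible N" "\<And>x e. x \<notin> N \<Longrightarrow> 0 < e \<Longrightarrow> \<exists>d>0. \<forall>h. 0 < h \<and> h < d \<longrightarrow>
      norm (integral (cbox x (x + h *\<^sub>R One)) (\<lambda>x. f (- x)) /\<^sub>R h ^ DIM(real) - f (- x)) < e"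
    using integrable_ccontinuous_explicit[of "\<lambda>x. f (- x)"] by metis
  show thesis
  proof (rule that[of "uminus ` N"])
    show "negligible (uminus ` N)"
      by (rule negligible_differentiable_image_negligible[OF _ N(1)])
        (auto intro!: linear_imp_differentiable_on simp: linear_uminus)
    fix t and h :: "nat \<Rightarrow> real"
    assume t: "t \<notin> uminus ` N" and h: "\<And>n. 0 < h n" "h \<longlonglongrightarrow> 0"
    have tN: "- t \<notin> N" using t by force
    show "(\<lambda>n. integral {t - h n..t} f / h n) \<longlonglongrightarrow> f t"
    proof (rule LIMSEQ_I)
      fix e :: real assume "e > 0"
      then obtain d where d: "d > 0" "\<And>k. 0 < k \<Longrightarrow> k < d \<Longrightarrow>
          norm (integral (cbox (- t) (- t + k *\<^sub>R One)) (\<lambda>x. f (- x)) /\<^sub>R k ^ DIM(real) - f (- (- t))) < e"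
        using N(2)[OF tN] by blast
      have "\<forall>\<^sub>F n in sequentially. h n < d" using order_tendstoD(2)[OF h(2) d(1)] .
      then obtain M where M: "\<And>n. n \<ge> M \<Longrightarrow> h n < d" unfolding eventually_sequentially by blast
      have "norm (integral {t - h n..t} f / h n - f t) < e" if "n \<ge> M" for n
      proof -
        have "integral (cbox (- t) (- t + h n *\<^sub>R One)) (\<lambda>x. f (- x)) = integral {t - h n..t} f"
          using Henstock_Kurzweil_Integration.integral_reflect_real[of t "t - h n" f] by simp
        then show ?thesis using d(2)[OF h(1) M[OF that]] by (simp add: divide_inverse_commute)
      qed
      then show "\<exists>M. \<forall>n\<ge>M. norm (integral {t - h n..t} f / h n - f t) < e" by blast
    qed
  qed
qed

text \<open>After a shift everything cancels except intervals of length h at the two ends. Divided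
  by h these are averages near b and near a.\<close>

lemma integral_backward_difference:
  fixes F :: "real \<Rightarrow> real"
  assumes F: "continuous_on {0..T} F" and h: "0 \<le> h" "h \<le> a" and ab: "a \<le> b" "b \<le> T"
  shows "integral {a..b} (\<lambda>t. F t - F (t - h)) = integral {b - h..b} F - integral {a - h..a} F"
proof -
  have int: "F integrable_on {c..d}" if "0 \<le> c" "d \<le> T" for c d
    by (rule integrable_continuous_real, rule continuous_on_subset[OF F]) (use that in auto)
  have "continuous_on {a..b} (\<lambda>t. F (t - h))"
    by (rule continuous_on_compose2[OF F]) (use h ab in \<open>auto intro!: continuous_intros\<close>)
  then have i2: "(\<lambda>t. F (t - h)) integrable_on {a..b}" by (rule integrable_continuous_real)
  have "integral {a..b} (\<lambda>t. F t - F (t - h)) = integral {a..b} F - integral {a..b} (\<lambda>t. F (t - h))"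
    by (rule Henstock_Kurzweil_Integration.integral_diff[OF _ i2]) (use h ab in \<open>auto intro: int\<close>)
  also have "integral {a..b} (\<lambda>t. F (t - h)) = integral {a - h..b - h} F"
    using integral_shift_real_ivl[of "a - h" "- h" "b - h" F] by simp
  also have "integral {a..b} F - integral {a - h..b - h} F = integral {b - h..b} F - integral {a - h..a} F"
    using Henstock_Kurzweil_Integration.integral_combine[of "a - h" a b F]
      Henstock_Kurzweil_Integration.integral_combine[of "a - h" "b - h" b F] int h ab by simp
  finally show ?thesis .
qed

section \<open>Mean square approximation and limits of time averages\<close>

context bounded_domain
begin

lemma inner2_Young:
  assumes "x \<in> L2" "y \<in> L2" "\<kappa> > 0"
  shows "\<bar>x \<bullet>\<^sub>2 y\<bar> \<le> \<kappa> / 2 * (norm2 x)\<^sup>2 + (norm2 y)\<^sup>2 / (2 * \<kappa>)"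
proof -
  have "\<bar>x \<bullet>\<^sub>2 y\<bar> \<le> norm2 x * norm2 y" by (rule L2_Cauchy_Schwarz[OF assms(1,2)])
  moreover have "0 \<le> (\<kappa> * norm2 x - norm2 y)\<^sup>2 / (2 * \<kappa>)" using assms(3) by simp
  moreover have "(\<kappa> * norm2 x - norm2 y)\<^sup>2 / (2 * \<kappa>)
      = \<kappa> / 2 * (norm2 x)\<^sup>2 + (norm2 y)\<^sup>2 / (2 * \<kappa>) - norm2 x * norm2 y"
    using assms(3) by (simp add: field_simps power2_eq_square)
  ultimately show ?thesis by linarith
qed

lemma inner2_integrable:
  assumes I: "I \<in> sets lebesgue" and v: "bochner_measurable I L2 norm2 v"
    and vi: "integrable (lebesgue_on I) (\<lambda>t. (norm2 (v t))\<^sup>2)"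
    and wm: "\<And>y. y \<in> L2 \<Longrightarrow> (\<lambda>t. y \<bullet>\<^sub>2 w t) \<in> borel_measurable (lebesgue_on I)"
    and wL: "AE t in lebesgue_on I. w t \<in> L2"
    and wi: "integrable (lebesgue_on I) (\<lambda>t. (norm2 (w t))\<^sup>2)"
  shows "integrable (lebesgue_on I) (\<lambda>t. v t \<bullet>\<^sub>2 w t)"
proof (rule Bochner_Integration.integrable_bound)
  show "integrable (lebesgue_on I) (\<lambda>t. 1 / 2 * (norm2 (v t))\<^sup>2 + (norm2 (w t))\<^sup>2 / (2 * 1))"
    using vi wi by simp
  show "(\<lambda>t. v t \<bullet>\<^sub>2 w t) \<in> borel_measurable (lebesgue_on I)"
    by (rule inner2_measurable[OF I v wm wL])
  show "AE t in lebesgue_on I. norm (v t \<bullet>\<^sub>2 w t) \<le> norm (1 / 2 * (norm2 (v t))\<^sup>2 + (norm2 (w t))\<^sup>2 / (2 * 1))"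
    using bochner_measurable_L2[OF v] wL
  proof eventually_elim
    case (elim t)
    then show ?case using inner2_Young[of "v t" "w t" 1] by simp
  qed
qed

lemma bochner_L2_simple_approx:
  assumes I: "I \<in> sets lebesgue" and v: "v \<in> bochner_L2 I L2 norm2" and e: "0 < e"
  obtains s where "simple_function (lebesgue_on I) s" "s ` I \<subseteq> L2"
    "integrable (lebesgue_on I) (\<lambda>t. (norm2 (\<lambda>x. s t x - v t x))\<^sup>2)"
    "(\<integral>t. (norm2 (\<lambda>x. s t x - v t x))\<^sup>2 \<partial>lebesgue_on I) < e"
proof -
  have vb: "bochner_measurable I L2 norm2 v" and vi: "integrable (lebesgue_on I) (\<lambda>t. (norm2 (v t))\<^sup>2)"
    using v by (auto simp: bochner_L2_def)
  obtain s :: "nat \<Rightarrow> real \<Rightarrow> 'a \<Rightarrow> real"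
    where s: "\<And>n. simple_function (lebesgue_on I) (s n)" "\<And>n. s n ` I \<subseteq> L2"
      and lim: "AE t in lebesgue_on I. (\<lambda>n. norm2 (\<lambda>x. s n t x - v t x)) \<longlonglongrightarrow> 0"
    using vb unfolding bochner_measurable_def by blast
  \<comment> \<open>Outside \<open>A n\<close> the zero function is closer to \<open>v t\<close> than \<open>s n t\<close> is; cutting \<open>s n\<close> off there
    gives the domination needed to pass from convergence almost everywhere to mean square convergence.\<close>
  define A where "A n = {t \<in> space (lebesgue_on I). norm2 (s n t) \<le> 2 * norm2 (v t)}" for n
  have Am: "A n \<in> sets (lebesgue_on I)" for n
  proof -
    have "simple_function (lebesgue_on I) (\<lambda>t. norm2 (s n t))"
      using simple_function_compose[OF s(1)[of n], of norm2] by (simp add: o_def)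
    then have [measurable]: "(\<lambda>t. norm2 (s n t)) \<in> borel_measurable (lebesgue_on I)"
      by (rule borel_measurable_simple_function)
    note [measurable] = norm2_measurable[OF I vb]
    show ?thesis unfolding A_def by measurable
  qed
  define r where "r n t = (if t \<in> A n then s n t else (\<lambda>x. 0))" for n t
  have r: "simple_function (lebesgue_on I) (r n)" "r n ` I \<subseteq> L2" for n
  proof -
    show "simple_function (lebesgue_on I) (r n)"
      unfolding r_def[abs_def] by (intro simple_function_If_set s(1) simple_function_const) (use Am[of n] in auto)
    show "r n ` I \<subseteq> L2" using s(2)[of n] by (auto simp: r_def)
  qed
  have AEI: "AE t in lebesgue_on I. t \<in> I" by (rule AE_I2) simp
  \<comment> \<open>On \<open>A n\<close> the triangle inequality gives 2 + 1 = 3 times the norm of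
    v; off \<open>A n\<close> the cut function is 0 and the distance is the norm of v.\<close>
  have bound: "AE t in lebesgue_on I. norm2 (\<lambda>x. r n t x - v t x) \<le> norm2 (\<lambda>x. s n t x - v t x)
      \<and> norm2 (\<lambda>x. r n t x - v t x) \<le> 3 * norm2 (v t)" for n
    using bochner_measurable_L2[OF vb] AEI
  proof eventually_elim
    case (elim t)
    have st: "s n t \<in> L2" using elim(2) s(2)[of n] by blast
    show ?case
    proof (cases "t \<in> A n")
      case True
      have "norm2 (\<lambda>x. s n t x - v t x) \<le> norm2 (s n t) + norm2 (v t)"
        using L2_norm_triangle_diff[OF st L2_zero elim(1)] by (simp add: L2_norm_def)
      with True show ?thesis by (simp add: r_def A_def)
    next
      case False
      then have "norm2 (s n t) > 2 * norm2 (v t)" using elim(2) by (simp add: A_def)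
      moreover have "norm2 (s n t) - norm2 (v t) \<le> norm2 (\<lambda>x. s n t x - v t x)"
        using L2_norm_diff_ge[OF st elim(1)] by linarith
      moreover have "norm2 (\<lambda>x. r n t x - v t x) = norm2 (v t)"
        using False by (simp add: r_def L2_norm_def)
      ultimately show ?thesis using L2_norm_nonneg[of \<Omega> "v t"] by linarith
    qed
  qed
  have rm: "(\<lambda>t. (norm2 (\<lambda>x. r n t x - v t x))\<^sup>2) \<in> borel_measurable (lebesgue_on I)" for n
    using norm2_measurable[OF I bochner_measurable_simple_diff[OF vb r]] by measurable
  have sq: "AE t in lebesgue_on I. norm ((norm2 (\<lambda>x. r n t x - v t x))\<^sup>2) \<le> 9 * (norm2 (v t))\<^sup>2" for n
    using bound[of n]
  proof eventually_elim
    case (elim t)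
    then have "(norm2 (\<lambda>x. r n t x - v t x))\<^sup>2 \<le> (3 * norm2 (v t))\<^sup>2" by (intro power_mono) auto
    then show ?case by (simp add: power_mult_distrib)
  qed
  have v9: "integrable (lebesgue_on I) (\<lambda>t. 9 * (norm2 (v t))\<^sup>2)" using vi by simp
  have ri: "integrable (lebesgue_on I) (\<lambda>t. (norm2 (\<lambda>x. r n t x - v t x))\<^sup>2)" for n
    by (rule Bochner_Integration.integrable_bound[OF v9 rm]) (use sq[of n] in auto)
  have "(\<lambda>n. \<integral>t. (norm2 (\<lambda>x. r n t x - v t x))\<^sup>2 \<partial>lebesgue_on I) \<longlonglongrightarrow> (\<integral>t. 0 \<partial>lebesgue_on I)"
  proof (rule integral_dominated_convergence[OF _ rm v9 _ sq])
    have "AE t in lebesgue_on I. \<forall>n. norm2 (\<lambda>x. r n t x - v t x) \<le> norm2 (\<lambda>x. s n t x - v t x)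
      \<and> norm2 (\<lambda>x. r n t x - v t x) \<le> 3 * norm2 (v t)"
      using bound by (simp add: AE_all_countable)
    with lim show "AE t in lebesgue_on I. (\<lambda>n. (norm2 (\<lambda>x. r n t x - v t x))\<^sup>2) \<longlonglongrightarrow> 0"
    proof eventually_elim
      case (elim t)
      have "(\<lambda>n. norm2 (\<lambda>x. r n t x - v t x)) \<longlonglongrightarrow> 0"
        by (rule tendsto_sandwich[OF _ _ tendsto_const elim(1)]) (use elim(2) in auto)
      from tendsto_power[OF this, of 2] show ?case by simp
    qed
  qed simp
  then have "\<forall>\<^sub>F n in sequentially. (\<integral>t. (norm2 (\<lambda>x. r n t x - v t x))\<^sup>2 \<partial>lebesgue_on I) < e"
    by (intro order_tendstoD(2)) (use e in auto)
  then obtain n where "(\<integral>t. (norm2 (\<lambda>x. r n t x - v t x))\<^sup>2 \<partial>lebesgue_on I) < e"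
    unfolding eventually_sequentially by blast
  then show thesis by (rule that[OF r ri])
qed

lemma integrable_on_Icc_of_Ioo:
  fixes g :: "real \<Rightarrow> real"
  assumes "integrable (lebesgue_on {0<..<T}) g"
  shows "g integrable_on {0..T}"
  using integrable_on_lebesgue_on[OF assms] has_integral_Icc_iff_Ioo[of g _ 0 T]
  unfolding integrable_on_def by auto

text \<open>The vector y stands for w at the time t, frozen while r runs through [t - h, t]. Young's
  inequality is used pointwise in r, so the error splits into an average of |s - v|^2 and a term
  depending on y alone.\<close>

lemma time_average_difference:
  fixes h :: real
  assumes v: "v \<in> bochner_L2 {0<..<T} L2 norm2"
    and s: "simple_function (lebesgue_on {0<..<T}) s" "s ` {0<..<T} \<subseteq> L2"
    and gi: "integrable (lebesgue_on {0<..<T}) (\<lambda>t. (norm2 (\<lambda>x. s t x - v t x))\<^sup>2)"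
    and y: "y \<in> L2" and \<kappa>: "\<kappa> > 0" and h: "0 < h" "0 < t - h" "t < T"
  shows "\<bar>(\<integral>r. v r \<bullet>\<^sub>2 y \<partial>lebesgue_on {t - h..t}) / h
      - (\<Sum>z\<in>s ` {0<..<T}. (integral {t - h..t} (indicator {r \<in> {0<..<T}. s r = z}) / h) * (z \<bullet>\<^sub>2 y))\<bar>
    \<le> \<kappa> / 2 * (integral {t - h..t} (\<lambda>t. (norm2 (\<lambda>x. s t x - v t x))\<^sup>2) / h) + (norm2 y)\<^sup>2 / (2 * \<kappa>)"
proof -
  let ?I = "{0<..<T}" and ?J = "{t - h..t}"
  have I: "?I \<in> sets lebesgue" "?I \<in> lmeasurable" and J: "?J \<in> sets lebesgue" "?J \<subseteq> ?I"
    using h by auto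
  have vb: "bochner_measurable ?I L2 norm2 v" and vi: "integrable (lebesgue_on ?I) (\<lambda>t. (norm2 (v t))\<^sup>2)"
    using v by (auto simp: bochner_L2_def)
  define g where "g t = (norm2 (\<lambda>x. s t x - v t x))\<^sup>2" for t
  interpret finite_measure "lebesgue_on ?I" by (rule finite_measure_lebesgue_on[OF I(2)])
  have "integrable (lebesgue_on ?I) (\<lambda>r. v r \<bullet>\<^sub>2 y)"
    by (rule inner2_integrable[OF I(1) vb vi]) (use y in auto)
  from integrable_lebesgue_on_subset[OF this I(1) J] have iv: "integrable (lebesgue_on ?J) (\<lambda>r. v r \<bullet>\<^sub>2 y)" .
  from integrable_lebesgue_on_subset[OF simple_integral_inner2(1)[OF I(2) s y] I(1) J]
  have si: "integrable (lebesgue_on ?J) (\<lambda>r. s r \<bullet>\<^sub>2 y)" .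
  have gJ: "integrable (lebesgue_on ?J) g"
    unfolding g_def[abs_def] by (rule integrable_lebesgue_on_subset[OF gi I(1) J])
  interpret Jm: finite_measure "lebesgue_on ?J" by (rule finite_measure_lebesgue_on) auto
  have mJ: "measure (lebesgue_on ?J) (space (lebesgue_on ?J)) = h"
    using h by (simp add: measure_restrict_space)
  have cJ: "(\<integral>r. c \<partial>lebesgue_on ?J) = h * c" for c :: real
    using mJ by simp
  have ind: "integrable (lebesgue_on ?I) (indicator {r \<in> ?I. s r = z} :: real \<Rightarrow> real)" if "z \<in> s ` ?I" for z
    using simple_function_level_set[OF s(1) that] by (intro integrable_real_indicator) (auto simp: emeasure_eq_measure)
  have indJ: "integrable (lebesgue_on ?J) (indicator {r \<in> ?I. s r = z} :: real \<Rightarrow> real)" if "z \<in> s ` ?I" for z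
    by (rule integrable_lebesgue_on_subset[OF ind[OF that] I(1) J])
  have "(\<integral>r. s r \<bullet>\<^sub>2 y \<partial>lebesgue_on ?J)
      = (\<integral>r. (\<Sum>z\<in>s ` ?I. indicator {r \<in> ?I. s r = z} r * (z \<bullet>\<^sub>2 y)) \<partial>lebesgue_on ?J)"
    using J(2) by (intro Bochner_Integration.integral_cong refl simple_function_split_integral[OF s(1), where h="\<lambda>t z. z \<bullet>\<^sub>2 y"]) auto
  also have "\<dots> = (\<Sum>z\<in>s ` ?I. (\<integral>r. indicator {r \<in> ?I. s r = z} r * (z \<bullet>\<^sub>2 y) \<partial>lebesgue_on ?J))"
    by (intro Bochner_Integration.integral_sum integrable_mult_left indJ)
  also have "\<dots> = (\<Sum>z\<in>s ` ?I. integral ?J (indicator {r \<in> ?I. s r = z}) * (z \<bullet>\<^sub>2 y))"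
  proof (intro sum.cong refl)
    fix z assume "z \<in> s ` ?I"
    from lebesgue_integral_eq_integral[OF indJ[OF this] J(1)]
    show "(\<integral>r. indicator {r \<in> ?I. s r = z} r * (z \<bullet>\<^sub>2 y) \<partial>lebesgue_on ?J)
        = integral ?J (indicator {r \<in> ?I. s r = z}) * (z \<bullet>\<^sub>2 y)"
      by (simp only: integral_mult_left_zero)
  qed
  finally have sJ: "(\<integral>r. s r \<bullet>\<^sub>2 y \<partial>lebesgue_on ?J) / h
      = (\<Sum>z\<in>s ` ?I. (integral ?J (indicator {r \<in> ?I. s r = z}) / h) * (z \<bullet>\<^sub>2 y))"
    by (simp add: sum_divide_distrib)
  have "\<bar>(\<integral>r. v r \<bullet>\<^sub>2 y \<partial>lebesgue_on ?J) - (\<integral>r. s r \<bullet>\<^sub>2 y \<partial>lebesgue_on ?J)\<bar>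
      = \<bar>\<integral>r. s r \<bullet>\<^sub>2 y - v r \<bullet>\<^sub>2 y \<partial>lebesgue_on ?J\<bar>"
    using iv si by simp
  also have "\<dots> \<le> (\<integral>r. \<bar>s r \<bullet>\<^sub>2 y - v r \<bullet>\<^sub>2 y\<bar> \<partial>lebesgue_on ?J)"
    by (rule integral_abs_bound)
  also have "\<dots> \<le> (\<integral>r. \<kappa> / 2 * g r + (norm2 y)\<^sup>2 / (2 * \<kappa>) \<partial>lebesgue_on ?J)"
  proof (rule integral_mono_AE)
    show "integrable (lebesgue_on ?J) (\<lambda>r. \<bar>s r \<bullet>\<^sub>2 y - v r \<bullet>\<^sub>2 y\<bar>)" using iv si by simp
    show "integrable (lebesgue_on ?J) (\<lambda>r. \<kappa> / 2 * g r + (norm2 y)\<^sup>2 / (2 * \<kappa>))" using gJ by simp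
    have "AE r in lebesgue_on ?J. r \<in> ?J" by (rule AE_I2) simp
    with AE_lebesgue_on_subset[OF bochner_measurable_L2[OF vb] I(1) J]
    show "AE r in lebesgue_on ?J. \<bar>s r \<bullet>\<^sub>2 y - v r \<bullet>\<^sub>2 y\<bar> \<le> \<kappa> / 2 * g r + (norm2 y)\<^sup>2 / (2 * \<kappa>)"
    proof eventually_elim
      case (elim r)
      have sr: "s r \<in> L2" using elim(2) J(2) s(2) by blast
      show ?case
        using inner2_Young[OF L2_diff[OF sr elim(1)] y \<kappa>] L2_inner_diff_left[OF sr elim(1) y] by (simp add: g_def)
    qed
  qed
  also have "\<dots> = (\<integral>r. \<kappa> / 2 * g r \<partial>lebesgue_on ?J) + (\<integral>r. (norm2 y)\<^sup>2 / (2 * \<kappa>) \<partial>lebesgue_on ?J)"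
    by (rule Bochner_Integration.integral_add) (use gJ in auto)
  also have "\<dots> = \<kappa> / 2 * integral ?J g + h * ((norm2 y)\<^sup>2 / (2 * \<kappa>))"
    by (simp only: integral_mult_right_zero cJ lebesgue_integral_eq_integral[OF gJ J(1)])
  finally have "\<bar>(\<integral>r. v r \<bullet>\<^sub>2 y \<partial>lebesgue_on ?J) - (\<integral>r. s r \<bullet>\<^sub>2 y \<partial>lebesgue_on ?J)\<bar> / h
      \<le> (\<kappa> / 2 * integral ?J g + h * ((norm2 y)\<^sup>2 / (2 * \<kappa>))) / h"
    using h by (intro divide_right_mono) auto
  moreover have "\<bar>A / h - B / h\<bar> = \<bar>A - B\<bar> / h" for A B :: real
    using h by (simp add: diff_divide_distrib[symmetric])
  moreover have "(\<kappa> / 2 * integral ?J g + h * ((norm2 y)\<^sup>2 / (2 * \<kappa>))) / h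
      = \<kappa> / 2 * (integral ?J g / h) + (norm2 y)\<^sup>2 / (2 * \<kappa>)"
    using h by (simp add: add_divide_distrib)
  ultimately show ?thesis unfolding sJ[symmetric] g_def[abs_def] by simp
qed

text \<open>For a simple function \<open>s\<close> in place of \<open>v\<close> the averages converge by Lebesgue's differentiation
  theorem and dominated convergence. The error of replacing \<open>v\<close> by \<open>s\<close> is controlled by Young's
  inequality, where the time averages of \<open>g = |s - v|\<^sup>2\<close> are the difference quotients of its increasing
  primitive \<open>\<Phi>\<close>, whose integrals telescope.\<close>

lemma time_average_limit:
  fixes q :: "nat \<Rightarrow> real \<Rightarrow> real" and h :: "nat \<Rightarrow> real"
  assumes v: "v \<in> bochner_L2 {0<..<T} L2 norm2"
    and wL: "AE t in lebesgue_on {0<..<T}. w t \<in> L2"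
    and wm: "\<And>y. y \<in> L2 \<Longrightarrow> (\<lambda>t. y \<bullet>\<^sub>2 w t) \<in> borel_measurable (lebesgue_on {0<..<T})"
    and wi: "integrable (lebesgue_on {0<..<T}) (\<lambda>t. (norm2 (w t))\<^sup>2)"
    and ab: "0 < a" "a \<le> b" "b < T"
    and h: "\<And>n. 0 < h n" "\<And>n. h n < a" "h \<longlonglongrightarrow> 0"
    and qm: "\<And>n. q n \<in> borel_measurable (lebesgue_on {a..b})"
    and q: "\<And>n. AE t in lebesgue_on {a..b}. q n t = (\<integral>r. v r \<bullet>\<^sub>2 w t \<partial>lebesgue_on {t - h n..t}) / h n"
  shows "\<And>n. integrable (lebesgue_on {a..b}) (q n)"
    and "integrable (lebesgue_on {a..b}) (\<lambda>t. v t \<bullet>\<^sub>2 w t)"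
    and "(\<lambda>n. \<integral>t. q n t \<partial>lebesgue_on {a..b}) \<longlonglongrightarrow> (\<integral>t. v t \<bullet>\<^sub>2 w t \<partial>lebesgue_on {a..b})"
proof -
  let ?I = "{0<..<T}" and ?J = "{a..b}"
  have I: "?I \<in> sets lebesgue" "?I \<in> lmeasurable" and J: "?J \<in> sets lebesgue" "?J \<subseteq> ?I"
    using ab by auto
  have vb: "bochner_measurable ?I L2 norm2 v" and vi: "integrable (lebesgue_on ?I) (\<lambda>t. (norm2 (v t))\<^sup>2)"
    using v by (auto simp: bochner_L2_def)
  interpret finite_measure "lebesgue_on ?I" by (rule finite_measure_lebesgue_on[OF I(2)])
  have AEJ: "AE t in lebesgue_on ?J. t \<in> ?J" by (rule AE_I2) simp
  note wLJ = AE_lebesgue_on_subset[OF wL I(1) J]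
  note wiJ = integrable_lebesgue_on_subset[OF wi I(1) J]
  have vwI: "integrable (lebesgue_on ?I) (\<lambda>t. v t \<bullet>\<^sub>2 w t)"
    by (rule inner2_integrable[OF I(1) vb vi wm wL wi])
  show vw: "integrable (lebesgue_on ?J) (\<lambda>t. v t \<bullet>\<^sub>2 w t)"
    by (rule integrable_lebesgue_on_subset[OF vwI I(1) J])
  define W where "W = (\<integral>t. (norm2 (w t))\<^sup>2 \<partial>lebesgue_on ?J)"
  have W0: "0 \<le> W" by (simp add: W_def)
  \<comment> \<open>Integrability of \<open>q n\<close> is a by-product of the comparison with a
    simple function, so it is proved together with the limit; afterwards it is read off at e =
    1.\<close>
  have main: "(\<forall>n. integrable (lebesgue_on ?J) (q n)) \<and>
      (\<exists>N. \<forall>n\<ge>N. \<bar>(\<integral>t. q n t \<partial>lebesgue_on ?J) - (\<integral>t. v t \<bullet>\<^sub>2 w t \<partial>lebesgue_on ?J)\<bar> < e)" if e: "e > 0" for e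
  proof -
    \<comment> \<open>Replacing v by s costs at most B = (1 + W)/(2\<kappa>) = e/4, once in the
      averages and once in the limit; a third e/4 comes from the convergence for s.\<close>
    define \<kappa> where "\<kappa> = 2 * (1 + W) / e"
    have \<kappa>: "\<kappa> > 0" using e W0 by (simp add: \<kappa>_def)
    obtain s where s: "simple_function (lebesgue_on ?I) s" "s ` ?I \<subseteq> L2"
      and gi': "integrable (lebesgue_on ?I) (\<lambda>t. (norm2 (\<lambda>x. s t x - v t x))\<^sup>2)"
      and small: "(\<integral>t. (norm2 (\<lambda>x. s t x - v t x))\<^sup>2 \<partial>lebesgue_on ?I) < 1 / \<kappa>\<^sup>2"
      by (rule bochner_L2_simple_approx[OF I(1) v, of "1 / \<kappa>\<^sup>2"]) (use \<kappa> that in auto)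
    define g where "g t = (norm2 (\<lambda>x. s t x - v t x))\<^sup>2" for t
    have gi: "integrable (lebesgue_on ?I) g" using gi' by (simp add: g_def[abs_def])
    have g0: "0 \<le> g t" for t by (simp add: g_def)
    have giT: "g integrable_on {0..T}" by (rule integrable_on_Icc_of_Ioo[OF gi])
    define \<Phi> where "\<Phi> t = integral {0..t} g" for t
    have \<Phi>c: "continuous_on {0..T} \<Phi>"
      unfolding \<Phi>_def by (rule indefinite_integral_continuous_1[OF giT])
    have \<Phi>T: "\<Phi> T \<le> 1 / \<kappa>\<^sup>2"
      using small lebesgue_integral_eq_integral[OF gi I(1)] integral_open_interval_real[of 0 T g]
      unfolding \<Phi>_def g_def[symmetric] by simp
    have \<Phi>_diff: "integral {c..d} g = \<Phi> d - \<Phi> c" if "0 \<le> c" "c \<le> d" "d \<le> T" for c d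
      using Henstock_Kurzweil_Integration.integral_combine[of 0 c d g] integrable_subinterval_real[OF giT, of 0 d] that
      by (simp add: \<Phi>_def)
    have \<Phi>_mono: "\<Phi> c \<le> \<Phi> d" if "0 \<le> c" "c \<le> d" "d \<le> T" for c d
    proof -
      have "0 \<le> integral {c..d} g"
        by (rule Henstock_Kurzweil_Integration.integral_nonneg)
          (use integrable_subinterval_real[OF giT, of c d] that g0 in auto)
      then show ?thesis using \<Phi>_diff[OF that] by simp
    qed
    have \<Phi>0: "\<Phi> 0 = 0" by (simp add: \<Phi>_def)
    let ?Y = "s ` ?I"
    have Yfin: "finite ?Y" using s(1) by (simp add: simple_function_def)
    define A where "A z = {r \<in> ?I. s r = z}" for z
    have Am: "A z \<in> sets lebesgue" if "z \<in> ?Y" for z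
      using simple_function_level_set[OF s(1) that] I(1) unfolding A_def by (simp add: sets_restrict_space_iff)
    have Aint: "(indicator (A z) :: real \<Rightarrow> real) integrable_on {c..d}" if "z \<in> ?Y" for z c d
    proof -
      have "A z \<inter> {c..d} \<in> lmeasurable" using Am[OF that] by (intro bounded_set_imp_lmeasurable) auto
      then have "(indicator (A z \<inter> {c..d}) :: real \<Rightarrow> real) integrable_on UNIV"
        using lmeasurable_iff_indicator_has_integral has_integral_integrable lmeasurable_iff_has_integral by blast
      then have "(\<lambda>x. if x \<in> {c..d} then indicator (A z) x else 0 :: real) integrable_on UNIV"
        by (rule integrable_eq) (auto simp: indicator_def)
      then show ?thesis using Henstock_Kurzweil_Integration.integrable_restrict_UNIV by blast
    qed
    \<comment> \<open>The analogue of \<open>q n\<close> with the simple function s in place of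
      v.\<close>
    define p where "p n t = (\<Sum>z\<in>?Y. (integral {t - h n..t} (indicator (A z)) / h n) * (z \<bullet>\<^sub>2 w t))" for n t
    have avg01: "0 \<le> integral {t - h n..t} (indicator (A z)) / h n" "integral {t - h n..t} (indicator (A z)) / h n \<le> 1"
      if "z \<in> ?Y" for z n t
    proof -
      have "0 \<le> integral {t - h n..t} (indicator (A z) :: real \<Rightarrow> real)"
        by (intro Henstock_Kurzweil_Integration.integral_nonneg Aint that) auto
      then show "0 \<le> integral {t - h n..t} (indicator (A z)) / h n" using h(1)[of n] by simp
      have "integral {t - h n..t} (indicator (A z) :: real \<Rightarrow> real) \<le> integral {t - h n..t} (\<lambda>_. 1)"
        by (intro integral_le Aint that) auto
      also have "\<dots> = h n" using h(1)[of n] by simp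
      finally show "integral {t - h n..t} (indicator (A z)) / h n \<le> 1" using h(1)[of n] by simp
    qed
    have zw: "integrable (lebesgue_on ?J) (\<lambda>t. \<bar>z \<bullet>\<^sub>2 w t\<bar>)" if "z \<in> ?Y" for z
    proof -
      have z: "z \<in> L2" using that s(2) by blast
      have "integrable (lebesgue_on ?I) (\<lambda>t. z \<bullet>\<^sub>2 w t)"
      proof (rule Bochner_Integration.integrable_bound[OF _ wm[OF z]])
        show "integrable (lebesgue_on ?I) (\<lambda>t. 1 / 2 * (norm2 z)\<^sup>2 + (norm2 (w t))\<^sup>2 / (2 * 1))"
          using wi by simp
        show "AE t in lebesgue_on ?I. norm (z \<bullet>\<^sub>2 w t) \<le> norm (1 / 2 * (norm2 z)\<^sup>2 + (norm2 (w t))\<^sup>2 / (2 * 1))"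
          using wL
        proof eventually_elim
          case (elim t)
          then show ?case using inner2_Young[OF z elim, of 1] by simp
        qed
      qed
      then show ?thesis by (intro integrable_abs integrable_lebesgue_on_subset[OF _ I(1) J])
    qed
    have wmJ: "(\<lambda>t. z \<bullet>\<^sub>2 w t) \<in> borel_measurable (lebesgue_on ?J)" if "z \<in> ?Y" for z
    proof -
      have "(\<lambda>t. z \<bullet>\<^sub>2 w t) \<in> borel_measurable (lebesgue_on ?I)" using wm that s(2) by blast
      then show ?thesis by (rule measurable_restrict_mono[OF _ J(2)])
    qed
    \<comment> \<open>As a difference of two values of a primitive, the average is even continuous
      in t.\<close>
    have avgm: "(\<lambda>t. integral {t - h n..t} (indicator (A z)) / h n) \<in> borel_measurable (lebesgue_on ?J)" if z: "z \<in> ?Y" for z n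
    proof -
      define \<Psi> where "\<Psi> t = integral {0..t} (indicator (A z) :: real \<Rightarrow> real)" for t
      have \<Psi>c: "continuous_on {0..T} \<Psi>"
        unfolding \<Psi>_def by (rule indefinite_integral_continuous_1[OF Aint[OF z]])
      have "integral {t - h n..t} (indicator (A z)) = \<Psi> t - \<Psi> (t - h n)" if "t \<in> ?J" for t
        using Henstock_Kurzweil_Integration.integral_combine[of 0 "t - h n" t "indicator (A z) :: real \<Rightarrow> real"]
          Aint[OF z] that h(1)[of n] h(2)[of n] by (simp add: \<Psi>_def)
      then have "continuous_on ?J (\<lambda>t. integral {t - h n..t} (indicator (A z) :: real \<Rightarrow> real)) \<longleftrightarrow>
          continuous_on ?J (\<lambda>t. \<Psi> t - \<Psi> (t - h n))"
        by (intro continuous_on_cong) auto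
      moreover have "continuous_on ?J (\<lambda>t. \<Psi> t - \<Psi> (t - h n))"
        by (intro continuous_intros continuous_on_compose2[OF \<Psi>c])
          (use ab h(1)[of n] h(2)[of n] in auto)
      ultimately have "continuous_on ?J (\<lambda>t. integral {t - h n..t} (indicator (A z) :: real \<Rightarrow> real) / h n)"
        using h(1)[of n] by (intro continuous_intros) auto
      then show ?thesis by (rule continuous_imp_measurable_on_sets_lebesgue[OF _ J(1)])
    qed
    have pm: "p n \<in> borel_measurable (lebesgue_on ?J)" for n
      unfolding p_def[abs_def] by (intro borel_measurable_sum borel_measurable_times avgm wmJ)
    have pbound: "norm (p n t) \<le> (\<Sum>z\<in>?Y. \<bar>z \<bullet>\<^sub>2 w t\<bar>)" for n t
    proof -
      have "\<bar>(integral {t - h n..t} (indicator (A z)) / h n) * (z \<bullet>\<^sub>2 w t)\<bar> \<le> \<bar>z \<bullet>\<^sub>2 w t\<bar>" if "z \<in> ?Y" for z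
        using avg01[OF that, of t n] unfolding abs_mult by (intro mult_left_le_one_le) auto
      then show ?thesis
        unfolding p_def real_norm_def by (intro order_trans[OF sum_abs] sum_mono)
    qed
    have domi: "integrable (lebesgue_on ?J) (\<lambda>t. \<Sum>z\<in>?Y. \<bar>z \<bullet>\<^sub>2 w t\<bar>)"
      by (intro Bochner_Integration.integrable_sum zw)
    have pi: "integrable (lebesgue_on ?J) (p n)" for n
      by (rule Bochner_Integration.integrable_bound[OF domi pm]) (use pbound in \<open>auto intro!: AE_I2 order_trans[OF _ abs_ge_self]\<close>)
    have sw: "s t \<bullet>\<^sub>2 w t = (\<Sum>z\<in>?Y. indicator (A z) t * (z \<bullet>\<^sub>2 w t))" if "t \<in> ?J" for t
      unfolding A_def by (rule simple_function_split_integral[OF s(1), where h="\<lambda>t z. z \<bullet>\<^sub>2 w t"]) (use that J in auto)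
    \<comment> \<open>One null set for each value of s, and there are finitely many values.\<close>
    have plim: "AE t in lebesgue_on ?J. (\<lambda>n. p n t) \<longlonglongrightarrow> s t \<bullet>\<^sub>2 w t"
    proof -
      have "AE t in lebesgue. (\<lambda>n. integral {t - h n..t} (indicator (A z)) / h n) \<longlonglongrightarrow> indicator (A z) t"
        if z: "z \<in> ?Y" for z
      proof -
        obtain N where N: "negligible N" "\<And>t h. t \<notin> N \<Longrightarrow> (\<And>n::nat. 0 < h n) \<Longrightarrow> h \<longlonglongrightarrow> 0 \<Longrightarrow>
            (\<lambda>n. integral {t - h n..t} (indicator (A z)) / h n) \<longlonglongrightarrow> (indicator (A z) t :: real)"
          by (rule backward_average[OF Aint[OF z]]) (rule that, assumption, blast)
        have "AE t in lebesgue. t \<notin> N"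
          using N(1) by (intro AE_not_in) (simp add: negligible_iff_null_sets)
        then show ?thesis by eventually_elim (rule N(2)[OF _ h(1) h(3)])
      qed
      then have "AE t in lebesgue. \<forall>z\<in>?Y. (\<lambda>n. integral {t - h n..t} (indicator (A z)) / h n) \<longlonglongrightarrow> (indicator (A z) t :: real)"
        by (intro AE_finite_allI Yfin)
      then have "AE t in lebesgue. t \<in> ?J \<longrightarrow> (\<lambda>n. p n t) \<longlonglongrightarrow> s t \<bullet>\<^sub>2 w t"
      proof eventually_elim
        case (elim t)
        show ?case
        proof
          assume t: "t \<in> ?J"
          show "(\<lambda>n. p n t) \<longlonglongrightarrow> s t \<bullet>\<^sub>2 w t"
            unfolding sw[OF t] p_def by (intro tendsto_sum tendsto_mult tendsto_const) (use elim in blast)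
        qed
      qed
      then show ?thesis using J(1) by (simp add: AE_restrict_space_iff)
    qed
    have swm: "(\<lambda>t. s t \<bullet>\<^sub>2 w t) \<in> borel_measurable (lebesgue_on ?J)"
      by (rule borel_measurable_AE_LIMSEQ[OF J(1) pm plim])
    have swi: "integrable (lebesgue_on ?J) (\<lambda>t. s t \<bullet>\<^sub>2 w t)"
      by (rule integrable_dominated_convergence[OF swm pm domi plim]) (use pbound in auto)
    have pint: "(\<lambda>n. \<integral>t. p n t \<partial>lebesgue_on ?J) \<longlonglongrightarrow> (\<integral>t. s t \<bullet>\<^sub>2 w t \<partial>lebesgue_on ?J)"
      by (rule integral_dominated_convergence[OF swm pm domi plim]) (use pbound in auto)
    define B where "B = \<kappa> / 2 * (1 / \<kappa>\<^sup>2) + W / (2 * \<kappa>)"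
    have B: "B = e / 4"
    proof -
      have "B = (1 + W) / (2 * \<kappa>)" using \<kappa> by (simp add: B_def field_simps power2_eq_square)
      moreover have "V / (2 * (2 * V / e)) = e / 4" if "V > 0" for V
        using that e by (simp add: field_simps)
      from this[of "1 + W"] have "(1 + W) / (2 * \<kappa>) = e / 4" using W0 by (simp only: \<kappa>_def)
      ultimately show ?thesis by simp
    qed
    define D where "D n t = \<kappa> / 2 * ((\<Phi> t - \<Phi> (t - h n)) / h n) + (norm2 (w t))\<^sup>2 / (2 * \<kappa>)" for n t
    have \<Phi>Dc: "continuous_on ?J (\<lambda>t. \<Phi> t - \<Phi> (t - h n))" for n
      by (intro continuous_intros continuous_on_compose2[OF \<Phi>c]) (use ab h(1)[of n] h(2)[of n] in auto)
    have \<Phi>Di: "integrable (lebesgue_on ?J) (\<lambda>t. \<Phi> t - \<Phi> (t - h n))" for n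
      by (rule continuous_imp_integrable_real[OF \<Phi>Dc])
    have Di: "integrable (lebesgue_on ?J) (D n)" for n
      unfolding D_def[abs_def] using \<Phi>Di[of n] wiJ by simp
    \<comment> \<open>The bound has to be uniform in n. By the telescoping identity the integral of
      \<Phi>(t) - \<Phi>(t - h) is at most h \<Phi>(T), because \<Phi> is nonnegative and
      increasing; the factor h cancels.\<close>
    have DB: "(\<integral>t. D n t \<partial>lebesgue_on ?J) \<le> B" for n
    proof -
      have "(\<integral>t. \<Phi> t - \<Phi> (t - h n) \<partial>lebesgue_on ?J) = integral {b - h n..b} \<Phi> - integral {a - h n..a} \<Phi>"
        unfolding lebesgue_integral_eq_integral[OF \<Phi>Di J(1)]
        by (rule integral_backward_difference[OF \<Phi>c]) (use h(1)[of n] h(2)[of n] ab in auto)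
      also have "\<dots> \<le> h n * \<Phi> T - 0"
      proof (rule diff_mono)
        have \<Phi>int: "\<Phi> integrable_on {c..d}" if "0 \<le> c" "d \<le> T" for c d
          by (rule integrable_continuous_real, rule continuous_on_subset[OF \<Phi>c]) (use that in auto)
        have "integral {b - h n..b} \<Phi> \<le> integral {b - h n..b} (\<lambda>_. \<Phi> T)"
          by (intro integral_le \<Phi>int \<Phi>_mono) (use h(2)[of n] ab in auto)
        then show "integral {b - h n..b} \<Phi> \<le> h n * \<Phi> T" using h(1)[of n] by simp
        show "0 \<le> integral {a - h n..a} \<Phi>"
        proof (intro Henstock_Kurzweil_Integration.integral_nonneg \<Phi>int)
          show "0 \<le> \<Phi> t" if "t \<in> {a - h n..a}" for t
            using \<Phi>_mono[of 0 t] \<Phi>0 that h(2)[of n] ab by simp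
        qed (use h(2)[of n] ab in auto)
      qed
      finally have *: "(\<integral>t. \<Phi> t - \<Phi> (t - h n) \<partial>lebesgue_on ?J) / h n \<le> \<Phi> T"
        using h(1)[of n] by (simp add: field_simps)
      have "(\<integral>t. D n t \<partial>lebesgue_on ?J) = \<kappa> / 2 * ((\<integral>t. \<Phi> t - \<Phi> (t - h n) \<partial>lebesgue_on ?J) / h n) + W / (2 * \<kappa>)"
      proof -
        have "integrable (lebesgue_on ?J) (\<lambda>t. \<kappa> / 2 * ((\<Phi> t - \<Phi> (t - h n)) / h n))"
          "integrable (lebesgue_on ?J) (\<lambda>t. (norm2 (w t))\<^sup>2 / (2 * \<kappa>))"
          using \<Phi>Di[of n] wiJ by auto
        then show ?thesis
          unfolding D_def W_def by (simp only: Bochner_Integration.integral_add integral_mult_right_zero integral_divide_zero)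
      qed
      also have "\<dots> \<le> \<kappa> / 2 * \<Phi> T + W / (2 * \<kappa>)"
        using * \<kappa> by (intro add_right_mono mult_left_mono) auto
      also have "\<dots> \<le> B" unfolding B_def using \<Phi>T \<kappa> by (intro add_right_mono mult_left_mono) auto
      finally show ?thesis .
    qed
    have qp: "AE t in lebesgue_on ?J. \<bar>q n t - p n t\<bar> \<le> D n t" for n
      using q[of n] wLJ AEJ
    proof eventually_elim
      case (elim t)
      have t: "0 < t - h n" "t < T" using elim(3) h(2)[of n] ab by auto
      have "\<bar>q n t - p n t\<bar> \<le> \<kappa> / 2 * (integral {t - h n..t} g / h n) + (norm2 (w t))\<^sup>2 / (2 * \<kappa>)"
        unfolding elim(1) p_def A_def g_def[abs_def]
        by (rule time_average_difference[OF v s gi' elim(2) \<kappa> h(1) t])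
      also have "integral {t - h n..t} g = \<Phi> t - \<Phi> (t - h n)"
        by (rule \<Phi>_diff) (use t h(1)[of n] in auto)
      finally show ?case by (simp add: D_def)
    qed
    have qpi: "integrable (lebesgue_on ?J) (\<lambda>t. q n t - p n t)" for n
    proof (rule Bochner_Integration.integrable_bound[OF Di[of n]])
      show "(\<lambda>t. q n t - p n t) \<in> borel_measurable (lebesgue_on ?J)" using qm[of n] pm[of n] by measurable
      show "AE t in lebesgue_on ?J. norm (q n t - p n t) \<le> norm (D n t)"
        using qp[of n] by eventually_elim simp
    qed
    have qi: "integrable (lebesgue_on ?J) (q n)" for n
      using Bochner_Integration.integrable_add[OF qpi[of n] pi[of n]] by simp
    have 1: "\<bar>(\<integral>t. q n t \<partial>lebesgue_on ?J) - (\<integral>t. p n t \<partial>lebesgue_on ?J)\<bar> \<le> B" for n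
    proof -
      have "\<bar>(\<integral>t. q n t \<partial>lebesgue_on ?J) - (\<integral>t. p n t \<partial>lebesgue_on ?J)\<bar> = \<bar>\<integral>t. q n t - p n t \<partial>lebesgue_on ?J\<bar>"
        using qi pi by simp
      also have "\<dots> \<le> (\<integral>t. \<bar>q n t - p n t\<bar> \<partial>lebesgue_on ?J)" by (rule integral_abs_bound)
      also have "\<dots> \<le> (\<integral>t. D n t \<partial>lebesgue_on ?J)"
        by (rule integral_mono_AE[OF integrable_abs[OF qpi] Di qp])
      also note DB
      finally show ?thesis .
    qed
    have 2: "\<bar>(\<integral>t. s t \<bullet>\<^sub>2 w t \<partial>lebesgue_on ?J) - (\<integral>t. v t \<bullet>\<^sub>2 w t \<partial>lebesgue_on ?J)\<bar> \<le> B"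
    proof -
      have giJ: "integrable (lebesgue_on ?J) g" by (rule integrable_lebesgue_on_subset[OF gi I(1) J])
      have "\<bar>(\<integral>t. s t \<bullet>\<^sub>2 w t \<partial>lebesgue_on ?J) - (\<integral>t. v t \<bullet>\<^sub>2 w t \<partial>lebesgue_on ?J)\<bar>
          = \<bar>\<integral>t. s t \<bullet>\<^sub>2 w t - v t \<bullet>\<^sub>2 w t \<partial>lebesgue_on ?J\<bar>"
        using swi vw by simp
      also have "\<dots> \<le> (\<integral>t. \<bar>s t \<bullet>\<^sub>2 w t - v t \<bullet>\<^sub>2 w t\<bar> \<partial>lebesgue_on ?J)" by (rule integral_abs_bound)
      also have "\<dots> \<le> (\<integral>t. \<kappa> / 2 * g t + (norm2 (w t))\<^sup>2 / (2 * \<kappa>) \<partial>lebesgue_on ?J)"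
      proof (rule integral_mono_AE)
        show "integrable (lebesgue_on ?J) (\<lambda>t. \<bar>s t \<bullet>\<^sub>2 w t - v t \<bullet>\<^sub>2 w t\<bar>)" using swi vw by simp
        show "integrable (lebesgue_on ?J) (\<lambda>t. \<kappa> / 2 * g t + (norm2 (w t))\<^sup>2 / (2 * \<kappa>))" using giJ wiJ by simp
        show "AE t in lebesgue_on ?J. \<bar>s t \<bullet>\<^sub>2 w t - v t \<bullet>\<^sub>2 w t\<bar> \<le> \<kappa> / 2 * g t + (norm2 (w t))\<^sup>2 / (2 * \<kappa>)"
          using AE_lebesgue_on_subset[OF bochner_measurable_L2[OF vb] I(1) J] wLJ AEJ
        proof eventually_elim
          case (elim t)
          have st: "s t \<in> L2" using elim(3) J(2) s(2) by blast
          show ?case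
            using inner2_Young[OF L2_diff[OF st elim(1)] elim(2) \<kappa>] L2_inner_diff_left[OF st elim(1,2)] by (simp add: g_def)
        qed
      qed
      also have "\<dots> = \<kappa> / 2 * integral ?J g + W / (2 * \<kappa>)"
        using giJ wiJ by (simp add: W_def lebesgue_integral_eq_integral[OF giJ J(1)])
      also have "integral ?J g = \<Phi> b - \<Phi> a" by (rule \<Phi>_diff) (use ab in auto)
      also have "\<kappa> / 2 * (\<Phi> b - \<Phi> a) + W / (2 * \<kappa>) \<le> \<kappa> / 2 * (1 / \<kappa>\<^sup>2) + W / (2 * \<kappa>)"
        using \<Phi>_mono[of b T] \<Phi>_mono[of 0 a] \<Phi>0 \<Phi>T ab \<kappa> by (intro add_right_mono mult_left_mono) auto
      finally show ?thesis by (simp add: B_def)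
    qed
    obtain N where N: "\<And>n. n \<ge> N \<Longrightarrow> \<bar>(\<integral>t. p n t \<partial>lebesgue_on ?J) - (\<integral>t. s t \<bullet>\<^sub>2 w t \<partial>lebesgue_on ?J)\<bar> < e / 4"
      using LIMSEQ_D[OF pint, of "e / 4"] e by auto
    have "\<bar>(\<integral>t. q n t \<partial>lebesgue_on ?J) - (\<integral>t. v t \<bullet>\<^sub>2 w t \<partial>lebesgue_on ?J)\<bar> < e" if "n \<ge> N" for n
      using 1[of n] 2 N[OF that] e unfolding B by linarith
    with qi show ?thesis by blast
  qed
  show "\<And>n. integrable (lebesgue_on ?J) (q n)" using main[of 1] by simp
  show "(\<lambda>n. \<integral>t. q n t \<partial>lebesgue_on ?J) \<longlonglongrightarrow> (\<integral>t. v t \<bullet>\<^sub>2 w t \<partial>lebesgue_on ?J)"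
    by (rule LIMSEQ_I) (use main in auto)
qed

end

section \<open>The energy inequality\<close>

text \<open>For continuous F the limit holds at a prescribed point, including the right end T; this
  is what the endpoint terms need.\<close>

lemma backward_average_continuous:
  fixes F :: "real \<Rightarrow> real"
  assumes F: "continuous_on {0..T} F" and t: "0 < t" "t \<le> T"
    and h: "\<And>n::nat. 0 < h n" "\<And>n. h n < t" "h \<longlonglongrightarrow> 0"
  shows "(\<lambda>n. integral {t - h n..t} F / h n) \<longlonglongrightarrow> F t"
proof -
  define \<Psi> where "\<Psi> x = integral {0..x} F" for x
  have "(\<Psi> has_real_derivative F t) (at t within {0..T})"
    unfolding \<Psi>_def by (rule integral_has_real_derivative[OF F]) (use t in auto)
  then have lim: "((\<lambda>y. (\<Psi> y - \<Psi> t) / (y - t)) \<longlongrightarrow> F t) (at t within {0..T})"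
    by (simp add: has_field_derivative_iff)
  have "(\<lambda>n. t - h n) \<longlonglongrightarrow> t - 0" by (intro tendsto_intros h(3))
  then have "filterlim (\<lambda>n. t - h n) (at t within {0..T}) sequentially"
    unfolding filterlim_at
  proof (intro conjI always_eventually allI)
    show "t - h n \<in> {0..T}" "t - h n \<noteq> t" for n using h(1)[of n] h(2)[of n] t by auto
  qed simp
  from filterlim_compose[OF lim this]
  have "(\<lambda>n. (\<Psi> (t - h n) - \<Psi> t) / (t - h n - t)) \<longlonglongrightarrow> F t" .
  moreover have "(\<Psi> (t - h n) - \<Psi> t) / (t - h n - t) = integral {t - h n..t} F / h n" for n
  proof -
    have "F integrable_on {0..t}"
      by (rule integrable_continuous_real, rule continuous_on_subset[OF F]) (use t in auto)
    then have "\<Psi> (t - h n) + integral {t - h n..t} F = \<Psi> t"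
      unfolding \<Psi>_def using h(1)[of n] h(2)[of n]
      by (intro Henstock_Kurzweil_Integration.integral_combine) auto
    then have "\<Psi> (t - h n) - \<Psi> t = - integral {t - h n..t} F" by simp
    then show ?thesis by simp
  qed
  ultimately show ?thesis by simp
qed

lemma eventually_within: "\<forall>\<^sub>F s in at t within S. s \<in> S"
  by (simp add: eventually_at_filter)

context bounded_domain
begin

lemma bochner_measurable_subset:
  assumes "bochner_measurable I V N w" "I \<in> sets lebesgue" "A \<in> sets lebesgue" "A \<subseteq> I"
  shows "bochner_measurable A V N w"
proof -
  obtain s :: "nat \<Rightarrow> real \<Rightarrow> 'b \<Rightarrow> real"
    where s: "\<And>n. simple_function (lebesgue_on I) (s n)" "\<And>n. s n ` I \<subseteq> V"
      and lim: "AE t in lebesgue_on I. (\<lambda>n. N (\<lambda>x. s n t x - w t x)) \<longlonglongrightarrow> 0"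
      and wV: "AE t in lebesgue_on I. w t \<in> V"
    using assms(1) unfolding bochner_measurable_def by blast
  have "simple_function (lebesgue_on A) (s n)" for n
    unfolding simple_function_def
  proof (intro conjI ballI)
    show "finite (s n ` space (lebesgue_on A))"
      using s(1)[of n] assms(4) by (auto simp: simple_function_def intro: finite_subset[OF image_mono])
    fix y assume "y \<in> s n ` space (lebesgue_on A)"
    then have "{r \<in> I. s n r = y} \<in> sets (lebesgue_on I)"
      using assms(4) by (intro simple_function_level_set[OF s(1)]) auto
    then have "{r \<in> I. s n r = y} \<in> sets lebesgue" using assms(2) by (simp add: sets_restrict_space_iff)
    then have "{r \<in> I. s n r = y} \<inter> A \<in> sets lebesgue" using assms(3) by (rule sets.Int)
    moreover have "s n -` {y} \<inter> space (lebesgue_on A) = {r \<in> I. s n r = y} \<inter> A" using assms(4) by auto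
    ultimately show "s n -` {y} \<inter> space (lebesgue_on A) \<in> sets (lebesgue_on A)"
      using assms(3) by (simp add: sets_restrict_space_iff)
  qed
  moreover have "s n ` A \<subseteq> V" for n using s(2)[of n] assms(4) by blast
  ultimately show ?thesis
    unfolding bochner_measurable_def
    using AE_lebesgue_on_subset[OF lim assms(2-4)] AE_lebesgue_on_subset[OF wV assms(2-4)] by blast
qed

text \<open>Here equality is exact: v and w have the same weak derivatives, so \<open>SOME\<close>
  selects from the same predicate. It transfers the initial condition to gradients.\<close>

lemma weak_grad_cong_AE:
  assumes "v \<in> L2" "w \<in> L2" "AE x in lebesgue_on \<Omega>. v x = w x"
  shows "weak_grad \<Omega> v = weak_grad \<Omega> w"
proof -
  have "is_weak_deriv \<Omega> [b] v = is_weak_deriv \<Omega> [b] w" if "b \<in> Basis" for b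
  proof
    fix g
    have "v \<bullet>\<^sub>2 iterated_partial [b] \<phi> = w \<bullet>\<^sub>2 iterated_partial [b] \<phi>" if "\<phi> \<in> tests" for \<phi>
      by (rule L2_inner_cong_AE[OF assms(1,2) _ assms(3)])
        (use that \<open>b \<in> Basis\<close> in \<open>auto intro!: tests_L2 test_partial\<close>)
    then show "is_weak_deriv \<Omega> [b] v g = is_weak_deriv \<Omega> [b] w g" by (simp add: is_weak_deriv_iff)
  qed
  then show ?thesis by (simp add: weak_grad_def[abs_def] weak_deriv_def)
qed

text \<open>A rearrangement of nonnegativity of |\<nabla>v - \<nabla>w|^2, with Green's formula
  applied to v and to w against \<Delta>v.\<close>

lemma weak_grad_norm_convex:
  assumes v: "v \<in> H10_space \<Omega>" "v \<in> sobolev_space 2 \<Omega>" and w: "w \<in> H10_space \<Omega>"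
  shows "(L2_norm \<Omega> (weak_grad \<Omega> v))\<^sup>2 - (L2_norm \<Omega> (weak_grad \<Omega> w))\<^sup>2
    \<le> - 2 * ((\<lambda>x. v x - w x) \<bullet>\<^sub>2 weak_laplacian \<Omega> v)"
proof -
  have v1: "v \<in> sobolev_space 1 \<Omega>" and w1: "w \<in> sobolev_space 1 \<Omega>"
    by (rule H10_sobolev[OF v(1)], rule H10_sobolev[OF w])
  have b: "(norm2 (wd [b] v))\<^sup>2 - (norm2 (wd [b] w))\<^sup>2 \<le> 2 * (wd [b] v \<bullet>\<^sub>2 wd [b] v) - 2 * (wd [b] w \<bullet>\<^sub>2 wd [b] v)"
    if b: "b \<in> Basis" for b
  proof -
    note p = wd1_L2[OF v1 b] and p' = wd1_L2[OF w1 b]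
    have "0 \<le> (norm2 (\<lambda>x. 1 * wd [b] v x + (- 1) * wd [b] w x))\<^sup>2" by simp
    also have "\<dots> = (norm2 (wd [b] v))\<^sup>2 - 2 * (wd [b] v \<bullet>\<^sub>2 wd [b] w) + (norm2 (wd [b] w))\<^sup>2"
      unfolding norm2_lincomb[OF p p'] by simp
    finally show ?thesis by (simp add: L2_norm_sq L2_inner_commute[of _ "wd [b] w" "wd [b] v"])
  qed
  have "(L2_norm \<Omega> (weak_grad \<Omega> v))\<^sup>2 - (L2_norm \<Omega> (weak_grad \<Omega> w))\<^sup>2
      = (\<Sum>b\<in>Basis. (norm2 (wd [b] v))\<^sup>2 - (norm2 (wd [b] w))\<^sup>2)"
    by (simp only: weak_grad_norm_sq[OF v1] weak_grad_norm_sq[OF w1] sum_subtractf)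
  also have "\<dots> \<le> (\<Sum>b\<in>Basis. 2 * (wd [b] v \<bullet>\<^sub>2 wd [b] v) - 2 * (wd [b] w \<bullet>\<^sub>2 wd [b] v))"
    by (intro sum_mono b)
  also have "\<dots> = 2 * (\<Sum>b\<in>Basis. wd [b] v \<bullet>\<^sub>2 wd [b] v) - 2 * (\<Sum>b\<in>Basis. wd [b] w \<bullet>\<^sub>2 wd [b] v)"
    by (simp add: sum_subtractf sum_distrib_left)
  also have "\<dots> = - 2 * (v \<bullet>\<^sub>2 weak_laplacian \<Omega> v - w \<bullet>\<^sub>2 weak_laplacian \<Omega> v)"
    by (simp only: Green[OF v] Green[OF w v(2)]) simp
  also have "\<dots> = - 2 * ((\<lambda>x. v x - w x) \<bullet>\<^sub>2 weak_laplacian \<Omega> v)"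
    using sobolev_L2[OF v1] sobolev_L2[OF w1] laplacian_L2[OF v(2)] by (simp add: L2_inner_diff_left)
  finally show ?thesis .
qed

section \<open>The energy balance of a fixed solution on (0, T)\<close>

context
  fixes u ut :: "real \<Rightarrow> 'a \<Rightarrow> real" and T :: real
  assumes cont: "u \<in> continuous_into {0..T} (H10_space \<Omega>) (sobolev_norm 1 \<Omega>)"
    and uH2: "u \<in> bochner_L2 {0<..<T} (sobolev_space 2 \<Omega>) (sobolev_norm 2 \<Omega>)"
    and utL2: "ut \<in> bochner_L2 {0<..<T} L2 norm2"
    and wt: "is_weak_time_deriv \<Omega> T u ut"
    and T: "0 < T"
begin

abbreviation grad_sq where "grad_sq t \<equiv> (L2_norm \<Omega> (weak_grad \<Omega> (u t)))\<^sup>2"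
abbreviation lap where "lap t \<equiv> weak_laplacian \<Omega> (u t)"

lemma u_H10: "t \<in> {0..T} \<Longrightarrow> u t \<in> H10_space \<Omega>"
  using cont by (simp add: continuous_into_def)

lemma u_sobolev: "t \<in> {0..T} \<Longrightarrow> u t \<in> sobolev_space 1 \<Omega>"
  by (intro H10_sobolev u_H10)

lemma u_L2: "t \<in> {0..T} \<Longrightarrow> u t \<in> L2"
  by (intro sobolev_L2[of _ 1] u_sobolev)

lemma wd_diff_tendsto:
  assumes t: "t \<in> {0..T}" and bs: "set bs \<subseteq> Basis" "length bs \<le> 1"
  shows "((\<lambda>s. norm2 (\<lambda>x. wd bs (u s) x - wd bs (u t) x)) \<longlongrightarrow> 0) (at t within {0..T})"
proof (rule tendsto_sandwich[OF _ _ tendsto_const])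
  show "((\<lambda>s. sobolev_norm 1 \<Omega> (\<lambda>x. u s x - u t x)) \<longlongrightarrow> 0) (at t within {0..T})"
    using cont t by (simp add: continuous_into_def)
  show "\<forall>\<^sub>F s in at t within {0..T}. norm2 (\<lambda>x. wd bs (u s) x - wd bs (u t) x) \<le> sobolev_norm 1 \<Omega> (\<lambda>x. u s x - u t x)"
    unfolding eventually_at_filter
  proof (intro always_eventually allI impI)
    fix s assume "s \<in> {0..T}"
    from norm2_wd_diff[OF u_sobolev[OF this] u_sobolev[OF t] bs] norm2_wd_le_sobolev_norm[OF bs]
    show "norm2 (\<lambda>x. wd bs (u s) x - wd bs (u t) x) \<le> sobolev_norm 1 \<Omega> (\<lambda>x. u s x - u t x)" by metis
  qed
qed simp

lemma inner2_u_continuous: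
  assumes y: "y \<in> L2"
  shows "continuous_on {0..T} (\<lambda>t. u t \<bullet>\<^sub>2 y)"
  unfolding continuous_on_def
proof
  fix t assume t: "t \<in> {0..T}"
  \<comment> \<open>The Sobolev norm controls the representative \<open>wd []\<close> and not the
    function itself, hence the detour.\<close>
  have eq: "wd [] (u s) \<bullet>\<^sub>2 y = u s \<bullet>\<^sub>2 y" if "s \<in> {0..T}" for s
    using wd_eq[OF u_L2[OF that] is_weak_deriv_Nil] by (intro L2_inner_cong_AE u_L2 that y) auto
  have Nil: "wd [] (u s) \<in> L2" if "s \<in> {0..T}" for s
    by (rule wd_eq(1)[OF u_L2[OF that] is_weak_deriv_Nil])
  have "((\<lambda>s. wd [] (u s) \<bullet>\<^sub>2 y) \<longlongrightarrow> wd [] (u t) \<bullet>\<^sub>2 y) (at t within {0..T})"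
  proof (rule L2_inner_tendsto[OF _ Nil[OF t] y wd_diff_tendsto[OF t]])
    show "\<forall>\<^sub>F s in at t within {0..T}. wd [] (u s) \<in> L2 \<and> y \<in> L2"
      using eventually_within by eventually_elim (use Nil y in auto)
  qed auto
  then have "((\<lambda>s. wd [] (u s) \<bullet>\<^sub>2 y) \<longlongrightarrow> u t \<bullet>\<^sub>2 y) (at t within {0..T})" by (simp only: eq[OF t])
  then show "((\<lambda>s. u s \<bullet>\<^sub>2 y) \<longlongrightarrow> u t \<bullet>\<^sub>2 y) (at t within {0..T})"
  proof (rule Lim_transform_eventually)
    show "\<forall>\<^sub>F s in at t within {0..T}. wd [] (u s) \<bullet>\<^sub>2 y = u s \<bullet>\<^sub>2 y"
      using eventually_within by eventually_elim (rule eq)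
  qed
qed

lemma grad_sq_continuous: "continuous_on {0..T} (\<lambda>t. grad_sq t)"
  unfolding continuous_on_def
proof
  fix t assume t: "t \<in> {0..T}"
  have "((\<lambda>s. \<Sum>b\<in>Basis. wd [b] (u s) \<bullet>\<^sub>2 wd [b] (u s)) \<longlongrightarrow> (\<Sum>b\<in>Basis. wd [b] (u t) \<bullet>\<^sub>2 wd [b] (u t))) (at t within {0..T})"
  proof (rule tendsto_sum)
    fix b :: 'a assume b: "b \<in> Basis"
    have lim: "((\<lambda>s. norm2 (\<lambda>x. wd [b] (u s) x - wd [b] (u t) x)) \<longlongrightarrow> 0) (at t within {0..T})"
      by (rule wd_diff_tendsto[OF t]) (use b in auto)
    show "((\<lambda>s. wd [b] (u s) \<bullet>\<^sub>2 wd [b] (u s)) \<longlongrightarrow> wd [b] (u t) \<bullet>\<^sub>2 wd [b] (u t)) (at t within {0..T})"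
    proof (rule L2_inner_tendsto[OF _ wd1_L2[OF u_sobolev[OF t] b] wd1_L2[OF u_sobolev[OF t] b] lim lim])
      show "\<forall>\<^sub>F s in at t within {0..T}. wd [b] (u s) \<in> L2 \<and> wd [b] (u s) \<in> L2"
        using eventually_within by eventually_elim (use wd1_L2[OF u_sobolev b] in auto)
    qed
  qed
  then have "((\<lambda>s. \<Sum>b\<in>Basis. wd [b] (u s) \<bullet>\<^sub>2 wd [b] (u s)) \<longlongrightarrow> grad_sq t) (at t within {0..T})"
    by (simp only: weak_grad_norm_sq[OF u_sobolev[OF t]] L2_norm_sq)
  then show "((\<lambda>s. grad_sq s) \<longlongrightarrow> grad_sq t) (at t within {0..T})"
  proof (rule Lim_transform_eventually)
    show "\<forall>\<^sub>F s in at t within {0..T}. (\<Sum>b\<in>Basis. wd [b] (u s) \<bullet>\<^sub>2 wd [b] (u s)) = grad_sq s"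
      using eventually_within
      by eventually_elim (simp only: weak_grad_norm_sq[OF u_sobolev] L2_norm_sq)
  qed
qed

lemma u_AE_sobolev2: "AE t in lebesgue_on {0<..<T}. u t \<in> sobolev_space 2 \<Omega>"
  using uH2 by (simp add: bochner_L2_def bochner_measurable_def)

text \<open>The Laplacian of a simple function is simple as a mere composition, and its continuity
  from H^2 to L^2 preserves the convergence of the approximants.\<close>

lemma lap_measurable: "bochner_measurable {0<..<T} L2 norm2 (\<lambda>t. lap t)"
proof -
  obtain s :: "nat \<Rightarrow> real \<Rightarrow> 'a \<Rightarrow> real"
    where s: "\<And>n. simple_function (lebesgue_on {0<..<T}) (s n)" "\<And>n. s n ` {0<..<T} \<subseteq> sobolev_space 2 \<Omega>"
      and lim: "AE t in lebesgue_on {0<..<T}. (\<lambda>n. sobolev_norm 2 \<Omega> (\<lambda>x. s n t x - u t x)) \<longlonglongrightarrow> 0"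
    using uH2 unfolding bochner_L2_def bochner_measurable_def by blast
  have AEI: "AE t in lebesgue_on {0<..<T}. t \<in> {0<..<T}" by (rule AE_I2) simp
  have "simple_function (lebesgue_on {0<..<T}) (\<lambda>t. weak_laplacian \<Omega> (s n t))" for n
    using simple_function_compose[OF s(1)[of n], of "weak_laplacian \<Omega>"] by (simp add: o_def)
  moreover have "(\<lambda>t. weak_laplacian \<Omega> (s n t)) ` {0<..<T} \<subseteq> L2" for n
    using s(2)[of n] by (auto intro: laplacian_L2)
  moreover have "AE t in lebesgue_on {0<..<T}. (\<lambda>n. norm2 (\<lambda>x. weak_laplacian \<Omega> (s n t) x - lap t x)) \<longlonglongrightarrow> 0"
    using lim u_AE_sobolev2 AEI
  proof eventually_elim
    case (elim t)
    have st: "s n t \<in> sobolev_space 2 \<Omega>" for n using s(2)[of n] elim(3) by blast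
    show ?case
    proof (rule tendsto_sandwich[OF _ _ tendsto_const])
      show "(\<lambda>n. real DIM('a) * sobolev_norm 2 \<Omega> (\<lambda>x. s n t x - u t x)) \<longlonglongrightarrow> 0"
        using tendsto_mult_left[OF elim(1), of "real DIM('a)"] by simp
      show "\<forall>\<^sub>F n in sequentially. norm2 (\<lambda>x. weak_laplacian \<Omega> (s n t) x - lap t x)
          \<le> real DIM('a) * sobolev_norm 2 \<Omega> (\<lambda>x. s n t x - u t x)"
        by (intro always_eventually allI norm2_laplacian_diff_le st elim(2))
    qed simp
  qed
  moreover have "AE t in lebesgue_on {0<..<T}. lap t \<in> L2"
    using u_AE_sobolev2 by eventually_elim (rule laplacian_L2)
  ultimately show ?thesis
    unfolding bochner_measurable_def
    by (intro conjI exI[of _ "\<lambda>n t. weak_laplacian \<Omega> (s n t)"] allI; blast)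
qed

lemma lap_sq_integrable: "integrable (lebesgue_on {0<..<T}) (\<lambda>t. (norm2 (lap t))\<^sup>2)"
proof (rule Bochner_Integration.integrable_bound)
  show "integrable (lebesgue_on {0<..<T}) (\<lambda>t. (real DIM('a))\<^sup>2 * (sobolev_norm 2 \<Omega> (u t))\<^sup>2)"
    using uH2 by (simp add: bochner_L2_def)
  show "(\<lambda>t. (norm2 (lap t))\<^sup>2) \<in> borel_measurable (lebesgue_on {0<..<T})"
    using norm2_measurable[OF _ lap_measurable] by simp
  show "AE t in lebesgue_on {0<..<T}. norm ((norm2 (lap t))\<^sup>2) \<le> norm ((real DIM('a))\<^sup>2 * (sobolev_norm 2 \<Omega> (u t))\<^sup>2)"
    using u_AE_sobolev2
  proof eventually_elim
    case (elim t)
    from power_mono[OF norm2_laplacian_le[OF elim], of 2] show ?case by (simp add: power_mult_distrib)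
  qed
qed

text \<open>Convexity of the gradient norm bounds its backward increment by a term that involves the
  Laplacian at the later time only, so continuity of translations is not needed for \<open>lap\<close>.\<close>

lemma weighted_energy_increment:
  fixes \<alpha> a b :: real
  assumes ab: "0 < a" "a \<le> b" "b < T"
  shows "exp (2 * \<alpha> * b) * grad_sq b - exp (2 * \<alpha> * a) * grad_sq a
      \<le> - 2 * (\<integral>t. exp (2 * \<alpha> * t) * (ut t \<bullet>\<^sub>2 lap t) \<partial>lebesgue_on {a..b})
        + 2 * \<alpha> * (\<integral>t. exp (2 * \<alpha> * t) * grad_sq t \<partial>lebesgue_on {a..b})"
    and "integrable (lebesgue_on {a..b}) (\<lambda>t. exp (2 * \<alpha> * t) * (ut t \<bullet>\<^sub>2 lap t))"
proof -
  let ?I = "{0<..<T}" and ?J = "{a..b}"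
  define e where "e t = exp (2 * \<alpha> * t)" for t
  have e0: "0 < e t" for t by (simp add: e_def)
  have ec: "continuous_on S e" for S unfolding e_def by (intro continuous_intros)
  have I: "?I \<in> sets lebesgue" and J: "?J \<in> sets lebesgue" "?J \<subseteq> ?I" using ab by auto
  define W where "W t = (\<lambda>x. e t * lap t x)" for t
  \<comment> \<open>Strictly below a for every n, so that t - h n stays positive for all t in
    [a, b].\<close>
  define h where "h n = a / (real n + 2)" for n
  have h: "0 < h n" "h n < a" for n
    using ab divide_strict_left_mono[of 1 "real n + 2" a] by (auto simp: h_def)
  have h0: "h \<longlonglongrightarrow> 0" unfolding h_def by real_asymp
  have lapL: "AE t in lebesgue_on ?I. lap t \<in> L2" by (rule bochner_measurable_L2[OF lap_measurable])
  have WL: "AE t in lebesgue_on ?I. W t \<in> L2"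
    using lapL unfolding W_def by eventually_elim (rule L2_scale)
  have em: "e \<in> borel_measurable (lebesgue_on S)" if "S \<in> sets lebesgue" for S
    by (rule continuous_imp_measurable_on_sets_lebesgue[OF ec that])
  have Wm: "(\<lambda>t. y \<bullet>\<^sub>2 W t) \<in> borel_measurable (lebesgue_on ?I)" if "y \<in> L2" for y
    using inner2_const_measurable[OF I lap_measurable that] em[OF I] unfolding W_def by simp
  have Wi: "integrable (lebesgue_on ?I) (\<lambda>t. (norm2 (W t))\<^sup>2)"
  proof (rule Bochner_Integration.integrable_bound)
    show "integrable (lebesgue_on ?I) (\<lambda>t. (exp (\<bar>2 * \<alpha>\<bar> * T))\<^sup>2 * (norm2 (lap t))\<^sup>2)"
      using lap_sq_integrable by simp
    have eq: "(norm2 (W t))\<^sup>2 = (e t)\<^sup>2 * (norm2 (lap t))\<^sup>2" for t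
      unfolding W_def L2_norm_scale by (simp add: power_mult_distrib)
    show "(\<lambda>t. (norm2 (W t))\<^sup>2) \<in> borel_measurable (lebesgue_on ?I)"
      unfolding eq using norm2_measurable[OF I lap_measurable] em[OF I] by measurable
    show "AE t in lebesgue_on ?I. norm ((norm2 (W t))\<^sup>2) \<le> norm ((exp (\<bar>2 * \<alpha>\<bar> * T))\<^sup>2 * (norm2 (lap t))\<^sup>2)"
    proof (rule AE_I2)
      fix t assume "t \<in> space (lebesgue_on ?I)"
      then have t: "0 < t" "t < T" by auto
      have "2 * \<alpha> * t \<le> \<bar>2 * \<alpha>\<bar> * t" using t by (intro mult_right_mono) auto
      also have "\<dots> \<le> \<bar>2 * \<alpha>\<bar> * T" using t by (intro mult_left_mono) auto
      finally have "e t \<le> exp (\<bar>2 * \<alpha>\<bar> * T)" by (simp add: e_def)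
      then have "(e t)\<^sup>2 \<le> (exp (\<bar>2 * \<alpha>\<bar> * T))\<^sup>2" using e0[of t] by (intro power_mono) auto
      then show "norm ((norm2 (W t))\<^sup>2) \<le> norm ((exp (\<bar>2 * \<alpha>\<bar> * T))\<^sup>2 * (norm2 (lap t))\<^sup>2)"
        unfolding eq by (simp add: mult_right_mono)
    qed
  qed
  define d where "d n t = (\<lambda>x. u t x - u (t - h n) x)" for n t
  define q where "q n t = (d n t \<bullet>\<^sub>2 W t) / h n" for n t
  have dL: "d n t \<in> L2" if "t \<in> ?J" for n t
    unfolding d_def by (intro L2_diff u_L2) (use that ab h[of n] in auto)
  \<comment> \<open>The roles in \<open>inner2_measurable\<close> are divided: \<open>lap\<close> is
    Bochner measurable, the time difference only weakly continuous.\<close>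
  have qm: "q n \<in> borel_measurable (lebesgue_on ?J)" for n
  proof -
    have lapJ: "bochner_measurable ?J L2 norm2 (\<lambda>t. lap t)"
      by (rule bochner_measurable_subset[OF lap_measurable I J])
    have "(\<lambda>t. lap t \<bullet>\<^sub>2 d n t) \<in> borel_measurable (lebesgue_on ?J)"
    proof (rule inner2_measurable[OF J(1) lapJ])
      show "AE t in lebesgue_on ?J. d n t \<in> L2" by (rule AE_I2) (use dL in simp)
      fix y assume y: "y \<in> L2"
      have "continuous_on ?J (\<lambda>t. u t \<bullet>\<^sub>2 y - u (t - h n) \<bullet>\<^sub>2 y)"
        by (intro continuous_intros continuous_on_compose2[OF inner2_u_continuous[OF y]])
          (use ab h[of n] in auto)
      moreover have "y \<bullet>\<^sub>2 d n t = u t \<bullet>\<^sub>2 y - u (t - h n) \<bullet>\<^sub>2 y" if "t \<in> ?J" for t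
        unfolding d_def using that ab h[of n] y
        by (subst L2_inner_commute) (intro L2_inner_diff_left u_L2, auto)
      ultimately have "continuous_on ?J (\<lambda>t. y \<bullet>\<^sub>2 d n t)"
        by (simp cong: continuous_on_cong_simp)
      then show "(\<lambda>t. y \<bullet>\<^sub>2 d n t) \<in> borel_measurable (lebesgue_on ?J)"
        by (rule continuous_imp_measurable_on_sets_lebesgue[OF _ J(1)])
    qed
    moreover have "q n t = e t * (lap t \<bullet>\<^sub>2 d n t) / h n" for t
      unfolding q_def W_def by (simp add: L2_inner_commute[of _ "d n t"])
    ultimately show ?thesis unfolding q_def[abs_def] using em[OF J(1)]
      by (simp add: W_def L2_inner_commute[of _ "d n _"])
  qed
  have q: "AE t in lebesgue_on ?J. q n t = (\<integral>r. ut r \<bullet>\<^sub>2 W t \<partial>lebesgue_on {t - h n..t}) / h n" for n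
  proof -
    have "AE t in lebesgue_on ?J. t \<in> ?J" by (rule AE_I2) simp
    with AE_lebesgue_on_subset[OF WL I J] show ?thesis
    proof eventually_elim
      case (elim t)
      have "d n t \<bullet>\<^sub>2 W t = u t \<bullet>\<^sub>2 W t - u (t - h n) \<bullet>\<^sub>2 W t"
        unfolding d_def by (intro L2_inner_diff_left u_L2 elim(1)) (use elim(2) ab h[of n] in auto)
      also have "\<dots> = (\<integral>r. ut r \<bullet>\<^sub>2 W t \<partial>lebesgue_on {t - h n..t})"
        by (rule inner2_weak_time_deriv(2)[OF T wt utL2 elim(1) inner2_u_continuous[OF elim(1)]])
          (use elim(2) ab h[of n] in auto)
      finally show ?case by (simp add: q_def)
    qed
  qed
  note avg = time_average_limit[OF utL2 WL Wm Wi ab h h0 qm q]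
  have eW: "ut t \<bullet>\<^sub>2 W t = e t * (ut t \<bullet>\<^sub>2 lap t)" for t by (simp add: W_def)
  show "integrable (lebesgue_on ?J) (\<lambda>t. exp (2 * \<alpha> * t) * (ut t \<bullet>\<^sub>2 lap t))"
    using avg(2) by (simp add: W_def e_def)
  define G where "G t = e t * grad_sq t" for t
  have Gc: "continuous_on {0..T} G" unfolding G_def by (intro continuous_intros ec grad_sq_continuous)
  \<comment> \<open>The relative growth rate of the weight over a step, whose limit is the
    derivative of the exponential at 0.\<close>
  define c where "c n = (exp (2 * \<alpha> * h n) - 1) / h n" for n
  have clim: "c \<longlonglongrightarrow> 2 * \<alpha>"
  proof -
    have "((\<lambda>x. exp (2 * \<alpha> * x)) has_real_derivative 2 * \<alpha>) (at 0)"
      by (auto intro!: derivative_eq_intros)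
    then have "(\<lambda>x. (exp (2 * \<alpha> * x) - 1) / x) \<midarrow>0\<rightarrow> 2 * \<alpha>" by (simp add: DERIV_def)
    moreover have "filterlim h (at 0) sequentially"
      unfolding filterlim_at using h0 h(1) by (auto intro!: always_eventually simp: less_imp_neq[symmetric])
    ultimately show ?thesis unfolding c_def by (rule filterlim_compose)
  qed
  have Gd: "continuous_on ?J (\<lambda>t. G (t - h n))" for n
    by (intro continuous_on_compose2[OF Gc] continuous_intros) (use ab h[of n] in auto)
  have GJ: "continuous_on ?J G" by (rule continuous_on_subset[OF Gc]) (use ab in auto)
  have Gdi: "integrable (lebesgue_on ?J) (\<lambda>t. G (t - h n))" for n by (rule continuous_imp_integrable_real[OF Gd])
  have GDi: "integrable (lebesgue_on ?J) (\<lambda>t. G t - G (t - h n))" for n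
    by (intro continuous_imp_integrable_real continuous_intros GJ Gd)
  have pointwise: "AE t in lebesgue_on ?J. (G t - G (t - h n)) / h n \<le> - 2 * q n t + c n * G (t - h n)" for n
  proof -
    have "AE t in lebesgue_on ?J. t \<in> ?J" by (rule AE_I2) simp
    with AE_lebesgue_on_subset[OF u_AE_sobolev2 I J] show ?thesis
    proof eventually_elim
      case (elim t)
      have t: "t \<in> {0..T}" "t - h n \<in> {0..T}" using elim(2) ab h[of n] by auto
      have "grad_sq t - grad_sq (t - h n) \<le> - 2 * (d n t \<bullet>\<^sub>2 lap t)"
        unfolding d_def by (rule weak_grad_norm_convex[OF u_H10[OF t(1)] elim(1) u_H10[OF t(2)]])
      then have "e t * (grad_sq t - grad_sq (t - h n)) \<le> e t * (- 2 * (d n t \<bullet>\<^sub>2 lap t))"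
        using e0[of t] by (intro mult_left_mono) auto
      also have "\<dots> = - 2 * (h n * q n t)" using h(1)[of n] by (simp add: q_def W_def)
      finally have 1: "e t * (grad_sq t - grad_sq (t - h n)) \<le> - 2 * (h n * q n t)" .
      have "e t = e (t - h n) * exp (2 * \<alpha> * h n)"
        unfolding e_def exp_add[symmetric] by (simp add: algebra_simps)
      then have "(e t - e (t - h n)) * grad_sq (t - h n) = (exp (2 * \<alpha> * h n) - 1) * G (t - h n)"
        by (simp add: G_def algebra_simps)
      also have "\<dots> = h n * (c n * G (t - h n))" using h(1)[of n] by (simp add: c_def)
      finally have 2: "(e t - e (t - h n)) * grad_sq (t - h n) = h n * (c n * G (t - h n))" .
      \<comment> \<open>Discrete product rule: the increment of the energy is weighted at the later
        time, that of the weight multiplies the earlier energy.\<close>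
      have "G t - G (t - h n) = e t * (grad_sq t - grad_sq (t - h n)) + (e t - e (t - h n)) * grad_sq (t - h n)"
        by (simp add: G_def algebra_simps)
      also have "\<dots> \<le> h n * (- 2 * q n t + c n * G (t - h n))"
        unfolding 2 using 1 by (simp add: algebra_simps)
      finally show ?case using h(1)[of n] by (simp add: field_simps)
    qed
  qed
  have le: "(integral {b - h n..b} G - integral {a - h n..a} G) / h n
      \<le> - 2 * (\<integral>t. q n t \<partial>lebesgue_on ?J) + c n * integral {a - h n..b - h n} G" for n
  proof -
    have "(integral {b - h n..b} G - integral {a - h n..a} G) / h n = (\<integral>t. (G t - G (t - h n)) / h n \<partial>lebesgue_on ?J)"
      using integral_backward_difference[OF Gc, of "h n" a b] h[of n] ab
      by (simp add: lebesgue_integral_eq_integral[OF GDi J(1)])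
    also have "\<dots> \<le> (\<integral>t. - 2 * q n t + c n * G (t - h n) \<partial>lebesgue_on ?J)"
      by (rule integral_mono_AE[OF _ _ pointwise]) (use GDi Gdi avg(1) in auto)
    also have "\<dots> = - 2 * (\<integral>t. q n t \<partial>lebesgue_on ?J) + c n * (\<integral>t. G (t - h n) \<partial>lebesgue_on ?J)"
      using avg(1)[of n] Gdi[of n] by simp
    also have "(\<integral>t. G (t - h n) \<partial>lebesgue_on ?J) = integral {a - h n..b - h n} G"
      using integral_shift_real_ivl[of "a - h n" "- h n" "b - h n" G]
      by (simp add: lebesgue_integral_eq_integral[OF Gdi J(1)])
    finally show ?thesis .
  qed
  have "(\<lambda>n. (integral {b - h n..b} G - integral {a - h n..a} G) / h n) \<longlonglongrightarrow> G b - G a"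
    unfolding diff_divide_distrib
    by (intro tendsto_diff backward_average_continuous[OF Gc] h h0)
      (use ab h(2) in \<open>auto intro: less_le_trans\<close>)
  moreover have "(\<lambda>n. - 2 * (\<integral>t. q n t \<partial>lebesgue_on ?J) + c n * integral {a - h n..b - h n} G)
      \<longlonglongrightarrow> - 2 * (\<integral>t. ut t \<bullet>\<^sub>2 W t \<partial>lebesgue_on ?J) + 2 * \<alpha> * integral ?J G"
  proof (intro tendsto_add tendsto_mult clim avg(3) tendsto_const)
    \<comment> \<open>The interval of integration moves with n; a continuous primitive reduces its
      limit to two point values.\<close>
    define \<Psi> where "\<Psi> x = integral {0..x} G" for x
    have Gi: "G integrable_on {0..T}" by (rule integrable_continuous_real[OF Gc])
    have \<Psi>c: "continuous_on {0..T} \<Psi>" unfolding \<Psi>_def by (rule indefinite_integral_continuous_1[OF Gi])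
    have \<Psi>: "integral {x..y} G = \<Psi> y - \<Psi> x" if "0 \<le> x" "x \<le> y" "y \<le> T" for x y
      using Henstock_Kurzweil_Integration.integral_combine[of 0 x y G] integrable_subinterval_real[OF Gi, of 0 y] that
      by (simp add: \<Psi>_def)
    have \<Psi>lim: "(\<lambda>n. \<Psi> (x - h n)) \<longlonglongrightarrow> \<Psi> x" if "a \<le> x" "x \<le> T" for x
    proof (rule continuous_on_tendsto_compose[OF \<Psi>c])
      show "(\<lambda>n. x - h n) \<longlonglongrightarrow> x" using tendsto_diff[OF tendsto_const h0, of x] by simp
      show "x \<in> {0..T}" using that ab by auto
      show "\<forall>\<^sub>F n in sequentially. x - h n \<in> {0..T}"
      proof (intro always_eventually allI)
        show "x - h n \<in> {0..T}" for n using that h[of n] by simp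
      qed
    qed
    have "(\<lambda>n. \<Psi> (b - h n) - \<Psi> (a - h n)) \<longlonglongrightarrow> \<Psi> b - \<Psi> a"
      by (intro tendsto_diff \<Psi>lim) (use ab in auto)
    moreover have "integral {a - h n..b - h n} G = \<Psi> (b - h n) - \<Psi> (a - h n)" for n
      by (rule \<Psi>) (use ab h[of n] in auto)
    moreover have "integral ?J G = \<Psi> b - \<Psi> a" by (rule \<Psi>) (use ab in auto)
    ultimately show "(\<lambda>n. integral {a - h n..b - h n} G) \<longlonglongrightarrow> integral ?J G" by simp
  qed
  ultimately have "G b - G a \<le> - 2 * (\<integral>t. ut t \<bullet>\<^sub>2 W t \<partial>lebesgue_on ?J) + 2 * \<alpha> * integral ?J G"
    by (rule LIMSEQ_le) (use le in blast)
  then show "exp (2 * \<alpha> * b) * grad_sq b - exp (2 * \<alpha> * a) * grad_sq a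
      \<le> - 2 * (\<integral>t. exp (2 * \<alpha> * t) * (ut t \<bullet>\<^sub>2 lap t) \<partial>lebesgue_on {a..b})
        + 2 * \<alpha> * (\<integral>t. exp (2 * \<alpha> * t) * grad_sq t \<partial>lebesgue_on {a..b})"
    unfolding lebesgue_integral_eq_integral[OF continuous_imp_integrable_real[OF GJ] J(1), symmetric] eW
    by (simp add: G_def[abs_def] e_def[abs_def])
qed

end

end

section \<open>Inserting the equation\<close>

lemma integrable_continuous_mult:
  fixes c g :: "real \<Rightarrow> real"
  assumes c: "continuous_on {0..T} c" and g: "integrable (lebesgue_on {0<..<T}) g"
  shows "integrable (lebesgue_on {0<..<T}) (\<lambda>t. c t * g t)"
proof -
  have "bounded (c ` {0..T})"
    by (intro compact_imp_bounded compact_continuous_image c) simp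
  then obtain C where C: "\<forall>t\<in>{0..T}. \<bar>c t\<bar> \<le> C"
    by (auto simp: bounded_iff)
  have cm: "c \<in> borel_measurable (lebesgue_on {0<..<T})"
    by (rule continuous_imp_measurable_on_sets_lebesgue[OF continuous_on_subset[OF c]]) auto
  show ?thesis
  proof (rule Bochner_Integration.integrable_bound[of _ "\<lambda>t. C * \<bar>g t\<bar>"])
    show "integrable (lebesgue_on {0<..<T}) (\<lambda>t. C * \<bar>g t\<bar>)" using g by simp
    show "(\<lambda>t. c t * g t) \<in> borel_measurable (lebesgue_on {0<..<T})"
      using cm borel_measurable_integrable[OF g] by measurable
    show "AE t in lebesgue_on {0<..<T}. norm (c t * g t) \<le> norm (C * \<bar>g t\<bar>)"
    proof (rule AE_I2)
      fix t assume "t \<in> space (lebesgue_on {0<..<T})"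
      then have "t \<in> {0..T}" by auto
      then have "\<bar>c t\<bar> \<le> C" using C by blast
      then have "\<bar>c t\<bar> \<le> \<bar>C\<bar>" by simp
      then show "norm (c t * g t) \<le> norm (C * \<bar>g t\<bar>)" by (simp add: abs_mult mult_right_mono)
    qed
  qed
qed

context bounded_domain
begin

text \<open>The increment inequality is available on [a, b] with a > 0, because the weak time
  derivative is tested inside (0, T) only. The equation is inserted there, and a tends to 0 by
  continuity of the energy and of the integrals.\<close>

lemma weighted_energy_estimate:
  fixes u ut f :: "real \<Rightarrow> 'a \<Rightarrow> real" and T \<alpha> b F l :: real
  assumes cont: "u \<in> continuous_into {0..T} (H10_space \<Omega>) (sobolev_norm 1 \<Omega>)"
    and uH2: "u \<in> bochner_L2 {0<..<T} (sobolev_space 2 \<Omega>) (sobolev_norm 2 \<Omega>)"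
    and utL2: "ut \<in> bochner_L2 {0<..<T} L2 norm2"
    and wt: "is_weak_time_deriv \<Omega> T u ut"
    and pde: "AE t in lebesgue_on {0<..<T}. AE x in lebesgue_on \<Omega>.
      ut t x - (1 + (L2_norm \<Omega> (weak_grad \<Omega> (u t)))\<^sup>2) * weak_laplacian \<Omega> (u t) x = f t x"
    and f: "AE t in lebesgue_on {0<..<T}. f t \<in> L2 \<and> norm2 (f t) \<le> F"
    and l: "smallest_dirichlet_eigenvalue \<Omega> l" and \<alpha>: "0 < \<alpha>" "\<alpha> < l / 2"
    and b: "0 < b" "b < T"
  defines "k \<equiv> \<lambda>s. exp (2 * \<alpha> * s) * (norm2 (weak_laplacian \<Omega> (u s)))\<^sup>2"
    and "k' \<equiv> \<lambda>s. exp (2 * \<alpha> * s) * (L2_norm \<Omega> (weak_grad \<Omega> (u s)))\<^sup>2 * (norm2 (weak_laplacian \<Omega> (u s)))\<^sup>2"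
  shows "k absolutely_integrable_on {0..b}" "k' absolutely_integrable_on {0..b}"
    and "exp (2 * \<alpha> * b) * (L2_norm \<Omega> (weak_grad \<Omega> (u b)))\<^sup>2
        + (1 - 2 * \<alpha> / l) * integral {0..b} k + 2 * integral {0..b} k'
      \<le> (L2_norm \<Omega> (weak_grad \<Omega> (u 0)))\<^sup>2 + F\<^sup>2 / (2 * \<alpha>) * (exp (2 * \<alpha> * b) - 1)"
proof -
  have T: "0 < T" using b by simp
  let ?I = "{0<..<T}"
  define E where "E t = (L2_norm \<Omega> (weak_grad \<Omega> (u t)))\<^sup>2" for t
  define D where "D t = (norm2 (weak_laplacian \<Omega> (u t)))\<^sup>2" for t
  define e where "e t = exp (2 * \<alpha> * t)" for t
  define \<beta> where "\<beta> = 1 - 2 * \<alpha> / l"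
  have l0: "0 < l" using \<alpha> by simp
  have k: "k = (\<lambda>t. e t * D t)" and k': "k' = (\<lambda>t. (e t * E t) * D t)"
    by (simp_all add: k_def k'_def e_def D_def E_def)
  have e0: "0 < e t" for t by (simp add: e_def)
  have ec: "continuous_on S e" for S unfolding e_def by (intro continuous_intros)
  have Ec: "continuous_on {0..T} E"
    unfolding E_def by (rule grad_sq_continuous[OF cont uH2 utL2 wt T])
  have Di: "integrable (lebesgue_on ?I) D"
    unfolding D_def by (rule lap_sq_integrable[OF cont uH2 utL2 wt T])
  have ki: "integrable (lebesgue_on ?I) k" unfolding k by (rule integrable_continuous_mult[OF ec Di])
  have ki': "integrable (lebesgue_on ?I) k'"
    unfolding k' by (rule integrable_continuous_mult[OF continuous_on_mult[OF ec Ec] Di])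
  note kT = integrable_on_Icc_of_Ioo[OF ki] and kT' = integrable_on_Icc_of_Ioo[OF ki']
  have sub: "g integrable_on {c..b}" if "g integrable_on {0..T}" "0 \<le> c" for g :: "real \<Rightarrow> real" and c
    by (rule integrable_subinterval_real[OF that(1)]) (use that b in auto)
  have nonneg: "0 \<le> k t" "0 \<le> k' t" for t by (simp_all add: k_def k'_def)
  \<comment> \<open>Nonnegativity upgrades gauge integrability, which later permits reading
    \<open>integral\<close> as a Lebesgue integral.\<close>
  show "k absolutely_integrable_on {0..b}" "k' absolutely_integrable_on {0..b}"
    using sub[OF kT] sub[OF kT'] nonneg by (simp_all add: absolutely_integrable_on_iff_nonneg)
  have step: "e b * E b \<le> e a * E a + F\<^sup>2 / (2 * \<alpha>) * (e b - e a) - \<beta> * integral {a..b} k - 2 * integral {a..b} k'"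
    if a: "0 < a" "a \<le> b" for a
  proof -
    let ?J = "{a..b}"
    have I: "?I \<in> sets lebesgue" and J: "?J \<in> sets lebesgue" "?J \<subseteq> ?I" using a b by auto
    have kJ: "integrable (lebesgue_on ?J) k" and kJ': "integrable (lebesgue_on ?J) k'"
      by (rule integrable_lebesgue_on_subset[OF ki I J], rule integrable_lebesgue_on_subset[OF ki' I J])
    have eJ: "integrable (lebesgue_on ?J) e" by (rule continuous_imp_integrable_real[OF ec])
    have eEJ: "integrable (lebesgue_on ?J) (\<lambda>t. e t * E t)"
      by (intro continuous_imp_integrable_real continuous_intros ec continuous_on_subset[OF Ec]) (use a b in auto)
    note inc = weighted_energy_increment[OF cont uH2 utL2 wt T a b(2), of \<alpha>, folded e_def E_def]
    have "e b * E b - e a * E a \<le> - 2 * (\<integral>t. e t * (ut t \<bullet>\<^sub>2 weak_laplacian \<Omega> (u t)) \<partial>lebesgue_on ?J)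
        + 2 * \<alpha> * (\<integral>t. e t * E t \<partial>lebesgue_on ?J)"
      by (rule inc(1))
    also have "\<dots> = (\<integral>t. - 2 * (e t * (ut t \<bullet>\<^sub>2 weak_laplacian \<Omega> (u t))) + 2 * \<alpha> * (e t * E t) \<partial>lebesgue_on ?J)"
      using inc(2) eEJ by simp
    also have "\<dots> \<le> (\<integral>t. F\<^sup>2 * e t - \<beta> * k t - 2 * k' t \<partial>lebesgue_on ?J)"
    proof (rule integral_mono_AE)
      show "integrable (lebesgue_on ?J) (\<lambda>t. - 2 * (e t * (ut t \<bullet>\<^sub>2 weak_laplacian \<Omega> (u t))) + 2 * \<alpha> * (e t * E t))"
        using inc(2) eEJ by simp
      show "integrable (lebesgue_on ?J) (\<lambda>t. F\<^sup>2 * e t - \<beta> * k t - 2 * k' t)"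
        using eJ kJ kJ' by simp
      have "AE t in lebesgue_on ?J. t \<in> ?J" by (rule AE_I2) simp
      moreover have "AE t in lebesgue_on ?I. ut t \<in> L2"
        using utL2 by (simp add: bochner_L2_def bochner_measurable_def)
      note AE_lebesgue_on_subset[OF this I J]
      moreover note AE_lebesgue_on_subset[OF u_AE_sobolev2[OF cont uH2 utL2 wt T] I J]
        AE_lebesgue_on_subset[OF pde I J] AE_lebesgue_on_subset[OF f I J]
      ultimately show "AE t in lebesgue_on ?J. - 2 * (e t * (ut t \<bullet>\<^sub>2 weak_laplacian \<Omega> (u t))) + 2 * \<alpha> * (e t * E t)
          \<le> F\<^sup>2 * e t - \<beta> * k t - 2 * k' t"
      proof eventually_elim
        case (elim t)
        let ?w = "weak_laplacian \<Omega> (u t)"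
        have w: "?w \<in> L2" by (rule laplacian_L2[OF elim(3)])
        have uH: "u t \<in> H10_space \<Omega>"
          by (rule u_H10[OF cont uH2 utL2 wt T]) (use elim(1) a b in auto)
        have "ut t \<bullet>\<^sub>2 ?w = (\<lambda>x. (1 + E t) * ?w x + f t x) \<bullet>\<^sub>2 ?w"
        proof (rule L2_inner_cong_AE[OF elim(2) _ w])
          show "(\<lambda>x. (1 + E t) * ?w x + f t x) \<in> L2" using elim(5) by (intro L2_add L2_scale w) simp
          show "AE x in lebesgue_on \<Omega>. ut t x = (1 + E t) * ?w x + f t x"
            using elim(4) by eventually_elim (simp add: E_def)
        qed
        also have "\<dots> = (1 + E t) * D t + f t \<bullet>\<^sub>2 ?w"
          using elim(5) by (simp add: L2_inner_add_left L2_scale w D_def L2_norm_sq)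
        finally have ut: "ut t \<bullet>\<^sub>2 ?w = (1 + E t) * D t + f t \<bullet>\<^sub>2 ?w" .
        \<comment> \<open>Young's inequality with constant 1; doubled, it uses up exactly one copy
          of D.\<close>
        have "\<bar>f t \<bullet>\<^sub>2 ?w\<bar> \<le> 1 / 2 * (norm2 (f t))\<^sup>2 + D t / (2 * 1)"
          unfolding D_def by (rule inner2_Young) (use elim(5) w in auto)
        moreover have "(norm2 (f t))\<^sup>2 \<le> F\<^sup>2" using elim(5) by (intro power_mono) auto
        ultimately have fw: "- 2 * (f t \<bullet>\<^sub>2 ?w) \<le> F\<^sup>2 + D t" by linarith
        have "l * E t \<le> D t"
          unfolding E_def D_def by (rule eigenvalue_laplacian_bound[OF l l0 uH elim(3)])
        \<comment> \<open>The fraction 2\<alpha>/l of D pays for the derivative of the weight; it is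
          below 1 by the choice of \<alpha>.\<close>
        then have "2 * \<alpha> / l * (l * E t) \<le> 2 * \<alpha> / l * D t"
          using \<alpha> l0 by (intro mult_left_mono) auto
        then have ED: "2 * \<alpha> * E t \<le> (1 - \<beta>) * D t" using l0 by (simp add: \<beta>_def)
        have "- 2 * (ut t \<bullet>\<^sub>2 ?w) + 2 * \<alpha> * E t \<le> F\<^sup>2 - \<beta> * D t - 2 * (E t * D t)"
          unfolding ut using fw ED by (simp add: algebra_simps)
        then have "e t * (- 2 * (ut t \<bullet>\<^sub>2 ?w) + 2 * \<alpha> * E t) \<le> e t * (F\<^sup>2 - \<beta> * D t - 2 * (E t * D t))"
          using e0[of t] by (intro mult_left_mono) auto
        then show ?case unfolding k k' by (simp add: algebra_simps)
      qed
    qed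
    also have "\<dots> = F\<^sup>2 * integral ?J e - \<beta> * integral ?J k - 2 * integral ?J k'"
      using eJ kJ kJ' by (simp add: lebesgue_integral_eq_integral[OF eJ J(1)]
          lebesgue_integral_eq_integral[OF kJ J(1)] lebesgue_integral_eq_integral[OF kJ' J(1)])
    also have "integral ?J e = e b / (2 * \<alpha>) - e a / (2 * \<alpha>)"
    proof (rule integral_unique, rule fundamental_theorem_of_calculus[OF a(2)])
      fix t
      have "((\<lambda>t. e t / (2 * \<alpha>)) has_real_derivative e t) (at t within ?J)"
        unfolding e_def using \<alpha>(1) by (auto intro!: derivative_eq_intros)
      then show "((\<lambda>t. e t / (2 * \<alpha>)) has_vector_derivative e t) (at t within ?J)"
        by (simp add: has_real_derivative_iff_has_vector_derivative)
    qed
    finally show ?thesis by (simp add: diff_divide_distrib right_diff_distrib)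
  qed
  \<comment> \<open>The right-hand side as a function of the left endpoint, continuous down to
    0.\<close>
  define \<Theta> where "\<Theta> a = e a * E a + F\<^sup>2 / (2 * \<alpha>) * (e b - e a) - \<beta> * integral {a..b} k - 2 * integral {a..b} k'" for a
  have \<Theta>c: "continuous_on {0..b} \<Theta>"
    unfolding \<Theta>_def
    by (intro continuous_intros ec continuous_on_subset[OF Ec]
        indefinite_integral_continuous_1' sub[OF kT] sub[OF kT']) (use b in auto)
  have "(\<lambda>n. \<Theta> (b / (real n + 1))) \<longlonglongrightarrow> \<Theta> 0"
  proof (rule continuous_on_tendsto_compose[OF \<Theta>c])
    show "(\<lambda>n. b / (real n + 1)) \<longlonglongrightarrow> 0" by real_asymp
    show "\<forall>\<^sub>F n in sequentially. b / (real n + 1) \<in> {0..b}"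
      using b divide_left_mono[of 1 "real n + 1" b for n] by (intro always_eventually allI) simp
  qed (use b in simp)
  then have "e b * E b \<le> \<Theta> 0"
  proof (rule tendsto_lowerbound)
    show "\<forall>\<^sub>F n in sequentially. e b * E b \<le> \<Theta> (b / (real n + 1))"
      unfolding \<Theta>_def
    proof (intro always_eventually allI step)
      show "0 < b / (real n + 1)" "b / (real n + 1) \<le> b" for n
        using b divide_left_mono[of 1 "real n + 1" b] by auto
    qed
  qed simp
  then show "exp (2 * \<alpha> * b) * (L2_norm \<Omega> (weak_grad \<Omega> (u b)))\<^sup>2
        + (1 - 2 * \<alpha> / l) * integral {0..b} k + 2 * integral {0..b} k'
      \<le> (L2_norm \<Omega> (weak_grad \<Omega> (u 0)))\<^sup>2 + F\<^sup>2 / (2 * \<alpha>) * (exp (2 * \<alpha> * b) - 1)"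
    by (simp add: \<Theta>_def \<beta>_def e_def E_def)
qed

end

theorem lemma2p2:
  fixes \<Omega> :: "'a::euclidean_space set"
    and u\<^sub>0 :: "'a \<Rightarrow> real"
    and f u :: "real \<Rightarrow> 'a \<Rightarrow> real"
    and lambda1 \<alpha> \<beta> t F :: real
  assumes dim: "DIM('a) = 2 \<or> DIM('a) = 3"
    and domain: "convex_polytopal_domain \<Omega>"
    and eigenvalue: "smallest_dirichlet_eigenvalue \<Omega> lambda1"
    and u0: "u\<^sub>0 \<in> H10_space \<Omega>"
    and f: "f \<in> bochner_Linf {0<..} (L2_space \<Omega>) (L2_norm \<Omega>)"
    and F: "F = real_of_ereal (bochner_Linf_norm {0<..} (L2_norm \<Omega>) f)"
    and sol: "strong_solution \<Omega> f u\<^sub>0 u"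
    and alpha: "0 < \<alpha>" "\<alpha> < lambda1 / 2"
    and beta: "\<beta> = 1 - 2 * \<alpha> / lambda1"
    and t: "0 < t"
  shows "0 < \<beta> \<and>
    (L2_norm \<Omega> (weak_grad \<Omega> (u t)))\<^sup>2
      + \<beta> * exp (- 2 * \<alpha> * t) *
          (LINT s:{0..t}|lebesgue. exp (2 * \<alpha> * s) * (L2_norm \<Omega> (weak_laplacian \<Omega> (u s)))\<^sup>2)
      + 2 * exp (- 2 * \<alpha> * t) *
          (LINT s:{0..t}|lebesgue. exp (2 * \<alpha> * s) * (L2_norm \<Omega> (weak_grad \<Omega> (u s)))\<^sup>2
             * (L2_norm \<Omega> (weak_laplacian \<Omega> (u s)))\<^sup>2)
      \<le> exp (- 2 * \<alpha> * t) * (L2_norm \<Omega> (weak_grad \<Omega> u\<^sub>0))\<^sup>2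
          + 1 / (2 * \<alpha>) * F\<^sup>2 * (1 - exp (- 2 * \<alpha> * t)) \<and>
    exp (- 2 * \<alpha> * t) * (L2_norm \<Omega> (weak_grad \<Omega> u\<^sub>0))\<^sup>2
          + 1 / (2 * \<alpha>) * F\<^sup>2 * (1 - exp (- 2 * \<alpha> * t))
      \<le> (L2_norm \<Omega> (weak_grad \<Omega> u\<^sub>0))\<^sup>2 + 1 / (2 * \<alpha>) * F\<^sup>2"
proof -
  interpret bounded_domain \<Omega>
    using domain by unfold_locales (auto simp: convex_polytopal_domain_def)
  obtain ut where cont: "\<And>T. T > 0 \<Longrightarrow> u \<in> continuous_into {0..T} (H10_space \<Omega>) (sobolev_norm 1 \<Omega>)"
    and uH2: "\<And>T. T > 0 \<Longrightarrow> u \<in> bochner_L2 {0<..<T} (sobolev_space 2 \<Omega>) (sobolev_norm 2 \<Omega>)"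
    and init: "AE x in lebesgue_on \<Omega>. u 0 x = u\<^sub>0 x"
    and utL2: "\<And>T. T > 0 \<Longrightarrow> ut \<in> bochner_L2 {0<..<T} (L2_space \<Omega>) (L2_norm \<Omega>)"
    and wt: "\<And>T. T > 0 \<Longrightarrow> is_weak_time_deriv \<Omega> T u ut"
    and pde: "AE t in lebesgue_on {0<..}. AE x in lebesgue_on \<Omega>.
      ut t x - (1 + (L2_norm \<Omega> (weak_grad \<Omega> (u t)))\<^sup>2) * weak_laplacian \<Omega> (u t) x = f t x"
    using sol unfolding strong_solution_def by blast
  \<comment> \<open>Any horizon beyond t works; it makes t an interior time.\<close>
  define T where "T = t + 1"
  have T: "0 < T" "t < T" using t by (auto simp: T_def)
  have "{0<..} \<in> sets (lebesgue :: real measure)" by (rule sets_completionI_sets) simp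
  then have I: "{0<..<T} \<in> sets lebesgue" "{0<..} \<in> sets (lebesgue :: real measure)" "{0<..<T} \<subseteq> {0<..}"
    by auto
  have "AE s in lebesgue_on {0<..}. f s \<in> L2_space \<Omega> \<and> L2_norm \<Omega> (f s) \<le> F"
  proof -
    let ?S = "bochner_Linf_norm {0<..} (L2_norm \<Omega>) f"
    have fin: "?S < \<infinity>" and fL: "AE s in lebesgue_on {0<..}. f s \<in> L2_space \<Omega>"
      using f by (auto simp: bochner_Linf_def bochner_measurable_def)
    have "AE s in lebesgue_on {0<..}. ereal (L2_norm \<Omega> (f s)) \<le> ?S"
      unfolding bochner_Linf_norm_def by (rule esssup_AE)
    with fL show ?thesis
    proof eventually_elim
      case (elim s)
      \<comment> \<open>\<open>real_of_ereal\<close> is faithful only on finite values: the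
        hypothesis on f excludes +\<infinity>, and a bound on a real norm excludes
        -\<infinity>.\<close>
      then show ?case using fin unfolding F by (cases ?S) auto
    qed
  qed
  note fT = AE_lebesgue_on_subset[OF this I(2,1,3)]
  note est = weighted_energy_estimate[OF cont[OF T(1)] uH2[OF T(1)] utL2[OF T(1)] wt[OF T(1)]
      AE_lebesgue_on_subset[OF pde I(2,1,3)] fT eigenvalue alpha t T(2)]
  have u0_eq: "weak_grad \<Omega> (u 0) = weak_grad \<Omega> u\<^sub>0"
  proof (rule weak_grad_cong_AE[OF _ _ init])
    show "u 0 \<in> L2_space \<Omega>"
      using cont[OF T(1)] T by (intro sobolev_L2[of _ 1] H10_sobolev) (simp add: continuous_into_def)
    show "u\<^sub>0 \<in> L2_space \<Omega>" by (rule sobolev_L2[OF H10_sobolev[OF u0]])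
  qed
  define K where "K = (LINT s:{0..t}|lebesgue. exp (2 * \<alpha> * s) * (L2_norm \<Omega> (weak_laplacian \<Omega> (u s)))\<^sup>2)"
  define K' where "K' = (LINT s:{0..t}|lebesgue. exp (2 * \<alpha> * s) * (L2_norm \<Omega> (weak_grad \<Omega> (u s)))\<^sup>2
      * (L2_norm \<Omega> (weak_laplacian \<Omega> (u s)))\<^sup>2)"
  \<comment> \<open>Multiplying the estimate by the inverse weight restores the normalisation of the
    claim.\<close>
  define x where "x = exp (- 2 * \<alpha> * t)"
  have x: "0 < x" "x * exp (2 * \<alpha> * t) = 1" by (auto simp: x_def exp_add[symmetric])
  have x1: "x \<le> 1" using alpha t by (simp add: x_def)
  have "exp (2 * \<alpha> * t) * (L2_norm \<Omega> (weak_grad \<Omega> (u t)))\<^sup>2 + \<beta> * K + 2 * K'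
      \<le> (L2_norm \<Omega> (weak_grad \<Omega> u\<^sub>0))\<^sup>2 + F\<^sup>2 / (2 * \<alpha>) * (exp (2 * \<alpha> * t) - 1)"
    using est(3) unfolding u0_eq K_def K'_def set_lebesgue_integral_eq_integral(2)[OF est(1)]
      set_lebesgue_integral_eq_integral(2)[OF est(2)] beta .
  moreover have distrib: "x * (p + c * (z - 1)) = x * p + c * (x * z - x)" for p c z
    by (simp add: algebra_simps)
  ultimately have "x * (exp (2 * \<alpha> * t) * (L2_norm \<Omega> (weak_grad \<Omega> (u t)))\<^sup>2 + \<beta> * K + 2 * K')
      \<le> x * ((L2_norm \<Omega> (weak_grad \<Omega> u\<^sub>0))\<^sup>2 + F\<^sup>2 / (2 * \<alpha>) * (exp (2 * \<alpha> * t) - 1))"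
    using x(1) by (intro mult_left_mono) auto
  also have "x * (exp (2 * \<alpha> * t) * (L2_norm \<Omega> (weak_grad \<Omega> (u t)))\<^sup>2 + \<beta> * K + 2 * K')
      = (x * exp (2 * \<alpha> * t)) * (L2_norm \<Omega> (weak_grad \<Omega> (u t)))\<^sup>2 + \<beta> * x * K + 2 * x * K'"
    by (simp only: distrib_left mult_ac)
  also have "x * ((L2_norm \<Omega> (weak_grad \<Omega> u\<^sub>0))\<^sup>2 + F\<^sup>2 / (2 * \<alpha>) * (exp (2 * \<alpha> * t) - 1))
      = x * (L2_norm \<Omega> (weak_grad \<Omega> u\<^sub>0))\<^sup>2 + F\<^sup>2 / (2 * \<alpha>) * (x * exp (2 * \<alpha> * t) - x)"
    by (rule distrib)
  finally have main: "(L2_norm \<Omega> (weak_grad \<Omega> (u t)))\<^sup>2 + \<beta> * x * K + 2 * x * K'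
      \<le> x * (L2_norm \<Omega> (weak_grad \<Omega> u\<^sub>0))\<^sup>2 + 1 / (2 * \<alpha>) * F\<^sup>2 * (1 - x)"
    unfolding x(2) by simp
  have "0 < \<beta>" using alpha by (simp add: beta field_simps)
  moreover have "x * (L2_norm \<Omega> (weak_grad \<Omega> u\<^sub>0))\<^sup>2 + 1 / (2 * \<alpha>) * F\<^sup>2 * (1 - x)
      \<le> (L2_norm \<Omega> (weak_grad \<Omega> u\<^sub>0))\<^sup>2 + 1 / (2 * \<alpha>) * F\<^sup>2"
    using x x1 alpha(1) by (intro add_mono mult_left_le_one_le mult_left_le) auto
  ultimately show ?thesis
    using main unfolding K_def K'_def x_def by blast
qed

end
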